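(* Let $c,d$ be nonzero complex numbers with $cd\neq -1$, and fix a square root $\sqrt{cd}$. Then for every $n\geq 1$ and every braid $x\in B_n$, \[ Tr^5_n(x)=\frac{1+cd}{\sqrt{cd}}\,V(\hat{x}), \] where $\hat x$ is the closure of $x$, $V$ is the Jones polynomial, and $Tr^5_n(x)=(\sqrt{cd})^{\,w(x)+n}\, tr_n^{\beta}(\varphi_5(x))$ with $\beta=\frac{1+cd}{cd}$.
   Context: $B_n$ is the Artin braid group with generators $\sigma_1,\dots,\sigma_{n-1}$ and relations $\sigma_i\sigma_j=\sigma_j\sigma_i$ for $|i-j|>1$, $\sigma_i\sigma_j\sigma_i=\sigma_j\sigma_i\sigma_j$ for $|i-j|=1$. Here $w(x)$ is the exponent sum (writhe) of $x$ in the $\sigma_i$, so $\sigma_i$ corresponds to a positive crossing. The closure $\hat x$ is the oriented link in $\mathbb{R}^3$ obtained by identifying the top and bottom of $x$. Planar rook algebra: $P_n$ is the monoid of bipartite graphs (diagrams) on two rows of $n$ vertices, each row labelled $1,\dots,n$ from left to right, in which every vertex has degree $0$ or $1$ and every edge joins the top row to the bottom row, and which can be drawn inside the rectangle formed by the vertices without edge crossings. The product $d_1d_2$ is obtained by stacking $d_1$ on top of $d_2$, joining edges that meet in the middle row, and deleting any edge of one diagram that meets a vertex of degree $0$ of the other. $\mathbb{C}P_n$ is the $\mathbb{C}$-algebra with basis $P_n$ and this product extended bilinearly. A vertical line at $i$ is an edge joining top vertex $i$ to bottom vertex $i$. The six elements of $P_2$ are: $d_1$ (no edges); $d_2$ (only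 the vertical line at $1$); $d_3$ (only the edge from bottom vertex $1$ to top vertex $2$); $d_4$ (only the edge from top vertex $1$ to bottom vertex $2$); $d_5$ (only the vertical line at $2$); $d_6$ (vertical lines at $1$ and $2$). For $1\le i\le n-1$, $d_{ji}\in P_n$ is the diagram that is $d_j$ on vertices $i,i+1$ and has vertical lines at all other positions. $\varphi_5:B_n\to(\mathbb{C}P_n)^*$ (units of $\mathbb{C}P_n$) is the group homomorphism with \[ \varphi_5(\sigma_i)=(1-c-d+cd)d_{1i}-d_{2i}+c\,d_{3i}+d\,d_{4i}-cd\,d_{5i}+d_{6i}. \] For $\beta\in\mathbb{C}$, the bubble trace $tr_n^\beta:\mathbb{C}P_n\to\mathbb{C}$ is the linear function with $tr_n^\beta(D)=\beta^{k(D)}$ for $D\in P_n$, where $k(D)$ is the number of vertical lines of $D$. Jones polynomial convention: $V$ is the invariant of oriented links with values in $\mathbb{Z}[s,s^{-1}]$, evaluated here at $s=\sqrt{cd}$, determined by $V(\text{unknot})=1$ and the skein relation $s^{-2}V(L_+)-s^{2}V(L_-)=(s^{-1}-s)V(L_0)$, where $L_+,L_-,L_0$ differ only at one crossing, which is positive, negative, or smoothed respecting orientation (for closed braids: the closures of $x\sigma_i$, $x\sigma_i^{-1}$, $x$). Equivalently, it is the usual Jones polynomial with $t^{1/2}=-s$. *)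

theory Defs
  imports
    "HOL-Analysis.Analysis"
    "HOL-Analysis.Cross3"
    "HOL-Algebra.Ring"
    "HOL-Library.Poly_Mapping"
begin

section \<open>The Artin braid group\<close>

text \<open>A letter \<open>(i, True)\<close> stands for $\sigma_i$ and \<open>(i, False)\<close> for $\sigma_i^{-1}$.\<close>

type_synonym braid_word = "(nat \<times> bool) list"

definition braid_words :: "nat \<Rightarrow> braid_word set" where
  "braid_words n = lists ({1..<n} \<times> UNIV)"

inductive braid_eq :: "nat \<Rightarrow> braid_word \<Rightarrow> braid_word \<Rightarrow> bool" for n where
  refl: "u \<in> braid_words n \<Longrightarrow> braid_eq n u u"
| sym: "braid_eq n u v \<Longrightarrow> braid_eq n v u"
| trans: "braid_eq n u v \<Longrightarrow> braid_eq n v w \<Longrightarrow> braid_eq n u w"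
| append: "braid_eq n u u' \<Longrightarrow> braid_eq n v v' \<Longrightarrow> braid_eq n (u @ v) (u' @ v')"
| cancel: "i \<in> {1..<n} \<Longrightarrow> braid_eq n [(i, b), (i, \<not> b)] []"
| commute: "i \<in> {1..<n} \<Longrightarrow> j \<in> {1..<n} \<Longrightarrow> \<bar>int i - int j\<bar> > 1 \<Longrightarrow>
    braid_eq n [(i, True), (j, True)] [(j, True), (i, True)]"
| braid: "i \<in> {1..<n} \<Longrightarrow> j \<in> {1..<n} \<Longrightarrow> \<bar>int i - int j\<bar> = 1 \<Longrightarrow>
    braid_eq n [(i, True), (j, True), (i, True)] [(j, True), (i, True), (j, True)]"

definition braid_class :: "nat \<Rightarrow> braid_word \<Rightarrow> braid_word set" where
  "braid_class n u = {v. braid_eq n u v}"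

definition braid_group :: "nat \<Rightarrow> braid_word set monoid" where
  "braid_group n =
    \<lparr>carrier = braid_class n ` braid_words n,
     mult = (\<lambda>X Y. \<Union>u\<in>X. \<Union>v\<in>Y. braid_class n (u @ v)),
     one = braid_class n []\<rparr>"

definition braid_gen :: "nat \<Rightarrow> nat \<Rightarrow> braid_word set" where
  "braid_gen n i = braid_class n [(i, True)]"

definition word_writhe :: "braid_word \<Rightarrow> int" where
  "word_writhe u = (\<Sum>(i, b)\<leftarrow>u. if b then 1 else -1)"

text \<open>All words representing a braid have the same exponent sum, so the image below is a
  singleton for \<open>x \<in> carrier (braid_group n)\<close>.\<close>

definition writhe :: "braid_word set \<Rightarrow> int" where
  "writhe x = the_elem (word_writhe ` x)"


section \<open>The planar rook algebra\<close>

text \<open>A diagram is its set of edges, \<open>(t, b)\<close> being the edge from top vertex \<open>t\<close> to bottom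
  vertex \<open>b\<close>. Two edges can be drawn inside the rectangle without crossing iff their top ends
  and their bottom ends are in the same left-to-right order.\<close>

type_synonym rook_diagram = "(nat \<times> nat) set"

definition planar_rook :: "nat \<Rightarrow> rook_diagram set" where
  "planar_rook n = {D. D \<subseteq> {1..n} \<times> {1..n} \<and>
     (\<forall>(t, b)\<in>D. \<forall>(t', b')\<in>D. (t = t' \<longleftrightarrow> b = b') \<and> (t < t' \<longleftrightarrow> b < b'))}"

text \<open>An element of the algebra is its coefficient function. Stacking \<open>D1\<close> on top of \<open>D2\<close> is
  the relational composition \<open>D1 O D2\<close>.\<close>

definition planar_rook_algebra :: "nat \<Rightarrow> (rook_diagram \<Rightarrow> complex) ring" where
  "planar_rook_algebra n =
    \<lparr>carrier = {f. \<forall>D. D \<notin> planar_rook n \<longrightarrow> f D = 0},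
     mult = (\<lambda>f g D. \<Sum>(D1, D2) \<in> {p \<in> planar_rook n \<times> planar_rook n. fst p O snd p = D}.
               f D1 * g D2),
     one = (\<lambda>D. if D = Id_on {1..n} then 1 else 0),
     zero = (\<lambda>D. 0),
     add = (\<lambda>f g D. f D + g D)\<rparr>"

text \<open>The edge sets of the six elements of $P_2$, placed on the vertices \<open>i\<close>, \<open>i + 1\<close>.\<close>

definition local_rook :: "nat \<Rightarrow> nat \<Rightarrow> rook_diagram" where
  "local_rook j i =
     [{}, {(i, i)}, {(i + 1, i)}, {(i, i + 1)}, {(i + 1, i + 1)}, {(i, i), (i + 1, i + 1)}]
       ! (j - 1)"

definition rook_d :: "nat \<Rightarrow> nat \<Rightarrow> nat \<Rightarrow> rook_diagram" where
  "rook_d n j i = local_rook j i \<union> Id_on ({1..n} - {i, i + 1})"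

definition rook_basis :: "rook_diagram \<Rightarrow> rook_diagram \<Rightarrow> complex" where
  "rook_basis D = (\<lambda>D'. if D' = D then 1 else 0)"

definition phi5_gen :: "complex \<Rightarrow> complex \<Rightarrow> nat \<Rightarrow> nat \<Rightarrow> rook_diagram \<Rightarrow> complex" where
  "phi5_gen c d n i = (\<lambda>D.
     (1 - c - d + c * d) * rook_basis (rook_d n 1 i) D
     - rook_basis (rook_d n 2 i) D
     + c * rook_basis (rook_d n 3 i) D
     + d * rook_basis (rook_d n 4 i) D
     - c * d * rook_basis (rook_d n 5 i) D
     + rook_basis (rook_d n 6 i) D)"

definition vertical_lines :: "rook_diagram \<Rightarrow> nat" where
  "vertical_lines D = card {i. (i, i) \<in> D}"

definition bubble_trace :: "nat \<Rightarrow> complex \<Rightarrow> (rook_diagram \<Rightarrow> complex) \<Rightarrow> complex" where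
  "bubble_trace n \<beta> f = (\<Sum>D\<in>planar_rook n. f D * \<beta> ^ vertical_lines D)"

text \<open>Here \<open>s\<close> is the chosen square root of \<open>c * d\<close> and \<open>\<phi>\<close> is the homomorphism $\varphi_5$.\<close>

definition Tr5 :: "complex \<Rightarrow> complex \<Rightarrow> complex \<Rightarrow>
    (braid_word set \<Rightarrow> rook_diagram \<Rightarrow> complex) \<Rightarrow> nat \<Rightarrow> braid_word set \<Rightarrow> complex" where
  "Tr5 c d s \<phi> n x =
     s powi (writhe x + int n) * bubble_trace n ((1 + c * d) / (c * d)) (\<phi> x)"


section \<open>Oriented links in three-space\<close>

text \<open>Tame oriented links are represented by polygonal ones: a link is the finite set of its
  directed edges \<open>(a, b)\<close>, from \<open>a\<close> to \<open>b\<close>. Every vertex is the start of exactly one edge and the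
  end of exactly one edge, and distinct edges meet at most in common vertices.\<close>

type_synonym point = "real ^ 3"

type_synonym polygon = "(point \<times> point) set"

definition support :: "polygon \<Rightarrow> point set" where
  "support E = (\<Union>(a, b)\<in>E. closed_segment a b)"

definition oriented_link :: "polygon \<Rightarrow> bool" where
  "oriented_link E \<longleftrightarrow>
     finite E \<and> E \<noteq> {} \<and> (\<forall>(a, b)\<in>E. a \<noteq> b) \<and>
     inj_on fst E \<and> inj_on snd E \<and> fst ` E = snd ` E \<and>
     (\<forall>(a, b)\<in>E. \<forall>(a', b')\<in>E. (a, b) \<noteq> (a', b') \<longrightarrow>
        closed_segment a b \<inter> closed_segment a' b' \<subseteq> {a, b} \<inter> {a', b'})"

text \<open>Isotopy of polygonal links is the equivalence generated by Reidemeister's elementary moves,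
  which replace one side of a triangle not otherwise met by the link by the two other sides (or,
  for a degenerate triangle, subdivide an edge).\<close>

definition triangle_move :: "polygon \<Rightarrow> polygon \<Rightarrow> bool" where
  "triangle_move E E' \<longleftrightarrow> oriented_link E \<and> oriented_link E' \<and>
     (\<exists>R a b p. E = R \<union> {(a, b)} \<and> E' = R \<union> {(a, p), (p, b)} \<and>
        convex hull {a, b, p} \<inter> support R \<subseteq> {a, b})"

definition isotopic :: "polygon \<Rightarrow> polygon \<Rightarrow> bool" where
  "isotopic = equivclp triangle_move"

definition unknot :: "polygon \<Rightarrow> bool" where
  "unknot E \<longleftrightarrow> (\<exists>a b p. \<not> collinear {a, b, p} \<and> isotopic {(a, b), (b, p), (p, a)} E)"

text \<open>The three links agree outside the octahedron with vertices \<open>a\<close>, \<open>b\<close>, \<open>c\<close>, \<open>d\<close>, \<open>m + v\<close>,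
  \<open>m - v\<close>, where \<open>m\<close> is the point in which the diagonals \<open>a d\<close> and \<open>b c\<close> of a planar
  quadrilateral cross. Viewed from the side of \<open>v\<close>, the strand from \<open>b\<close> to \<open>c\<close> passes over the
  strand from \<open>a\<close> to \<open>d\<close> in \<open>Lp\<close> and under it in \<open>Lm\<close>. By the condition on the triple product,
  turning the direction of the overcrossing strand counterclockwise to that of the undercrossing
  one takes less than a half turn in \<open>Lp\<close>, so that this crossing is positive, and that in \<open>Lm\<close>
  negative.\<close>

definition skein_triple :: "polygon \<Rightarrow> polygon \<Rightarrow> polygon \<Rightarrow> bool" where
  "skein_triple Lp Lm L0 \<longleftrightarrow> oriented_link Lp \<and> oriented_link Lm \<and> oriented_link L0 \<and>
     (\<exists>R a b c d m v.
        m \<in> open_segment a d \<and> m \<in> open_segment b c \<and>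
        cross3 (c - b) (d - a) \<bullet> v > 0 \<and>
        convex hull {a, b, c, d, m + v, m - v} \<inter> support R \<subseteq> {a, b, c, d} \<and>
        Lp = R \<union> {(a, d), (b, m + v), (m + v, c)} \<and>
        Lm = R \<union> {(a, d), (b, m - v), (m - v, c)} \<and>
        L0 = R \<union> {(a, c), (b, d)})"


section \<open>The Jones polynomial\<close>

text \<open>\<open>int \<Rightarrow>\<^sub>0 int\<close> with its convolution product is the ring $\mathbb{Z}[s, s^{-1}]$; the key
  of a monomial is its exponent.\<close>

type_synonym laurent = "int \<Rightarrow>\<^sub>0 int"

definition s_power :: "int \<Rightarrow> laurent" where
  "s_power k = Poly_Mapping.single k 1"

definition laurent_eval :: "laurent \<Rightarrow> complex \<Rightarrow> complex" where
  "laurent_eval p s = (\<Sum>k\<in>Poly_Mapping.keys p. of_int (Poly_Mapping.lookup p k) * s powi k)"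

definition jones_polynomial :: "(polygon \<Rightarrow> laurent) \<Rightarrow> bool" where
  "jones_polynomial V \<longleftrightarrow>
     (\<forall>L L'. oriented_link L \<longrightarrow> oriented_link L' \<longrightarrow> isotopic L L' \<longrightarrow> V L = V L') \<and>
     (\<forall>L. unknot L \<longrightarrow> V L = 1) \<and>
     (\<forall>Lp Lm L0. skein_triple Lp Lm L0 \<longrightarrow>
        s_power (-2) * V Lp - s_power 2 * V Lm = (s_power (-1) - s_power 1) * V L0)"


section \<open>Closed braids\<close>

text \<open>The plane of the braid diagram has \<open>x\<close> pointing right and \<open>y\<close> pointing up and is seen from
  large \<open>z\<close>. The word is read from top to bottom, its letter number \<open>k\<close> lying between the heights
  \<open>- k\<close> and \<open>- k - 1\<close>, and all strands are directed downwards; then $\sigma_i$ is a positive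
  crossing if the strand starting at position \<open>i + 1\<close> is the upper one.\<close>

definition pt :: "real \<Rightarrow> real \<Rightarrow> real \<Rightarrow> point" where
  "pt x y z = vector [x, y, z]"

fun braid_layer :: "nat \<Rightarrow> nat \<Rightarrow> nat \<times> bool \<Rightarrow> polygon" where
  "braid_layer n k (i, b) =
     (let m = pt (real i + 1/2) (- real k - 1/2) (if b then 1/2 else - 1/2) in
      (\<lambda>j. (pt (real j) (- real k) 0, pt (real j) (- real k - 1) 0)) ` ({1..n} - {i, i + 1}) \<union>
      {(pt (real i) (- real k) 0, pt (real i + 1) (- real k - 1) 0),
       (pt (real i + 1) (- real k) 0, m),
       (m, pt (real i) (- real k - 1) 0)})"

text \<open>The bottom end of strand \<open>j\<close> is joined to its top end by an arc running behind the braid,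
  in the plane \<open>x = j\<close>.\<close>

definition closing_arc :: "nat \<Rightarrow> nat \<Rightarrow> polygon" where
  "closing_arc l j =
     {(pt (real j) (- real l) 0, pt (real j) (- real l) (-1)),
      (pt (real j) (- real l) (-1), pt (real j) 1 (-1)),
      (pt (real j) 1 (-1), pt (real j) 0 0)}"

definition braid_closure :: "nat \<Rightarrow> braid_word \<Rightarrow> polygon" where
  "braid_closure n u =
     (\<Union>k<length u. braid_layer n k (u ! k)) \<union> (\<Union>j\<in>{1..n}. closing_arc (length u) j)"

end

theory Submission
  imports Defs
begin

text \<open>
  Both sides are values of functions \<open>H n w\<close> of a number of strands and a braid word. Either function
  satisfies the relations of a Markov trace: the skein relation at every letter, invariance under
  cancellation, far commutation and the braid relation, and
  $H(n+1, u \sigma_n^{\pm 1} v) = H(n, u v)$ and $H(n+1, u) = (s + s^{-1}) H(n, u)$ for words $u$, $v$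
  on \<open>n\<close> strands (locale \<open>skein_functional\<close>). These relations determine \<open>H\<close> by its value at the trivial
  braid with one strand (\<open>skein_functional_unique\<close>): modulo words with fewer letters the signs of the
  letters are immaterial, so a word behaves like a word in the Coxeter generators of a symmetric
  group, and such a word can be brought to a form with a repeated letter, which leads to shorter
  words, or with at most one occurrence of the last generator, which leads to fewer strands.

  For the left-hand side, the planar rook algebra acts on the functions of subsets of
  $\{1, \dots, n\}$. A planar diagram carries a set to itself only if it fixes all its points, so the
  bubble trace with parameter $1 + y$ is the trace of this representation in which a set $S$ has the
  weight $y^{|S|}$. The image of $\sigma_i$ becomes a local operator, the R-matrix of the Jones
  polynomial, and \<open>Tr5\<close> a state sum (\<open>Tr5_eq_state_sum\<close>). All relations are then computations on two or
  three neighbouring sites (\<open>state_sum_skein_functional\<close>).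

  For the right-hand side, isotopies between closed braids have to be composed of triangle moves. A
  closed braid is cut along horizontal planes into slabs of straight strands. Two strands
  of a slab are disjoint iff their difference, a segment in the plane, misses zero. Consequently the
  vertices in a window of slabs can be moved horizontally, one after another, as soon as for each pair
  of strands the differences of the old and new positions stay in a convex set without zero
  (\<open>link_iso_separated\<close>). The second and third Reidemeister moves and far commutation become finite checks of
  this condition, which exhibit one strand in front of the other or to its left. Blank letters
  make it possible to delete crossings without changing the heights of the others; they can be
  moved to the end of a word and be removed there (\<open>blank_closure_drop_blank\<close>). For stabilization the
  loop formed by the last strand and its closing arc is contracted by a fan of triangles
  (\<open>link_iso_contract_loop\<close>). The skein relation applies directly, because the crossings of a closed
  braid have the shape that a skein triple prescribes (\<open>blank_closure_skein_triple\<close>).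
\<close>


section \<open>Braid words and skein functionals\<close>

text \<open>Letters are bare indices: modulo shorter words the skein relation makes the sign of a letter
  immaterial, so that only the positive relations of the braid group have to be kept.\<close>

inductive artin_move :: "nat list \<Rightarrow> nat list \<Rightarrow> bool" where
  stay: "artin_move u u"
| chain: "artin_move u v \<Longrightarrow> artin_move v w \<Longrightarrow> artin_move u w"
| commute: "1 < \<bar>int i - int j\<bar> \<Longrightarrow> artin_move (u @ [i, j] @ v) (u @ [j, i] @ v)"
| braid: "\<bar>int i - int j\<bar> = 1 \<Longrightarrow> artin_move (u @ [i, j, i] @ v) (u @ [j, i, j] @ v)"

lemma artin_move_context:
  "artin_move u v \<Longrightarrow> artin_move (p @ u @ q) (p @ v @ q)"
proof (induction rule: artin_move.induct)
  case (commute i j u v)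
  then show ?case using artin_move.commute[of i j "p @ u" "v @ q"] by simp
next
  case (braid i j u v)
  then show ?case using artin_move.braid[of i j "p @ u" "v @ q"] by simp
qed (auto intro: artin_move.intros)

lemma artin_move_set: "artin_move u v \<Longrightarrow> set v = set u"
  by (induction rule: artin_move.induct) auto

lemma artin_move_length: "artin_move u v \<Longrightarrow> length v = length u"
  by (induction rule: artin_move.induct) auto

lemma artin_move_past:
  "(\<And>j. j \<in> set w \<Longrightarrow> 1 < \<bar>int i - int j\<bar>) \<Longrightarrow> artin_move (i # w) (w @ [i])"
proof (induction w)
  case (Cons j w)
  have "artin_move (i # j # w) (j # i # w)"
    using artin_move.commute[of i j "[]" w] Cons.prems by simp
  moreover have "artin_move (j # i # w) (j # w @ [i])"
    using artin_move_context[OF Cons.IH, of "[j]" "[]"] Cons.prems by simp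
  ultimately show ?case by (auto intro: artin_move.chain)
qed (auto intro: artin_move.stay)

lemma artin_move_past':
  "(\<And>j. j \<in> set w \<Longrightarrow> 1 < \<bar>int i - int j\<bar>) \<Longrightarrow> artin_move (w @ [i]) (i # w)"
proof (induction w)
  case (Cons j w)
  have "artin_move (j # i # w) (i # j # w)"
    using artin_move.commute[of j i "[]" w] Cons.prems by (simp add: abs_minus_commute)
  moreover have "artin_move (j # w @ [i]) (j # i # w)"
    using artin_move_context[OF Cons.IH, of "[j]" "[]"] Cons.prems by simp
  ultimately show ?case by (auto intro: artin_move.chain)
qed (auto intro: artin_move.stay)

lemma count_list_0_split: "count_list w n \<noteq> 0 \<Longrightarrow> \<exists>u v. w = u @ n # v \<and> count_list u n = 0"
  by (metis count_list_0_iff split_list_first)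

text \<open>Two consecutive occurrences of the largest index \<open>n\<close> enclose a word in smaller indices. By
  induction that word has a repeated letter or contains \<open>n - 1\<close> at most once. If \<open>n - 1\<close> does not
  occur, the two letters \<open>n\<close> can be moved next to each other; if it occurs once, all other letters
  move out of the way, and the braid relation trades the two letters \<open>n\<close> for a single one.\<close>

lemma artin_normal_form:
  assumes "set w \<subseteq> {1..n}"
  shows "\<exists>w'. artin_move w w' \<and> ((\<exists>u i v. w' = u @ [i, i] @ v) \<or> count_list w' n \<le> 1)"
  using assms
proof (induction n arbitrary: w)
  case 0
  then show ?case by (auto intro!: exI[of _ "[]"] artin_move.stay)
next
  case (Suc n)
  note outer = Suc.IH
  from Suc.prems show ?case
  proof (induction "count_list w (Suc n)" arbitrary: w rule: less_induct)
    case (less w)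
    show ?case
    proof (cases "count_list w (Suc n) \<le> 1")
      case True
      then show ?thesis by (auto intro: artin_move.stay)
    next
      case False
      then obtain u r where w1: "w = u @ Suc n # r" "count_list u (Suc n) = 0"
        using count_list_0_split[of w "Suc n"] by auto
      with False have "count_list r (Suc n) \<noteq> 0" by auto
      then obtain m v where r: "r = m @ Suc n # v" "count_list m (Suc n) = 0"
        using count_list_0_split[of r "Suc n"] by auto
      have w: "w = u @ (Suc n # m @ [Suc n]) @ v" using w1 r by simp
      have "set m \<subseteq> {1..n}"
      proof
        fix x assume x: "x \<in> set m"
        then have "x \<noteq> Suc n" using r(2) by (metis count_list_0_iff)
        moreover have "x \<in> {1..Suc n}" using x less.prems w by auto
        ultimately show "x \<in> {1..n}" by auto
      qed
      then obtain m' where m': "artin_move m m'"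
        "(\<exists>u i v. m' = u @ [i, i] @ v) \<or> count_list m' n \<le> 1"
        and setm: "set m \<subseteq> {1..n}" using outer by blast
      have setm': "set m' \<subseteq> {1..n}" using artin_move_set[OF m'(1)] setm by simp
      have mv: "artin_move w (u @ (Suc n # m' @ [Suc n]) @ v)"
        using artin_move_context[OF m'(1), of "u @ [Suc n]" "Suc n # v"] w by simp
      consider (dbl) a i b where "m' = a @ [i, i] @ b" | (zero) "count_list m' n = 0"
        | (one) "count_list m' n = 1"
        using m'(2) by (fastforce simp: le_Suc_eq)
      then show ?thesis
      proof cases
        case dbl
        have "u @ (Suc n # m' @ [Suc n]) @ v
            = (u @ Suc n # a) @ [i, i] @ (b @ Suc n # v)"
          using dbl by simp
        then show ?thesis using mv by metis
      next
        case zero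
        then have "n \<notin> set m'" by (simp add: count_list_0_iff)
        then have far: "1 < \<bar>int (Suc n) - int j\<bar>" if "j \<in> set m'" for j
          using setm' that by (cases "j = n") (fastforce simp: subset_iff)+
        have "artin_move (u @ (Suc n # m') @ ([Suc n] @ v)) (u @ (m' @ [Suc n]) @ ([Suc n] @ v))"
          by (intro artin_move_context artin_move_past far)
        then have "artin_move w ((u @ m') @ [Suc n, Suc n] @ v)"
          using mv by (auto intro: artin_move.chain)
        then show ?thesis by blast
      next
        case one
        then obtain a b where ab: "m' = a @ n # b" "count_list a n = 0"
          using count_list_0_split[of m' n] by auto
        with one have b0: "count_list b n = 0" by auto
        have n0: "n \<ge> 1" using ab(1) setm' by auto
        have far: "1 < \<bar>int (Suc n) - int j\<bar>" if "j \<in> set a \<union> set b" for j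
        proof -
          have "j \<noteq> n" using that ab(2) b0 by (metis Un_iff count_list_0_iff)
          moreover have "j \<le> n" using that setm' ab(1) by auto
          ultimately show ?thesis by auto
        qed
        have 1: "artin_move (u @ (Suc n # a) @ (n # b @ Suc n # v))
            (u @ (a @ [Suc n]) @ (n # b @ Suc n # v))"
          by (intro artin_move_context artin_move_past far) auto
        have 2: "artin_move ((u @ a @ [Suc n, n]) @ (b @ [Suc n]) @ v)
            ((u @ a @ [Suc n, n]) @ (Suc n # b) @ v)"
          by (intro artin_move_context artin_move_past' far) auto
        have 3: "artin_move ((u @ a) @ [Suc n, n, Suc n] @ (b @ v)) ((u @ a) @ [n, Suc n, n] @ (b @ v))"
          by (rule artin_move.braid) simp
        let ?w = "(u @ a) @ [n, Suc n, n] @ (b @ v)"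
        have m3: "artin_move w ?w"
          using mv 1 2 3 ab(1) by (auto intro: artin_move.chain)
        have "count_list a (Suc n) = 0" "count_list b (Suc n) = 0"
          using setm' ab(1) by (auto simp: count_list_0_iff)
        then have "count_list ?w (Suc n) < count_list w (Suc n)"
          using w1 r by simp
        moreover have "set ?w \<subseteq> {1..Suc n}"
          using artin_move_set[OF m3] less.prems by simp
        ultimately obtain w' where "artin_move ?w w'"
          "(\<exists>u i v. w' = u @ [i, i] @ v) \<or> count_list w' (Suc n) \<le> 1"
          using less.hyps by blast
        then show ?thesis using m3 by (blast intro: artin_move.chain)
      qed
    qed
  qed
qed

text \<open>These are the relations of a normalized Markov trace on the Hecke algebras. Letting
  stabilization act in the middle of a word makes it do the work of conjugation invariance as
  well.\<close>

locale skein_functional =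
  fixes s :: complex and H :: "nat \<Rightarrow> braid_word \<Rightarrow> complex"
  assumes s_nonzero: "s \<noteq> 0"
    and skein: "\<lbrakk>u \<in> braid_words n; v \<in> braid_words n; i \<in> {1..<n}\<rbrakk> \<Longrightarrow>
      H n (u @ (i, True) # v) / s\<^sup>2 - s\<^sup>2 * H n (u @ (i, False) # v) = (1 / s - s) * H n (u @ v)"
    and cancel: "\<lbrakk>u \<in> braid_words n; v \<in> braid_words n; i \<in> {1..<n}\<rbrakk> \<Longrightarrow>
      H n (u @ [(i, True), (i, False)] @ v) = H n (u @ v)"
    and commute: "\<lbrakk>u \<in> braid_words n; v \<in> braid_words n; i \<in> {1..<n}; j \<in> {1..<n};
        1 < \<bar>int i - int j\<bar>\<rbrakk> \<Longrightarrow>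
      H n (u @ [(i, True), (j, True)] @ v) = H n (u @ [(j, True), (i, True)] @ v)"
    and braid: "\<lbrakk>u \<in> braid_words n; v \<in> braid_words n; i \<in> {1..<n}; Suc i \<in> {1..<n}\<rbrakk> \<Longrightarrow>
      H n (u @ [(i, True), (Suc i, True), (i, True)] @ v) =
      H n (u @ [(Suc i, True), (i, True), (Suc i, True)] @ v)"
    and stabilize: "\<lbrakk>u \<in> braid_words n; v \<in> braid_words n; n \<ge> 1\<rbrakk> \<Longrightarrow>
      H (Suc n) (u @ (n, b) # v) = H n (u @ v)"
    and split: "\<lbrakk>u \<in> braid_words n; n \<ge> 1\<rbrakk> \<Longrightarrow> H (Suc n) u = (s + 1 / s) * H n u"
begin

definition pos :: "nat list \<Rightarrow> braid_word" where
  "pos w = map (\<lambda>i. (i, True)) w"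

lemma pos_braid_words: "set w \<subseteq> {1..<n} \<Longrightarrow> pos w \<in> braid_words n"
  by (auto simp: pos_def braid_words_def)

lemma pos_append: "pos (u @ v) = pos u @ pos v"
  by (simp add: pos_def)

text \<open>The skein relation at one letter involves the two values that differ in the sign of that letter
  and the value at a shorter word. If the latter is zero, the former vanish together; hence all
  signs can be made positive one after another.\<close>

lemma sign_change:
  assumes shorter: "\<And>v. v \<in> braid_words n \<Longrightarrow> length v < length w \<Longrightarrow> H n v = 0"
    and "w \<in> braid_words n" and "w = u @ v"
    and "H n (u @ pos (map fst v)) = 0"
  shows "H n w = 0"
  using assms(3,4)
proof (induction v arbitrary: u)
  case Nil
  then show ?case by (simp add: pos_def)
next
  case (Cons a v)
  obtain i b where a: "a = (i, b)" by (cases a)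
  let ?v = "pos (map fst v)"
  have u: "u \<in> braid_words n" and i: "i \<in> {1..<n}" and v: "?v \<in> braid_words n"
    using Cons.prems(1) assms(2) a
    by (force simp: braid_words_def pos_def)+
  have p: "H n (u @ (i, True) # ?v) = 0" using Cons.prems(2) a by (simp add: pos_def)
  have "u @ ?v \<in> braid_words n" using u v by (auto simp: braid_words_def)
  moreover have "length (u @ ?v) < length w" using Cons.prems(1) by (simp add: pos_def)
  ultimately have "H n (u @ ?v) = 0" by (rule shorter)
  then have "H n (u @ (i, False) # ?v) = 0"
    using skein[OF u v i] p s_nonzero by simp
  with p have "H n ((u @ [a]) @ ?v) = 0" using a by (cases b) auto
  then show ?case using Cons.IH[of "u @ [a]"] Cons.prems(1) by simp
qed

lemma artin_move_invariant:
  "artin_move w w' \<Longrightarrow> set w \<subseteq> {1..<n} \<Longrightarrow> H n (pos w) = H n (pos w')"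
proof (induction rule: artin_move.induct)
  case (chain u v w)
  then show ?case using artin_move_set by metis
next
  case (commute i j u v)
  then have "pos u \<in> braid_words n" "pos v \<in> braid_words n" "i \<in> {1..<n}" "j \<in> {1..<n}"
    by (auto intro!: pos_braid_words)
  then show ?case using skein_functional.commute[OF skein_functional_axioms] commute(1)
    by (simp add: pos_append) (simp add: pos_def)
next
  case (braid i j u v)
  then have *: "pos u \<in> braid_words n" "pos v \<in> braid_words n" "i \<in> {1..<n}" "j \<in> {1..<n}"
    by (auto intro!: pos_braid_words)
  from braid(1) consider "j = Suc i" | "i = Suc j" by linarith
  then show ?case
  proof cases
    case 1
    then show ?thesis
      using skein_functional.braid[OF skein_functional_axioms *(1-3)] *
      by (simp add: pos_append) (simp add: pos_def)
  next
    case 2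
    then show ?thesis
      using skein_functional.braid[OF skein_functional_axioms *(1,2,4)] *
      by (simp add: pos_append) (simp add: pos_def)
  qed
qed auto

text \<open>The induction is on the number of strands and then on the length of the word. By \<open>sign_change\<close>
  the word may be taken positive and in the form of \<open>artin_normal_form\<close>. A repeated letter
  $\sigma_i^2$ is related by skein and cancellation to shorter words; a word that contains the last
  generator at most once loses a strand.\<close>

lemma vanishes_everywhere:
  assumes base: "H 1 [] = 0"
  shows "\<lbrakk>w \<in> braid_words n; n \<ge> 1\<rbrakk> \<Longrightarrow> H n w = 0"
proof (induction n arbitrary: w)
  case 0
  then show ?case by simp
next
  case (Suc n)
  note fewer_strands = Suc.IH
  show ?case
  proof (cases "n = 0")
    case True
    then have "w = []" using Suc.prems by (auto simp: braid_words_def)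
    then show ?thesis using base True by simp
  next
    case False
    then have n1: "n \<ge> 1" by simp
    from Suc.prems(1) show ?thesis
    proof (induction "length w" arbitrary: w rule: less_induct)
      case (less w)
      have shorter: "H (Suc n) v = 0" if "v \<in> braid_words (Suc n)" "length v < length w" for v
        using less.hyps that by blast
      let ?m = "map fst w"
      have setm: "set ?m \<subseteq> {1..n}" using less.prems by (fastforce simp: braid_words_def)
      obtain w' where w': "artin_move ?m w'"
        "(\<exists>u i v. w' = u @ [i, i] @ v) \<or> count_list w' n \<le> 1"
        using artin_normal_form[OF setm] by blast
      have set': "set w' \<subseteq> {1..n}" and len': "length w' = length w"
        using artin_move_set[OF w'(1)] artin_move_length[OF w'(1)] setm by auto
      have bw: "pos u \<in> braid_words (Suc n)" if "set u \<subseteq> {1..n}" for u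
        using that by (auto intro!: pos_braid_words)
      have bw_n: "pos u \<in> braid_words n" if "set u \<subseteq> {1..n}" "count_list u n = 0" for u
      proof (rule pos_braid_words, rule subsetI)
        fix x assume "x \<in> set u"
        moreover from this have "x \<noteq> n" using that(2) by (metis count_list_0_iff)
        ultimately show "x \<in> {1..<n}" using that(1) by fastforce
      qed
      consider (dbl) u i v where "w' = u @ [i, i] @ v" | (zero) "count_list w' n = 0"
        | (one) "count_list w' n = 1"
        using w'(2) by (fastforce simp: le_Suc_eq)
      then have "H (Suc n) (pos w') = 0"
      proof cases
        case dbl
        have uv: "pos u \<in> braid_words (Suc n)" "pos v \<in> braid_words (Suc n)" "i \<in> {1..<Suc n}"
          using set' dbl by (auto intro!: bw)
        have "H (Suc n) (pos u @ pos v) = 0"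
        proof (rule shorter)
          show "pos u @ pos v \<in> braid_words (Suc n)" using uv by (auto simp: braid_words_def)
          show "length (pos u @ pos v) < length w" using len' dbl by (simp add: pos_def)
        qed
        then have c: "H (Suc n) (pos u @ [(i, True), (i, False)] @ pos v) = 0"
          using cancel[OF uv] by simp
        have uT: "pos u @ [(i, True)] \<in> braid_words (Suc n)" using uv by (auto simp: braid_words_def)
        have "H (Suc n) ((pos u @ [(i, True)]) @ pos v) = 0"
        proof (rule shorter)
          show "(pos u @ [(i, True)]) @ pos v \<in> braid_words (Suc n)"
            using uv by (auto simp: braid_words_def)
          show "length ((pos u @ [(i, True)]) @ pos v) < length w" using len' dbl by (simp add: pos_def)
        qed
        then have "H (Suc n) (pos u @ (i, True) # (i, True) # pos v) = 0"
          using skein[OF uT uv(2,3)] c s_nonzero by simp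
        then show ?thesis using dbl by (simp add: pos_append) (simp add: pos_def)
      next
        case zero
        then have "pos w' \<in> braid_words n" using set' by (rule bw_n[rotated])
        then show ?thesis using split[of "pos w'" n] fewer_strands n1 by simp
      next
        case one
        then obtain u v where uv: "w' = u @ n # v" "count_list u n = 0"
          using count_list_0_split[of w' n] by auto
        with one have "count_list v n = 0" by auto
        with uv set' have b: "pos u \<in> braid_words n" "pos v \<in> braid_words n"
          by (auto intro!: bw_n)
        then have "pos u @ pos v \<in> braid_words n" by (auto simp: braid_words_def)
        then have "H (Suc n) (pos u @ (n, True) # pos v) = 0"
          using stabilize[OF b n1] fewer_strands n1 by simp
        then show ?thesis using uv by (simp add: pos_append) (simp add: pos_def)
      qed
      moreover have "H (Suc n) (pos ?m) = H (Suc n) (pos w')"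
        using artin_move_invariant[OF w'(1), of "Suc n"] setm by fastforce
      ultimately have "H (Suc n) ([] @ pos ?m) = 0" by simp
      then show "H (Suc n) w = 0"
        using sign_change[OF shorter less.prems, of "[]" w] by simp
    qed
  qed
qed

end

text \<open>All the relations are linear, so the difference of two functionals is again one.\<close>

lemma skein_functional_unique:
  assumes "skein_functional s F" "skein_functional s G" "F 1 [] = G 1 []"
    and "w \<in> braid_words n" "n \<ge> 1"
  shows "F n w = G n w"
proof -
  interpret F: skein_functional s F by fact
  interpret G: skein_functional s G by fact
  interpret D: skein_functional s "\<lambda>n w. F n w - G n w"
  proof
    show "s \<noteq> 0" by (rule F.s_nonzero)
  next
    fix u v n i assume "u \<in> braid_words n" "v \<in> braid_words n" "i \<in> {1..<n}"
    then have "(F n (u @ (i, True) # v) / s\<^sup>2 - s\<^sup>2 * F n (u @ (i, False) # v))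
        - (G n (u @ (i, True) # v) / s\<^sup>2 - s\<^sup>2 * G n (u @ (i, False) # v))
        = (1 / s - s) * (F n (u @ v) - G n (u @ v))"
      by (simp only: F.skein G.skein right_diff_distrib)
    then show "(F n (u @ (i, True) # v) - G n (u @ (i, True) # v)) / s\<^sup>2
        - s\<^sup>2 * (F n (u @ (i, False) # v) - G n (u @ (i, False) # v))
        = (1 / s - s) * (F n (u @ v) - G n (u @ v))"
      by (simp only: diff_divide_distrib right_diff_distrib add_diff_eq diff_add_eq diff_diff_eq2)
         (simp add: algebra_simps)
  next
    fix u n assume "u \<in> braid_words n" "n \<ge> 1"
    then show "F (Suc n) u - G (Suc n) u = (s + 1 / s) * (F n u - G n u)"
      by (simp add: F.split G.split right_diff_distrib)
  qed (simp_all only: F.cancel G.cancel F.commute G.commute F.braid G.braid F.stabilize G.stabilize)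
  have "F n w - G n w = 0" using D.vanishes_everywhere assms by auto
  then show ?thesis by simp
qed


section \<open>The state sum of a braid word\<close>

text \<open>A set of natural numbers is regarded as a state, the set of occupied sites. On the sites \<open>i\<close> and
  \<open>i + 1\<close> the operator is the R-matrix of the Jones polynomial: it is the identity if both sites are
  empty or both are occupied, and has the matrix with rows $(0, d)$ and $(c, 1 - cd)$ on the states in
  which \<open>i\<close> or \<open>i + 1\<close> alone is occupied. Its eigenvalues are $1$ and $-cd$.\<close>

definition r_act :: "complex \<Rightarrow> complex \<Rightarrow> nat \<Rightarrow> (nat set \<Rightarrow> complex) \<Rightarrow> nat set \<Rightarrow> complex" where
  "r_act c d i \<psi> S =
    (if i \<in> S then (if Suc i \<in> S then \<psi> S else d * \<psi> (insert (Suc i) (S - {i})))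
     else (if Suc i \<in> S then c * \<psi> (insert i (S - {Suc i})) + (1 - c * d) * \<psi> S else \<psi> S))"

text \<open>The formula for a negative letter is the inverse that the quadratic equation of \<open>r_act\<close>
  provides.\<close>

definition letter_act where
  "letter_act c d a \<psi> S =
    (if snd a then r_act c d (fst a) \<psi> S
     else (r_act c d (fst a) \<psi> S - (1 - c * d) * \<psi> S) / (c * d))"

primrec word_act where
  "word_act c d [] \<psi> = \<psi>"
| "word_act c d (a # w) \<psi> = letter_act c d a (word_act c d w \<psi>)"

definition indicate :: "nat set \<Rightarrow> nat set \<Rightarrow> complex" where
  "indicate S = (\<lambda>S'. if S' = S then 1 else 0)"

text \<open>A weighted trace: every occupied site contributes the factor $1/(cd)$.\<close>

definition state_sum :: "complex \<Rightarrow> complex \<Rightarrow> nat \<Rightarrow> braid_word \<Rightarrow> complex" where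
  "state_sum c d n w =
    (\<Sum>S\<in>Pow {1..n}. (1 / (c * d)) ^ card S * word_act c d w (indicate S) S)"

lemma word_act_append: "word_act c d (u @ v) \<psi> = word_act c d u (word_act c d v \<psi>)"
  by (induction u) auto

lemma letter_act_linear:
  "letter_act c d a (\<lambda>S. p * f S + q * g S)
    = (\<lambda>S. p * letter_act c d a f S + q * letter_act c d a g S)"
  by (rule ext) (simp add: letter_act_def r_act_def field_simps add_divide_distrib diff_divide_distrib)

lemma word_act_linear:
  "word_act c d w (\<lambda>S. p * f S + q * g S)
    = (\<lambda>S. p * word_act c d w f S + q * word_act c d w g S)"
  by (induction w) (simp_all add: letter_act_linear)

lemma word_act_scale: "word_act c d w (\<lambda>S. p * f S) = (\<lambda>S. p * word_act c d w f S)"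
  using word_act_linear[of c d w p f 0 f] by simp

lemma word_act_zero: "word_act c d w (\<lambda>S. 0) = (\<lambda>S. 0)"
  using word_act_scale[of c d w 0] by simp

lemma r_act_quadratic:
  "r_act c d i (r_act c d i \<psi>) S = (1 - c * d) * r_act c d i \<psi> S + c * d * \<psi> S"
proof -
  have 1: "insert i (insert (Suc i) (S - {i}) - {Suc i}) = S" if "i \<in> S" "Suc i \<notin> S"
    using that by auto
  have 2: "insert (Suc i) (insert i (S - {Suc i}) - {i}) = S" if "i \<notin> S" "Suc i \<in> S"
    using that by auto
  show ?thesis by (simp add: r_act_def 1 2 insert_absorb algebra_simps)
qed

lemma letter_act_inverse_right:
  assumes "c \<noteq> 0" "d \<noteq> 0"
  shows "letter_act c d (i, True) (letter_act c d (i, False) \<psi>) = \<psi>"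
proof
  fix S
  let ?r = "r_act c d i"
  have eq: "letter_act c d (i, False) \<psi> = (\<lambda>S. 1 / (c * d) * ?r \<psi> S + (- (1 - c * d) / (c * d)) * \<psi> S)"
    by (rule ext) (simp add: letter_act_def field_simps diff_divide_distrib)
  have r: "?r f = letter_act c d (i, True) f" for f by (rule ext) (simp add: letter_act_def)
  have "letter_act c d (i, True) (letter_act c d (i, False) \<psi>) S
     = 1 / (c * d) * ?r (?r \<psi>) S + (- (1 - c * d) / (c * d)) * ?r \<psi> S"
    unfolding eq by (simp only: letter_act_linear r)
  then show "letter_act c d (i, True) (letter_act c d (i, False) \<psi>) S = \<psi> S"
    using assms by (simp add: r_act_quadratic field_simps)
qed

lemma letter_act_inverse_left:
  assumes "c \<noteq> 0" "d \<noteq> 0"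
  shows "letter_act c d (i, False) (letter_act c d (i, True) \<psi>) = \<psi>"
proof
  fix S
  have r: "letter_act c d (i, True) f = r_act c d i f" for f by (rule ext) (simp add: letter_act_def)
  show "letter_act c d (i, False) (letter_act c d (i, True) \<psi>) S = \<psi> S"
    using assms by (simp add: r) (simp add: letter_act_def r_act_quadratic)
qed

lemma r_act_commute:
  assumes "1 < \<bar>int i - int j\<bar>"
  shows "r_act c d i (r_act c d j \<psi>) = r_act c d j (r_act c d i \<psi>)"
proof
  fix S
  have ne: "i \<noteq> j" "i \<noteq> Suc j" "j \<noteq> Suc i" "Suc i \<noteq> j" "Suc j \<noteq> i"
    using assms by auto
  have swap: "insert a (insert b (S - {e}) - {f}) = insert b (insert a (S - {f}) - {e})"
    if "a \<noteq> e" "b \<noteq> f" for a b e f :: nat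
    using that by auto
  have "insert j (insert i (S - {Suc i}) - {Suc j}) = insert i (insert j (S - {Suc j}) - {Suc i})"
    "insert j (insert (Suc i) (S - {i}) - {Suc j}) = insert (Suc i) (insert j (S - {Suc j}) - {i})"
    "insert (Suc j) (insert i (S - {Suc i}) - {j}) = insert i (insert (Suc j) (S - {j}) - {Suc i})"
    "insert (Suc j) (insert (Suc i) (S - {i}) - {j}) = insert (Suc i) (insert (Suc j) (S - {j}) - {i})"
    using ne by (intro swap; simp)+
  then show "r_act c d i (r_act c d j \<psi>) S = r_act c d j (r_act c d i \<psi>) S"
    using ne by (simp add: r_act_def algebra_simps)
qed

text \<open>The identity is checked for each of the eight ways in which the three sites involved can be
  occupied; \<open>R\<close> is the part of the state outside of them.\<close>

lemma r_act_braid: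
  "r_act c d i (r_act c d (Suc i) (r_act c d i \<psi>))
    = r_act c d (Suc i) (r_act c d i (r_act c d (Suc i) \<psi>))"
proof
  fix S
  define R where "R = S - {i, Suc i, Suc (Suc i)}"
  have R: "i \<notin> R" "Suc i \<notin> R" "Suc (Suc i) \<notin> R" by (auto simp: R_def)
  let ?P = "\<lambda>S. r_act c d i (r_act c d (Suc i) (r_act c d i \<psi>)) S
    = r_act c d (Suc i) (r_act c d i (r_act c d (Suc i) \<psi>)) S"
  have ins: "insert (Suc i) (insert i X) = insert i (insert (Suc i) X)"
    "insert (Suc (Suc i)) (insert i X) = insert i (insert (Suc (Suc i)) X)"
    "insert (Suc (Suc i)) (insert (Suc i) X) = insert (Suc i) (insert (Suc (Suc i)) X)" for X
    by auto
  have cases: "S = R \<or> S = insert i R \<or> S = insert (Suc i) R \<or> S = insert (Suc (Suc i)) R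
     \<or> S = insert i (insert (Suc i) R) \<or> S = insert i (insert (Suc (Suc i)) R)
     \<or> S = insert (Suc i) (insert (Suc (Suc i)) R)
     \<or> S = insert i (insert (Suc i) (insert (Suc (Suc i)) R))"
    unfolding R_def by blast
  have "?P R" "?P (insert i R)" "?P (insert (Suc i) R)" "?P (insert (Suc (Suc i)) R)"
    "?P (insert i (insert (Suc i) R))" "?P (insert i (insert (Suc (Suc i)) R))"
    "?P (insert (Suc i) (insert (Suc (Suc i)) R))"
    "?P (insert i (insert (Suc i) (insert (Suc (Suc i)) R)))"
    using R by (simp_all add: r_act_def insert_Diff_if ins algebra_simps)
  then show "?P S" using cases by metis
qed

lemma letter_act_cong:
  assumes "\<And>Y. Y \<subseteq> A \<Longrightarrow> \<psi> Y = \<psi>' Y" "S \<subseteq> A" "fst a \<in> A" "Suc (fst a) \<in> A"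
  shows "letter_act c d a \<psi> S = letter_act c d a \<psi>' S"
proof -
  have "insert (Suc (fst a)) (S - {fst a}) \<subseteq> A" "insert (fst a) (S - {Suc (fst a)}) \<subseteq> A"
    using assms by auto
  then show ?thesis using assms by (simp add: letter_act_def r_act_def)
qed

text \<open>The letters of a word on \<open>n\<close> strands exchange particles between the sites up to \<open>n\<close> only. States
  without a particle at site \<open>n + 1\<close> are therefore not mixed with the others, and by
  \<open>word_act_insert\<close> a particle at that site is a mere spectator.\<close>

lemma word_act_cong:
  assumes "w \<in> braid_words n" "\<And>Y. Suc n \<notin> Y \<Longrightarrow> \<psi> Y = \<psi>' Y" "Suc n \<notin> S"
  shows "word_act c d w \<psi> S = word_act c d w \<psi>' S"
  using assms(1,3)
proof (induction w arbitrary: S)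
  case Nil
  then show ?case using assms(2) by simp
next
  case (Cons a w)
  show ?case unfolding word_act.simps
    by (rule letter_act_cong[where A = "- {Suc n}"])
       (use Cons in \<open>auto simp: braid_words_def\<close>)
qed

lemma letter_act_insert:
  assumes "fst a \<noteq> N" "Suc (fst a) \<noteq> N"
  shows "letter_act c d a \<psi> (insert N S) = letter_act c d a (\<lambda>Y. \<psi> (insert N Y)) S"
proof -
  have "insert x (insert N S - {y}) = insert N (insert x (S - {y}))" if "y \<noteq> N" for x y
    using that by auto
  then show ?thesis using assms by (simp add: letter_act_def r_act_def)
qed

lemma word_act_insert:
  assumes "w \<in> braid_words n"
  shows "word_act c d w \<psi> (insert (Suc n) S) = word_act c d w (\<lambda>Y. \<psi> (insert (Suc n) Y)) S"
  using assms
proof (induction w arbitrary: S)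
  case (Cons a w)
  have a: "fst a \<noteq> Suc n" "Suc (fst a) \<noteq> Suc n" and w: "w \<in> braid_words n"
    using Cons.prems by (auto simp: braid_words_def)
  show ?case using Cons.IH[OF w] by (simp add: letter_act_insert[OF a])
qed simp

lemma sum_Pow_Suc:
  "(\<Sum>S\<in>Pow {1..Suc n}. f S) = (\<Sum>S\<in>Pow {1..n}. f S + f (insert (Suc n) S))"
proof -
  have "{1..Suc n} = insert (Suc n) {1..n}" by auto
  then have "(\<Sum>S\<in>Pow {1..Suc n}. f S)
      = (\<Sum>S\<in>Pow {1..n} \<union> insert (Suc n) ` Pow {1..n}. f S)"
    by (simp only: Pow_insert)
  also have "\<dots> = (\<Sum>S\<in>Pow {1..n}. f S) + (\<Sum>S\<in>insert (Suc n) ` Pow {1..n}. f S)"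
    by (rule sum.union_disjoint) auto
  also have "(\<Sum>S\<in>insert (Suc n) ` Pow {1..n}. f S) = (\<Sum>S\<in>Pow {1..n}. f (insert (Suc n) S))"
  proof (rule sum.reindex_cong[of "insert (Suc n)"])
    show "inj_on (insert (Suc n)) (Pow {1..n})"
    proof (rule inj_onI)
      fix A B assume AB: "A \<in> Pow {1..n}" "B \<in> Pow {1..n}" "insert (Suc n) A = insert (Suc n) B"
      then have "Suc n \<notin> A" "Suc n \<notin> B" by auto
      then show "A = B" using AB(3) by (metis insert_ident)
    qed
  qed auto
  finally show ?thesis by (simp add: sum.distrib)
qed

lemma state_sum_Suc:
  "state_sum c d (Suc n) w = (\<Sum>S\<in>Pow {1..n}. (1 / (c * d)) ^ card S *
     (word_act c d w (indicate S) S
      + 1 / (c * d) * word_act c d w (indicate (insert (Suc n) S)) (insert (Suc n) S)))"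
proof -
  have "card (insert (Suc n) S) = Suc (card S)" if "S \<in> Pow {1..n}" for S
    using that finite_subset[of S "{1..n}"] by (auto simp: card_insert_if)
  then show ?thesis
    unfolding state_sum_def sum_Pow_Suc by (intro sum.cong) (auto simp: algebra_simps)
qed

lemma word_act_indicate_insert:
  assumes "w \<in> braid_words n" "Suc n \<notin> S" "Suc n \<notin> Y"
  shows "word_act c d w (indicate (insert (Suc n) S)) (insert (Suc n) Y) = word_act c d w (indicate S) Y"
  unfolding word_act_insert[OF assms(1)]
  using assms by (intro word_act_cong[OF assms(1)]) (auto simp: indicate_def insert_ident)

lemma state_sum_split:
  assumes "w \<in> braid_words n"
  shows "state_sum c d (Suc n) w = (1 + 1 / (c * d)) * state_sum c d n w"
proof -
  have *: "word_act c d w (indicate (insert (Suc n) S)) (insert (Suc n) S)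
      = word_act c d w (indicate S) S" if "S \<in> Pow {1..n}" for S
    using that by (intro word_act_indicate_insert[OF assms]) auto
  show ?thesis
    unfolding state_sum_Suc unfolding state_sum_def sum_distrib_left
    by (rule sum.cong) (simp_all add: * algebra_simps)
qed

text \<open>The sum over the occupation of site \<open>n + 1\<close> is a partial trace. With the weights $1$ (empty) and
  $1/(cd)$ (occupied) it contracts the R-matrix of the letter between \<open>u\<close> and \<open>v\<close> to a scalar on
  site \<open>n\<close>.\<close>

lemma state_sum_stabilize:
  assumes cd: "c \<noteq> 0" "d \<noteq> 0" and u: "u \<in> braid_words n" and v: "v \<in> braid_words n"
  shows "state_sum c d (Suc n) (u @ (n, b) # v) = (if b then 1 / (c * d) else 1) * state_sum c d n (u @ v)"
proof -
  let ?\<kappa> = "if b then 1 / (c * d) else 1"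
  have "word_act c d (u @ (n, b) # v) (indicate S) S + 1 / (c * d) *
      word_act c d (u @ (n, b) # v) (indicate (insert (Suc n) S)) (insert (Suc n) S)
    = ?\<kappa> * word_act c d (u @ v) (indicate S) S" if S: "S \<in> Pow {1..n}" for S
  proof -
    have N: "Suc n \<notin> S" using S by auto
    let ?\<omega> = "word_act c d v (indicate S)"
    let ?\<chi> = "word_act c d v (indicate (insert (Suc n) S))"
    have \<omega>0: "?\<omega> (insert (Suc n) Y) = 0" for Y
    proof -
      have "(\<lambda>Y. indicate S (insert (Suc n) Y)) = (\<lambda>Y. 0)" using N by (auto simp: indicate_def)
      then show ?thesis by (simp add: word_act_insert[OF v] word_act_zero)
    qed
    have \<chi>0: "?\<chi> Y = 0" if "Suc n \<notin> Y" for Y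
    proof -
      have "?\<chi> Y = word_act c d v (\<lambda>Y. 0) Y"
        by (rule word_act_cong[OF v _ that]) (auto simp: indicate_def)
      then show ?thesis by (simp add: word_act_zero)
    qed
    have \<chi>1: "?\<chi> (insert (Suc n) Y) = ?\<omega> Y" if "Suc n \<notin> Y" for Y
      by (rule word_act_indicate_insert[OF v N that])
    have ins: "insert n (insert (Suc n) Y - {Suc n}) = insert n Y" if "Suc n \<notin> Y" for Y
      using that by auto
    let ?A = "letter_act c d (n, b) ?\<omega>"
    let ?B = "\<lambda>Y. letter_act c d (n, b) ?\<chi> (insert (Suc n) Y)"
    \<comment> \<open>the partial trace of the R-matrix: \<open>?A\<close> and \<open>?B\<close> are the terms without and with a particle
      at site \<open>n + 1\<close>\<close>
    have AB: "1 * ?A Y + 1 / (c * d) * ?B Y = ?\<kappa> * ?\<omega> Y" if Y: "Suc n \<notin> Y" for Y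
      using Y \<chi>0 \<chi>1 cd
      by (simp add: letter_act_def r_act_def \<omega>0 ins) (simp add: field_simps)
    have "word_act c d (u @ (n, b) # v) (indicate S) S + 1 / (c * d) *
        word_act c d (u @ (n, b) # v) (indicate (insert (Suc n) S)) (insert (Suc n) S)
      = 1 * word_act c d u ?A S + 1 / (c * d) * word_act c d u ?B S"
      by (simp add: word_act_append word_act_insert[OF u])
    also have "\<dots> = word_act c d u (\<lambda>Y. 1 * ?A Y + 1 / (c * d) * ?B Y) S"
      by (simp only: word_act_linear)
    also have "\<dots> = word_act c d u (\<lambda>Y. ?\<kappa> * ?\<omega> Y) S"
      using AB by (rule word_act_cong[OF u _ N])
    also have "\<dots> = ?\<kappa> * word_act c d (u @ v) (indicate S) S"
      by (simp only: word_act_scale word_act_append)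
    finally show ?thesis .
  qed
  then show ?thesis
    unfolding state_sum_Suc unfolding state_sum_def sum_distrib_left
    by (intro sum.cong) (auto simp: algebra_simps)
qed

lemma state_sum_skein:
  assumes "c \<noteq> 0" "d \<noteq> 0"
  shows "c * d * state_sum c d n (u @ (i, False) # v)
    = state_sum c d n (u @ (i, True) # v) - (1 - c * d) * state_sum c d n (u @ v)"
proof -
  have eq: "letter_act c d (i, False) \<psi>
      = (\<lambda>S. 1 / (c * d) * letter_act c d (i, True) \<psi> S + (- (1 - c * d) / (c * d)) * \<psi> S)" for \<psi>
    by (rule ext) (simp add: letter_act_def field_simps diff_divide_distrib)
  have "c * d * word_act c d (u @ (i, False) # v) \<psi> S
      = word_act c d (u @ (i, True) # v) \<psi> S - (1 - c * d) * word_act c d (u @ v) \<psi> S" for \<psi> S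
    using assms unfolding word_act_append word_act.simps eq word_act_linear
    by (simp add: field_simps)
  then have *: "word_act c d (u @ (i, False) # v) \<psi> S
      = (word_act c d (u @ (i, True) # v) \<psi> S - (1 - c * d) * word_act c d (u @ v) \<psi> S) / (c * d)"
    for \<psi> S using assms by (simp add: field_simps)
  show ?thesis
    unfolding state_sum_def sum_distrib_left sum_subtractf[symmetric]
    by (rule sum.cong) (use assms in \<open>simp_all add: * field_simps\<close>)
qed

lemma word_writhe_simps [simp]:
  "word_writhe [] = 0"
  "word_writhe ((i, b) # w) = (if b then 1 else -1) + word_writhe w"
  "word_writhe (u @ w) = word_writhe u + word_writhe w"
  by (simp_all add: word_writhe_def)

text \<open>With $s^2 = cd$ the quadratic equation of the R-matrix $R$ reads $R - s^2 R^{-1} = 1 - s^2$; the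
  factor $s^w$ turns this into the skein relation. The exponent $w + n$ grows by $2$ or $0$ under
  positive or negative stabilization, which balances the scalars $s^{-2}$ and $1$ of
  \<open>state_sum_stabilize\<close>.\<close>

theorem state_sum_skein_functional:
  assumes "c \<noteq> 0" "d \<noteq> 0" "s\<^sup>2 = c * d"
  shows "skein_functional s (\<lambda>n w. s powi (word_writhe w + int n) * state_sum c d n w)"
proof
  let ?F = "\<lambda>n w. s powi (word_writhe w + int n) * state_sum c d n w"
  show s0: "s \<noteq> 0" using assms by auto
  have letter: "letter_act c d (i, True) f = r_act c d i f" for i f
    by (rule ext) (simp add: letter_act_def)
  {
    fix u v n i
    define X where "X = s powi (word_writhe u + word_writhe v + int n)"
    have X: "s powi (word_writhe (u @ (i, True) # v) + int n) = s * X"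
      "s powi (word_writhe (u @ (i, False) # v) + int n) = X / s"
      "s powi (word_writhe (u @ v) + int n) = X"
      unfolding X_def using s0 power_int_add_1'[of s "word_writhe u + word_writhe v + int n"]
        power_int_diff[of s "word_writhe u + word_writhe v + int n" 1]
      by (simp_all add: algebra_simps)
    have F: "state_sum c d n (u @ (i, False) # v)
        = (state_sum c d n (u @ (i, True) # v) - (1 - s\<^sup>2) * state_sum c d n (u @ v)) / s\<^sup>2"
      unfolding assms(3) state_sum_skein[OF assms(1,2), of n u i v, symmetric] using assms by simp
    show "?F n (u @ (i, True) # v) / s\<^sup>2 -
        s\<^sup>2 * ?F n (u @ (i, False) # v)
        = (1 / s - s) * ?F n (u @ v)"
      unfolding X F using s0 by (simp add: field_simps power2_eq_square)
  next
    fix u v n i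
    show "?F n (u @ [(i, True), (i, False)] @ v)
      = ?F n (u @ v)"
      unfolding state_sum_def word_act_append
      by (simp add: letter_act_inverse_right assms)
  next
    fix u v n i j
    assume "1 < \<bar>int i - int j\<bar>"
    then show "?F n (u @ [(i, True), (j, True)] @ v)
      = ?F n (u @ [(j, True), (i, True)] @ v)"
      unfolding state_sum_def word_act_append by (simp add: letter r_act_commute)
  next
    fix u v n i
    show "?F n (u @ [(i, True), (Suc i, True), (i, True)] @ v)
      = ?F n (u @ [(Suc i, True), (i, True), (Suc i, True)] @ v)"
      unfolding state_sum_def word_act_append by (simp add: letter r_act_braid)
  next
    fix u v n b
    assume uv: "u \<in> braid_words n" "v \<in> braid_words n"
    define X where "X = s powi (word_writhe u + word_writhe v + int n)"
    have "s powi (word_writhe (u @ (n, b) # v) + int (Suc n)) = X * (if b then s\<^sup>2 else 1)"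
      unfolding X_def using s0 power_int_add[of s "word_writhe u + word_writhe v + int n" 2]
      by (auto simp: algebra_simps)
    moreover have "s powi (word_writhe (u @ v) + int n) = X" unfolding X_def by simp
    ultimately show "?F (Suc n) (u @ (n, b) # v)
        = ?F n (u @ v)"
      using assms by (simp add: state_sum_stabilize[OF assms(1,2) uv])
  next
    fix u n assume u: "u \<in> braid_words n"
    have "s powi (word_writhe u + int (Suc n)) = s powi (word_writhe u + int n) * s"
      using s0 power_int_add_1[of s "word_writhe u + int n"] by (simp add: algebra_simps)
    moreover have "s * (1 + 1 / (c * d)) = s + 1 / s"
      using assms s0 by (simp add: field_simps power2_eq_square flip: assms(3))
    moreover have "(X * s) * (y * t) = (s * y) * (X * t)" for X y t :: complex by (simp only: mult_ac)
    ultimately show "?F (Suc n) u = (s + 1 / s) * ?F n u"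
      unfolding state_sum_split[OF u] by simp
  }
qed

lemma state_sum_trivial: "state_sum c d 1 [] = 1 + 1 / (c * d)"
  using state_sum_split[of "[]" 0 c d]
  by (simp add: braid_words_def) (simp add: state_sum_def indicate_def)


section \<open>The bubble trace as a state sum\<close>

text \<open>A diagram \<open>D\<close> carries a set \<open>S\<close> of top vertices to the set \<open>D `` S\<close> of bottom vertices, provided
  that an edge starts in every point of \<open>S\<close>, and to zero otherwise. Acting on functions of \<open>S\<close>
  instead of on the sets themselves makes stacking from top to bottom correspond to the
  composition of operators.\<close>

definition rep :: "nat \<Rightarrow> (rook_diagram \<Rightarrow> complex) \<Rightarrow> (nat set \<Rightarrow> complex) \<Rightarrow> nat set \<Rightarrow> complex" where
  "rep n f \<psi> S = (\<Sum>D\<in>{D \<in> planar_rook n. S \<subseteq> Domain D}. f D * \<psi> (D `` S))"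

lemma finite_planar_rook [simp]: "finite (planar_rook n)"
  by (rule finite_subset[of _ "Pow ({1..n} \<times> {1..n})"]) (auto simp: planar_rook_def)

lemma planar_rook_single_valued:
  "D \<in> planar_rook n \<Longrightarrow> (a, b) \<in> D \<Longrightarrow> (a, b') \<in> D \<Longrightarrow> b = b'"
  by (fastforce simp: planar_rook_def)

lemma planar_rook_inverse_single_valued:
  "D \<in> planar_rook n \<Longrightarrow> (a, b) \<in> D \<Longrightarrow> (a', b) \<in> D \<Longrightarrow> a = a'"
  by (fastforce simp: planar_rook_def)

lemma planar_rook_mono:
  "D \<in> planar_rook n \<Longrightarrow> (a, b) \<in> D \<Longrightarrow> (a', b') \<in> D \<Longrightarrow> a < a' \<longleftrightarrow> b < b'"
  by (fastforce simp: planar_rook_def)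

lemma planar_rook_subset: "D \<in> planar_rook n \<Longrightarrow> D \<subseteq> {1..n} \<times> {1..n}"
  by (simp add: planar_rook_def)

lemma planar_rookI:
  assumes "D \<subseteq> {1..n} \<times> {1..n}"
    and "\<And>a b a' b'. (a, b) \<in> D \<Longrightarrow> (a', b') \<in> D \<Longrightarrow> (a = a' \<longleftrightarrow> b = b') \<and> (a < a' \<longleftrightarrow> b < b')"
  shows "D \<in> planar_rook n"
  using assms unfolding planar_rook_def by fast

lemma planar_rook_comp: 
  assumes "D \<in> planar_rook n" "D' \<in> planar_rook n"
  shows "D O D' \<in> planar_rook n"
proof (rule planar_rookI)
  show "D O D' \<subseteq> {1..n} \<times> {1..n}"
    using planar_rook_subset[OF assms(1)] planar_rook_subset[OF assms(2)] by auto
next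
  fix a b a' b' assume "(a, b) \<in> D O D'" "(a', b') \<in> D O D'"
  then obtain m m' where "(a, m) \<in> D" "(m, b) \<in> D'" "(a', m') \<in> D" "(m', b') \<in> D'" by auto
  then show "(a = a' \<longleftrightarrow> b = b') \<and> (a < a' \<longleftrightarrow> b < b')"
    using planar_rook_mono[OF assms(1)] planar_rook_mono[OF assms(2)]
    by (metis linorder_neqE_nat order_less_irrefl)
qed

lemma planar_rook_id: "Id_on {1..n} \<in> planar_rook n"
  by (rule planar_rookI) auto

lemma subset_Domain_comp:
  assumes "D \<in> planar_rook n"
  shows "S \<subseteq> Domain (D O D') \<longleftrightarrow> S \<subseteq> Domain D \<and> D `` S \<subseteq> Domain D'"
proof
  assume S: "S \<subseteq> Domain (D O D')"
  have "b \<in> Domain D'" if ab: "a \<in> S" "(a, b) \<in> D" for a b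
  proof -
    obtain m e where "(a, m) \<in> D" "(m, e) \<in> D'" using S ab by blast
    then show ?thesis using planar_rook_single_valued[OF assms ab(2)] by blast
  qed
  then show "S \<subseteq> Domain D \<and> D `` S \<subseteq> Domain D'" using S by blast
qed fastforce

lemma rep_mult:
  "rep n (f \<otimes>\<^bsub>planar_rook_algebra n\<^esub> g) \<psi> S = rep n f (rep n g \<psi>) S"
proof -
  let ?P = "planar_rook n"
  have "rep n (f \<otimes>\<^bsub>planar_rook_algebra n\<^esub> g) \<psi> S =
    (\<Sum>D\<in>?P. if S \<subseteq> Domain D then
      (\<Sum>p\<in>{p \<in> ?P \<times> ?P. fst p O snd p = D}. f (fst p) * g (snd p)) * \<psi> (D `` S) else 0)"
    unfolding rep_def planar_rook_algebra_def
    by (simp add: sum.inter_filter[OF finite_planar_rook] case_prod_beta)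
  also have "\<dots> = (\<Sum>D\<in>?P. \<Sum>p\<in>{p \<in> ?P \<times> ?P. fst p O snd p = D}.
      if S \<subseteq> Domain (fst p O snd p) then f (fst p) * g (snd p) * \<psi> ((fst p O snd p) `` S) else 0)"
    by (intro sum.cong HOL.refl) (auto simp: sum_distrib_right intro!: sum.cong)
  also have "\<dots> = (\<Sum>p\<in>?P \<times> ?P.
      if S \<subseteq> Domain (fst p O snd p) then f (fst p) * g (snd p) * \<psi> ((fst p O snd p) `` S) else 0)"
    by (rule sum.group) (auto intro: planar_rook_comp)
  also have "\<dots> = (\<Sum>D\<in>?P. \<Sum>D'\<in>?P.
      if S \<subseteq> Domain (D O D') then f D * g D' * \<psi> ((D O D') `` S) else 0)"
    by (simp add: sum.cartesian_product case_prod_beta)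
  also have "\<dots> = (\<Sum>D\<in>?P. if S \<subseteq> Domain D then f D *
      (\<Sum>D'\<in>?P. if D `` S \<subseteq> Domain D' then g D' * \<psi> (D' `` (D `` S)) else 0) else 0)"
  proof (rule sum.cong[OF HOL.refl])
    fix D assume D: "D \<in> ?P"
    show "(\<Sum>D'\<in>?P. if S \<subseteq> Domain (D O D') then f D * g D' * \<psi> ((D O D') `` S) else 0)
      = (if S \<subseteq> Domain D then f D *
      (\<Sum>D'\<in>?P. if D `` S \<subseteq> Domain D' then g D' * \<psi> (D' `` (D `` S)) else 0) else 0)"
      unfolding subset_Domain_comp[OF D] relcomp_Image
      by (auto simp: sum_distrib_left mult.assoc intro!: sum.cong)
  qed
  also have "\<dots> = rep n f (rep n g \<psi>) S"
    unfolding rep_def by (simp add: sum.inter_filter[OF finite_planar_rook])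
  finally show ?thesis .
qed

lemma Image_planar_rook: "D \<in> planar_rook n \<Longrightarrow> D `` S \<subseteq> {1..n}"
  using planar_rook_subset by fastforce

lemma rep_cong:
  assumes "\<And>Y. Y \<subseteq> {1..n} \<Longrightarrow> \<psi> Y = \<psi>' Y"
  shows "rep n f \<psi> S = rep n f \<psi>' S"
  unfolding rep_def by (intro sum.cong HOL.refl) (simp add: assms[OF Image_planar_rook])

lemma rep_basis:
  "D \<in> planar_rook n \<Longrightarrow>
    rep n (rook_basis D) \<psi> S = (if S \<subseteq> Domain D then \<psi> (D `` S) else 0)"
  by (simp add: rep_def rook_basis_def sum.inter_filter if_distrib[of "\<lambda>x. x * _"] cong: if_cong)

lemma rep_one:
  assumes "S \<subseteq> {1..n}"
  shows "rep n \<one>\<^bsub>planar_rook_algebra n\<^esub> \<psi> S = \<psi> S"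
proof -
  have "\<one>\<^bsub>planar_rook_algebra n\<^esub> = rook_basis (Id_on {1..n})"
    by (simp add: planar_rook_algebra_def rook_basis_def fun_eq_iff)
  moreover have "Id_on {1..n} `` S = S" "Domain (Id_on {1..n}) = {1..n}" using assms by auto
  ultimately show ?thesis
    using rep_basis[OF planar_rook_id, of n \<psi> S] assms by (simp del: One_nat_def)
qed

lemma rook_d_planar:
  assumes "i \<in> {1..<n}" "j \<in> {1..6}"
  shows "rook_d n j i \<in> planar_rook n"
proof -
  have "j = 1 \<or> j = 2 \<or> j = 3 \<or> j = 4 \<or> j = 5 \<or> j = 6" using assms(2) by auto
  then show ?thesis
    using assms(1)
    by (elim disjE; intro planar_rookI) (auto simp: rook_d_def local_rook_def)
qed

lemma rep_phi5_gen:
  assumes i: "i \<in> {1..<n}" and S: "S \<subseteq> {1..n}"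
  shows "rep n (phi5_gen c d n i) \<psi> S = r_act c d i \<psi> S"
proof -
  have P: "rook_d n j i \<in> planar_rook n" if "j \<in> {1..6}" for j
    using rook_d_planar[OF i that] .
  have eq: "rep n (phi5_gen c d n i) \<psi> S =
     (1 - c - d + c * d) * rep n (rook_basis (rook_d n 1 i)) \<psi> S
     - rep n (rook_basis (rook_d n 2 i)) \<psi> S
     + c * rep n (rook_basis (rook_d n 3 i)) \<psi> S
     + d * rep n (rook_basis (rook_d n 4 i)) \<psi> S
     - c * d * rep n (rook_basis (rook_d n 5 i)) \<psi> S
     + rep n (rook_basis (rook_d n 6 i)) \<psi> S"
    unfolding rep_def phi5_gen_def
    by (simp add: sum.distrib sum_subtractf sum_distrib_left algebra_simps)
  have sub: "S \<subseteq> {1..n} - {i, Suc i} \<longleftrightarrow> i \<notin> S \<and> Suc i \<notin> S"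
    "S \<subseteq> {1..n} - {Suc i} \<longleftrightarrow> Suc i \<notin> S" "S \<subseteq> {1..n} - {i} \<longleftrightarrow> i \<notin> S"
    using S by auto
  have dom: "Domain (rook_d n 1 i) = {1..n} - {i, Suc i}"
    "Domain (rook_d n 2 i) = {1..n} - {Suc i}"
    "Domain (rook_d n 3 i) = {1..n} - {i}"
    "Domain (rook_d n 4 i) = {1..n} - {Suc i}"
    "Domain (rook_d n 5 i) = {1..n} - {i}"
    "Domain (rook_d n 6 i) = {1..n}"
    using i by (auto simp: rook_d_def local_rook_def)
  have im: "rook_d n 1 i `` S = S" if "i \<notin> S" "Suc i \<notin> S"
    using that S by (auto simp: rook_d_def local_rook_def)
  have im2: "rook_d n 2 i `` S = S" if "Suc i \<notin> S"
    using that S by (auto simp: rook_d_def local_rook_def)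
  have im3: "rook_d n 3 i `` S = (if Suc i \<in> S then insert i (S - {Suc i}) else S)" if "i \<notin> S"
    using that S by (auto simp: rook_d_def local_rook_def)
  have im4: "rook_d n 4 i `` S = (if i \<in> S then insert (Suc i) (S - {i}) else S)" if "Suc i \<notin> S"
    using that S by (auto simp: rook_d_def local_rook_def)
  have im5: "rook_d n 5 i `` S = S" if "i \<notin> S"
    using that S by (auto simp: rook_d_def local_rook_def)
  have im6: "rook_d n 6 i `` S = S"
    using S by (auto simp: rook_d_def local_rook_def)
  have B: "rep n (rook_basis (rook_d n j i)) \<psi> S
      = (if S \<subseteq> Domain (rook_d n j i) then \<psi> (rook_d n j i `` S) else 0)" if "j \<in> {1..6}" for j
    using rep_basis[OF P[OF that]] .
  have "rep n (rook_basis (rook_d n 1 i)) \<psi> S = (if i \<notin> S \<and> Suc i \<notin> S then \<psi> S else 0)"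
    using B[of 1] dom(1) sub(1) im by simp
  moreover have "rep n (rook_basis (rook_d n 2 i)) \<psi> S = (if Suc i \<notin> S then \<psi> S else 0)"
    using B[of 2] dom(2) sub(2) im2 by simp
  moreover have "rep n (rook_basis (rook_d n 3 i)) \<psi> S
      = (if i \<notin> S then \<psi> (if Suc i \<in> S then insert i (S - {Suc i}) else S) else 0)"
    using B[of 3] dom(3) sub(3) im3 by simp
  moreover have "rep n (rook_basis (rook_d n 4 i)) \<psi> S
      = (if Suc i \<notin> S then \<psi> (if i \<in> S then insert (Suc i) (S - {i}) else S) else 0)"
    using B[of 4] dom(4) sub(2) im4 by simp
  moreover have "rep n (rook_basis (rook_d n 5 i)) \<psi> S = (if i \<notin> S then \<psi> S else 0)"
    using B[of 5] dom(5) sub(3) im5 by simp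
  moreover have "rep n (rook_basis (rook_d n 6 i)) \<psi> S = \<psi> S"
    using B[of 6] dom(6) S im6 by simp
  ultimately show ?thesis
    unfolding eq r_act_def by (simp add: algebra_simps)
qed

lemma sum_Pow_power:
  fixes y :: "'a :: comm_semiring_1"
  assumes "finite A"
  shows "(\<Sum>S\<in>Pow A. y ^ card S) = (1 + y) ^ card A"
proof -
  have "(\<Prod>x\<in>A. y + 1) = (\<Sum>S\<in>Pow A. (\<Prod>x\<in>S. y) * (\<Prod>x\<in>A - S. 1))"
    by (rule prod_add[OF assms])
  then show ?thesis by (simp add: add.commute)
qed

text \<open>Along the edges a planar diagram is strictly increasing. An increasing bijection of a set of
  natural numbers onto itself is the identity.\<close>

lemma planar_rook_fixes_set_iff:
  assumes D: "D \<in> planar_rook n"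
  shows "S \<subseteq> Domain D \<and> D `` S = S \<longleftrightarrow> S \<subseteq> {i. (i, i) \<in> D}"
proof (intro iffI conjI)
  assume S: "S \<subseteq> Domain D \<and> D `` S = S"
  have "(t, t) \<in> D" if "t \<in> S" for t
    using that
  proof (induction t rule: less_induct)
    case (less t)
    obtain b where b: "(t, b) \<in> D" using S less.prems by auto
    have bS: "b \<in> S" using S b less.prems by auto
    obtain a where a: "a \<in> S" "(a, t) \<in> D" using S less.prems by blast
    have "\<not> b < t" using less.IH[OF _ bS] planar_rook_inverse_single_valued[OF D b] by blast
    moreover have "\<not> a < t" using less.IH[OF _ a(1)] planar_rook_single_valued[OF D a(2)] by blast
    moreover have "\<not> t < a \<or> b < t" using planar_rook_mono[OF D b a(2)] by blast
    ultimately have "a = t" by linarith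
    then show ?case using a(2) by simp
  qed
  then show "S \<subseteq> {i. (i, i) \<in> D}" by blast
next
  assume S: "S \<subseteq> {i. (i, i) \<in> D}"
  then show "S \<subseteq> Domain D" by blast
  show "D `` S = S"
    using S planar_rook_single_valued[OF D] by blast
qed

text \<open>The sets that a diagram carries to themselves are the subsets of its vertical lines. Weighted
  by $y^{|S|}$ their number is $(1 + y)^k$.\<close>

lemma bubble_trace_eq:
  "bubble_trace n (1 + y) f = (\<Sum>S\<in>Pow {1..n}. y ^ card S * rep n f (indicate S) S)"
proof -
  let ?P = "planar_rook n"
  have "(\<Sum>S\<in>Pow {1..n}. y ^ card S * rep n f (indicate S) S)
     = (\<Sum>S\<in>Pow {1..n}. \<Sum>D\<in>?P. if S \<subseteq> Domain D \<and> D `` S = S then f D * y ^ card S else 0)"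
    unfolding rep_def indicate_def
    by (intro sum.cong HOL.refl) (auto simp: sum.inter_filter sum_distrib_left intro!: sum.cong)
  also have "\<dots> = (\<Sum>D\<in>?P. \<Sum>S\<in>Pow {1..n}. if S \<subseteq> Domain D \<and> D `` S = S then f D * y ^ card S else 0)"
    by (rule sum.swap)
  also have "\<dots> = (\<Sum>D\<in>?P. f D * (1 + y) ^ vertical_lines D)"
  proof (rule sum.cong[OF HOL.refl])
    fix D assume D: "D \<in> ?P"
    have sub: "{i. (i, i) \<in> D} \<subseteq> {1..n}" using planar_rook_subset[OF D] by auto
    then have fin: "finite {i. (i, i) \<in> D}" by (rule finite_subset) simp
    have "(\<Sum>S\<in>Pow {1..n}. if S \<subseteq> Domain D \<and> D `` S = S then f D * y ^ card S else 0)
        = (\<Sum>S\<in>{S \<in> Pow {1..n}. S \<subseteq> {i. (i, i) \<in> D}}. f D * y ^ card S)"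
      unfolding planar_rook_fixes_set_iff[OF D] by (rule sum.inter_filter[symmetric]) simp
    also have "{S \<in> Pow {1..n}. S \<subseteq> {i. (i, i) \<in> D}} = Pow {i. (i, i) \<in> D}" using sub by auto
    finally show "(\<Sum>S\<in>Pow {1..n}. if S \<subseteq> Domain D \<and> D `` S = S then f D * y ^ card S else 0)
        = f D * (1 + y) ^ vertical_lines D"
      by (simp add: sum_Pow_power[OF fin] vertical_lines_def flip: sum_distrib_left)
  qed
  finally show ?thesis unfolding bubble_trace_def by simp
qed

lemma braid_eq_words: "braid_eq n u v \<Longrightarrow> u \<in> braid_words n \<and> v \<in> braid_words n"
  by (induction rule: braid_eq.induct) (auto simp: braid_words_def)

lemma braid_eq_writhe: "braid_eq n u v \<Longrightarrow> word_writhe u = word_writhe v"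
  by (induction rule: braid_eq.induct) auto

lemma braid_class_eq: "braid_eq n u v \<Longrightarrow> braid_class n u = braid_class n v"
  unfolding braid_class_def by (auto intro: braid_eq.sym braid_eq.trans)

lemma braid_group_mult:
  assumes "u \<in> braid_words n" "v \<in> braid_words n"
  shows "braid_class n u \<otimes>\<^bsub>braid_group n\<^esub> braid_class n v = braid_class n (u @ v)"
proof -
  have "braid_class n (u' @ v') = braid_class n (u @ v)"
    if "u' \<in> braid_class n u" "v' \<in> braid_class n v" for u' v'
    using that by (intro braid_class_eq[symmetric] braid_eq.append) (auto simp: braid_class_def)
  moreover have "u \<in> braid_class n u" "v \<in> braid_class n v"
    using assms by (auto simp: braid_class_def intro: braid_eq.refl)
  ultimately have "(\<Union>u'\<in>braid_class n u. \<Union>v'\<in>braid_class n v. braid_class n (u' @ v'))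
      = braid_class n (u @ v)"
    by blast
  then show ?thesis by (simp add: braid_group_def)
qed

lemma braid_class_carrier: "u \<in> braid_words n \<Longrightarrow> braid_class n u \<in> carrier (braid_group n)"
  by (simp add: braid_group_def)

lemma carrier_braid_group_class:
  assumes "x \<in> carrier (braid_group n)" "u \<in> x"
  shows "u \<in> braid_words n" "x = braid_class n u"
proof -
  obtain v where v: "x = braid_class n v" using assms(1) by (auto simp: braid_group_def)
  then have "braid_eq n v u" using assms(2) by (simp add: braid_class_def)
  then show "u \<in> braid_words n" "x = braid_class n u"
    using v braid_eq_words braid_class_eq by auto
qed

lemma writhe_braid_class:
  assumes "u \<in> braid_words n"
  shows "writhe (braid_class n u) = word_writhe u"
proof -
  have "word_writhe ` braid_class n u = {word_writhe u}"
    using assms braid_eq_writhe by (fastforce simp: braid_class_def intro: braid_eq.refl)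
  then show ?thesis by (simp add: writhe_def)
qed

text \<open>The operator of a negative letter is determined by being a right inverse of the positive one,
  which has an explicit two-sided inverse.\<close>

lemma rep_hom:
  assumes cd: "c \<noteq> 0" "d \<noteq> 0"
    and hom: "\<phi> \<in> hom (braid_group n) (units_of (planar_rook_algebra n))"
    and gen: "\<And>i. i \<in> {1..<n} \<Longrightarrow> \<phi> (braid_gen n i) = phi5_gen c d n i"
  shows "u \<in> braid_words n \<Longrightarrow> S \<subseteq> {1..n} \<Longrightarrow>
    rep n (\<phi> (braid_class n u)) \<psi> S = word_act c d u \<psi> S"
proof -
  let ?R = "planar_rook_algebra n"
  have mult: "\<phi> (braid_class n (u @ v)) = \<phi> (braid_class n u) \<otimes>\<^bsub>?R\<^esub> \<phi> (braid_class n v)"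
    if "u \<in> braid_words n" "v \<in> braid_words n" for u v
    using hom_mult[OF hom braid_class_carrier[OF that(1)] braid_class_carrier[OF that(2)]]
    by (simp add: braid_group_mult[OF that] units_of_mult)
  have nil: "[] \<in> braid_words n" by (simp add: braid_words_def)
  \<comment> \<open>the image of the neutral element is an idempotent with a left inverse\<close>
  have trivial: "rep n (\<phi> (braid_class n [])) \<psi> S = \<psi> S" if "S \<subseteq> {1..n}" for \<psi> S
  proof -
    let ?e = "\<phi> (braid_class n [])"
    have "?e \<in> Units ?R"
      using hom_in_carrier[OF hom braid_class_carrier[OF nil]] by (simp add: units_of_carrier)
    then obtain y where y: "y \<otimes>\<^bsub>?R\<^esub> ?e = \<one>\<^bsub>?R\<^esub>" by (auto simp: Units_def)
    have "rep n ?e \<psi> S = rep n (y \<otimes>\<^bsub>?R\<^esub> ?e) (rep n ?e \<psi>) S"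
      by (simp add: y rep_one[OF that])
    also have "\<dots> = rep n y (rep n (?e \<otimes>\<^bsub>?R\<^esub> ?e) \<psi>) S"
      by (simp add: rep_mult cong: rep_cong)
    also have "?e \<otimes>\<^bsub>?R\<^esub> ?e = ?e" using mult[OF nil nil] by simp
    also have "rep n y (rep n ?e \<psi>) S = rep n (y \<otimes>\<^bsub>?R\<^esub> ?e) \<psi> S" by (simp add: rep_mult)
    finally show ?thesis by (simp add: y rep_one[OF that])
  qed
  show "u \<in> braid_words n \<Longrightarrow> S \<subseteq> {1..n} \<Longrightarrow>
    rep n (\<phi> (braid_class n u)) \<psi> S = word_act c d u \<psi> S"
  proof (induction u arbitrary: S)
    case Nil
    then show ?case by (simp add: trivial)
  next
    case (Cons a u)
    obtain i b where a: "a = (i, b)" by (cases a)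
    have i: "i \<in> {1..<n}" and u: "u \<in> braid_words n" and b: "[(i, b)] \<in> braid_words n" for b
      using Cons.prems(1) a by (auto simp: braid_words_def)
    have pos: "rep n (\<phi> (braid_class n [(i, True)])) \<xi> Y = letter_act c d (i, True) \<xi> Y"
      if "Y \<subseteq> {1..n}" for \<xi> Y
      using gen[OF i] that i by (simp add: braid_gen_def rep_phi5_gen letter_act_def)
    have letter: "rep n (\<phi> (braid_class n [(i, b)])) \<xi> Y = letter_act c d (i, b) \<xi> Y"
      if Y: "Y \<subseteq> {1..n}" for \<xi> Y
    proof (cases b)
      case True
      then show ?thesis using pos[OF Y] by simp
    next
      case False
      let ?\<xi>' = "rep n (\<phi> (braid_class n [(i, False)])) \<xi>"
      have "braid_class n ([(i, True)] @ [(i, False)]) = braid_class n []"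
        using braid_eq.cancel[OF i, of True] by (intro braid_class_eq) simp
      then have "letter_act c d (i, True) ?\<xi>' Y = \<xi> Y" if "Y \<subseteq> {1..n}" for Y
        using mult[OF b b, of True False] pos[OF that, of ?\<xi>'] trivial[OF that, of \<xi>]
        by (simp add: rep_mult)
      then have "letter_act c d (i, False) (letter_act c d (i, True) ?\<xi>') Y = letter_act c d (i, False) \<xi> Y"
        using Y i by (intro letter_act_cong[where A = "{1..n}"]) auto
      then show ?thesis using False by (simp add: letter_act_inverse_left[OF cd])
    qed
    have "rep n (\<phi> (braid_class n (a # u))) \<psi> S
        = rep n (\<phi> (braid_class n [(i, b)])) (rep n (\<phi> (braid_class n u)) \<psi>) S"
      using mult[OF b u, of b] a by (simp add: rep_mult)
    also have "\<dots> = rep n (\<phi> (braid_class n [(i, b)])) (word_act c d u \<psi>) S"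
      by (rule rep_cong) (rule Cons.IH[OF u])
    finally show ?case using letter[OF Cons.prems(2)] a by simp
  qed
qed

theorem Tr5_eq_state_sum:
  assumes "c \<noteq> 0" "d \<noteq> 0"
    and "\<phi> \<in> hom (braid_group n) (units_of (planar_rook_algebra n))"
    and "\<And>i. i \<in> {1..<n} \<Longrightarrow> \<phi> (braid_gen n i) = phi5_gen c d n i"
    and "x \<in> carrier (braid_group n)" "u \<in> x"
  shows "Tr5 c d s \<phi> n x = s powi (word_writhe u + int n) * state_sum c d n u"
proof -
  have u: "u \<in> braid_words n" and x: "x = braid_class n u"
    using carrier_braid_group_class assms(5,6) by auto
  have "(1 + c * d) / (c * d) = 1 + 1 / (c * d)" using assms(1,2) by (simp add: field_simps)
  then have "bubble_trace n ((1 + c * d) / (c * d)) (\<phi> x) = state_sum c d n u"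
    unfolding x state_sum_def
    by (simp only: bubble_trace_eq) (intro sum.cong HOL.refl, simp only: Pow_iff rep_hom[OF assms(1-4) u])
  then show ?thesis by (simp add: Tr5_def x writhe_braid_class[OF u])
qed


section \<open>Elementary moves of polygonal links\<close>

lemma oriented_link_meet:
  "oriented_link E \<Longrightarrow> (a, b) \<in> E \<Longrightarrow> (a', b') \<in> E \<Longrightarrow> (a, b) \<noteq> (a', b') \<Longrightarrow>
    x \<in> closed_segment a b \<Longrightarrow> x \<in> closed_segment a' b' \<Longrightarrow> x \<in> {a, b} \<and> x \<in> {a', b'}"
  unfolding oriented_link_def by fast

lemma oriented_link_start_unique:
  "oriented_link E \<Longrightarrow> (a, b) \<in> E \<Longrightarrow> (a, b') \<in> E \<Longrightarrow> b = b'"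
  unfolding oriented_link_def using inj_onD[of fst E "(a, b)" "(a, b')"] by simp

lemma oriented_link_end_unique:
  "oriented_link E \<Longrightarrow> (a, b) \<in> E \<Longrightarrow> (a', b) \<in> E \<Longrightarrow> a = a'"
  unfolding oriented_link_def using inj_onD[of snd E "(a, b)" "(a', b)"] by simp

lemma oriented_link_nondegenerate: "oriented_link E \<Longrightarrow> (a, b) \<in> E \<Longrightarrow> a \<noteq> b"
  unfolding oriented_link_def by blast

lemma oriented_linkI:
  assumes "finite E" "E \<noteq> {}" "\<And>a b. (a, b) \<in> E \<Longrightarrow> a \<noteq> b"
    and "inj_on fst E" "inj_on snd E" "fst ` E = snd ` E"
    and meet: "\<And>a b a' b' x. (a, b) \<in> E \<Longrightarrow> (a', b') \<in> E \<Longrightarrow> (a, b) \<noteq> (a', b') \<Longrightarrow>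
      x \<in> closed_segment a b \<Longrightarrow> x \<in> closed_segment a' b' \<Longrightarrow> x \<in> {a', b'}"
  shows "oriented_link E"
proof -
  have "closed_segment a b \<inter> closed_segment a' b' \<subseteq> {a, b} \<inter> {a', b'}"
    if "(a, b) \<in> E" "(a', b') \<in> E" "(a, b) \<noteq> (a', b')" for a b a' b'
  proof
    fix x assume "x \<in> closed_segment a b \<inter> closed_segment a' b'"
    then have x: "x \<in> closed_segment a b" "x \<in> closed_segment a' b'" by simp_all
    show "x \<in> {a, b} \<inter> {a', b'}"
      using meet[OF that x] meet[OF that(2,1) that(3)[symmetric] x(2,1)] by (rule IntI[rotated])
  qed
  then show ?thesis using assms unfolding oriented_link_def by blast
qed

lemma oriented_link_parts:
  assumes "oriented_link E"
  shows "finite E" "inj_on fst E" "inj_on snd E" "fst ` E = snd ` E"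
  using assms unfolding oriented_link_def by blast+

lemma support_memI: "(a, b) \<in> R \<Longrightarrow> x \<in> closed_segment a b \<Longrightarrow> x \<in> support R"
  unfolding support_def by blast

lemma edge_ends_in_support: "(a, b) \<in> R \<Longrightarrow> p = a \<or> p = b \<Longrightarrow> p \<in> support R"
  using support_memI by fastforce

lemma support_memE:
  assumes "x \<in> support R"
  obtains a b where "(a, b) \<in> R" "x \<in> closed_segment a b"
  using assms unfolding support_def by blast

lemma support_Un: "support (R \<union> S) = support R \<union> support S"
  unfolding support_def by auto

lemma support_insert: "support (insert (a, b) S) = closed_segment a b \<union> support S"
  unfolding support_def by auto

text \<open>The new side of the triangle can meet the rest only in \<open>a\<close> and \<open>b\<close>. These are ends of the two
  old sides, so the link condition for the old sides shows that they are vertices of the rest as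
  well.\<close>

lemma delete_vertex:
  assumes L: "oriented_link (R \<union> {(a, p), (p, b)})"
    and R: "(a, p) \<notin> R" "(p, b) \<notin> R" and ab: "a \<noteq> b"
    and H: "convex hull {a, b, p} \<inter> support R \<subseteq> {a, b}"
  shows "oriented_link (R \<union> {(a, b)})"
    and "triangle_move (R \<union> {(a, b)}) (R \<union> {(a, p), (p, b)})"
proof -
  let ?E = "R \<union> {(a, p), (p, b)}" and ?E' = "R \<union> {(a, b)}"
  have ap: "a \<noteq> p" and pb: "p \<noteq> b"
    using oriented_link_nondegenerate[OF L, of a p] oriented_link_nondegenerate[OF L, of p b] by simp_all
  have starts: "a \<notin> fst ` R" "p \<notin> fst ` R"
  proof -
    have "(a, y) \<notin> R" "(p, y) \<notin> R" for y
      using oriented_link_start_unique[OF L, of a p y] oriented_link_start_unique[OF L, of p b y] R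
      by auto
    then show "a \<notin> fst ` R" "p \<notin> fst ` R" by force+
  qed
  have ends: "b \<notin> snd ` R" "p \<notin> snd ` R"
  proof -
    have "(y, b) \<notin> R" "(y, p) \<notin> R" for y
      using oriented_link_end_unique[OF L, of a p y] oriented_link_end_unique[OF L, of p b y] R
      by auto
    then show "b \<notin> snd ` R" "p \<notin> snd ` R" by force+
  qed
  have fin: "finite R" and inj: "inj_on fst R" "inj_on snd R" and eq: "fst ` ?E = snd ` ?E"
    using oriented_link_parts[OF L] by (simp_all add: inj_on_Un)
  have nd: "x \<noteq> y" if "(x, y) \<in> R" for x y
    using oriented_link_nondegenerate[OF L, of x y] that by simp
  have "insert p (insert a (fst ` R)) = insert p (insert b (snd ` R))" using eq by auto
  then have 1: "fst ` ?E' = snd ` ?E'"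
    using insert_ident[of p "insert a (fst ` R)" "insert b (snd ` R)"] ap pb starts ends by simp
  have 2: "inj_on fst ?E'" "inj_on snd ?E'"
    unfolding Un_insert_right Un_empty_right inj_on_insert using inj starts ends by auto
  have new: "x \<in> {a, b} \<and> x \<in> {a', b'}"
    if e: "(a', b') \<in> R" and x: "x \<in> closed_segment a b" "x \<in> closed_segment a' b'" for a' b' x
  proof -
    have "closed_segment a b \<subseteq> convex hull {a, b, p}"
      unfolding segment_convex_hull by (rule hull_mono) auto
    then have xab: "x = a \<or> x = b" using x e H support_memI by blast
    have ne: "(a, p) \<noteq> (a', b')" "(p, b) \<noteq> (a', b')" using e R by metis+
    have "a \<in> {a', b'}" if "x = a"
      using oriented_link_meet[OF L _ _ ne(1), of a] e that x(2) by simp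
    moreover have "b \<in> {a', b'}" if "x = b"
      using oriented_link_meet[OF L _ _ ne(2), of b] e that x(2) by simp
    ultimately show ?thesis using xab by blast
  qed
  show L': "oriented_link ?E'"
  proof (rule oriented_linkI)
    fix x y x' y' z
    assume e: "(x, y) \<in> ?E'" "(x', y') \<in> ?E'" "(x, y) \<noteq> (x', y')"
      and z: "z \<in> closed_segment x y" "z \<in> closed_segment x' y'"
    consider "(x, y) \<in> R" "(x', y') \<in> R" | "(x, y) = (a, b)" "(x', y') \<in> R"
      | "(x, y) \<in> R" "(x', y') = (a, b)"
      using e by blast
    then show "z \<in> {x', y'}"
    proof cases
      case 1
      then show ?thesis using oriented_link_meet[OF L _ _ e(3) z] by simp
    next
      case 2
      then show ?thesis using new[of x' y' z] z by simp
    next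
      case 3
      then show ?thesis using new[of x y z] z by simp
    qed
  qed (use fin nd ab 1 2 in \<open>auto simp del: inj_on_insert\<close>)
  show "triangle_move ?E' ?E"
    unfolding triangle_move_def using L L' H by blast
qed

text \<open>The new vertex lies in the triangle and differs from \<open>a\<close> and \<open>b\<close>, hence does not lie on the
  rest of the link.\<close>

lemma insert_vertex:
  assumes L: "oriented_link (R \<union> {(a, b)})" and R: "(a, b) \<notin> R"
    and H: "convex hull {a, b, p} \<inter> support R \<subseteq> {a, b}"
    and A: "closed_segment a p \<inter> closed_segment p b \<subseteq> {p}" and pa: "p \<noteq> a" "p \<noteq> b"
  shows "oriented_link (R \<union> {(a, p), (p, b)})"
    and "triangle_move (R \<union> {(a, b)}) (R \<union> {(a, p), (p, b)})"
proof -
  let ?E = "R \<union> {(a, b)}" and ?E' = "R \<union> {(a, p), (p, b)}"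
  have ab: "a \<noteq> b" using oriented_link_nondegenerate[OF L] by simp
  have starts: "a \<notin> fst ` R" and ends: "b \<notin> snd ` R"
  proof -
    have "(a, y) \<notin> R" for y using oriented_link_start_unique[OF L, of a b y] R by auto
    then show "a \<notin> fst ` R" by force
    have "(y, b) \<notin> R" for y using oriented_link_end_unique[OF L, of a b y] R by auto
    then show "b \<notin> snd ` R" by force
  qed
  have fin: "finite R" and inj: "inj_on fst R" "inj_on snd R" and eq: "fst ` ?E = snd ` ?E"
    using oriented_link_parts[OF L] by (simp_all add: inj_on_Un)
  have nd: "x \<noteq> y" if "(x, y) \<in> R" for x y
    using oriented_link_nondegenerate[OF L, of x y] that by simp
  have "p \<in> convex hull {a, b, p}" by (simp add: hull_inc)
  then have pR: "p \<notin> support R" using H pa by auto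
  have pe: "p \<notin> fst ` R" "p \<notin> snd ` R"
  proof -
    have "(p, y) \<notin> R" "(y, p) \<notin> R" for y using pR support_memI ends_in_segment by blast+
    then show "p \<notin> fst ` R" "p \<notin> snd ` R" by force+
  qed
  have 1: "fst ` ?E' = snd ` ?E'" using eq by auto
  have 2: "inj_on fst ?E'" "inj_on snd ?E'"
    unfolding Un_insert_right Un_empty_right inj_on_insert using inj starts ends pe pa by auto
  have sub: "closed_segment a p \<subseteq> convex hull {a, b, p}" "closed_segment p b \<subseteq> convex hull {a, b, p}"
    unfolding segment_convex_hull by (rule hull_mono, simp)+
  have nA: "b \<notin> closed_segment a p" "a \<notin> closed_segment p b" using A pa by auto
  have new: "x \<in> {u, v} \<and> x \<in> {a', b'}"
    if e: "(a', b') \<in> R" and uv: "(u, v) = (a, p) \<or> (u, v) = (p, b)"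
      and x: "x \<in> closed_segment u v" "x \<in> closed_segment a' b'" for a' b' u v x
  proof -
    have ne: "(a, b) \<noteq> (a', b')" using e R by metis
    have "x \<in> convex hull {a, b, p}" using uv x(1) sub by auto
    then have "x = a \<or> x = b" using e x(2) H support_memI by blast
    moreover have "a \<in> {a', b'}" if "x = a"
      using oriented_link_meet[OF L _ _ ne, of a] e that x(2) by simp
    moreover have "b \<in> {a', b'}" if "x = b"
      using oriented_link_meet[OF L _ _ ne, of b] e that x(2) by simp
    ultimately show ?thesis using uv x(1) nA by auto
  qed
  show L': "oriented_link ?E'"
  proof (rule oriented_linkI)
    fix x y x' y' z
    assume e: "(x, y) \<in> ?E'" "(x', y') \<in> ?E'" "(x, y) \<noteq> (x', y')"
      and z: "z \<in> closed_segment x y" "z \<in> closed_segment x' y'"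
    consider "(x, y) \<in> R" "(x', y') \<in> R" | "(x, y) = (a, p) \<or> (x, y) = (p, b)" "(x', y') \<in> R"
      | "(x, y) \<in> R" "(x', y') = (a, p) \<or> (x', y') = (p, b)"
      | "(x, y) = (a, p)" "(x', y') = (p, b)" | "(x, y) = (p, b)" "(x', y') = (a, p)"
      using e by blast
    then show "z \<in> {x', y'}"
    proof cases
      case 1
      then show ?thesis using oriented_link_meet[OF L _ _ e(3) z] by simp
    next
      case 2
      then show ?thesis using new z by blast
    next
      case 3
      then show ?thesis using new z by blast
    qed (use A z in auto)
  qed (use fin nd 1 2 pa in \<open>auto simp del: inj_on_insert\<close>)
  show "triangle_move ?E ?E'"
    unfolding triangle_move_def using L L' H by blast
qed

text \<open>Isotopy is reflexive on arbitrary sets of edges; here both ends are required to be links.\<close>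

definition link_iso :: "polygon \<Rightarrow> polygon \<Rightarrow> bool" where
  "link_iso E E' \<longleftrightarrow> oriented_link E \<and> oriented_link E' \<and> isotopic E E'"

lemma link_iso_refl: "oriented_link E \<Longrightarrow> link_iso E E"
  by (simp add: link_iso_def isotopic_def)

lemma link_iso_sym: "link_iso E E' \<Longrightarrow> link_iso E' E"
  by (auto simp: link_iso_def isotopic_def intro: equivclp_sym)

lemma link_iso_trans [trans]: "link_iso E E' \<Longrightarrow> link_iso E' E'' \<Longrightarrow> link_iso E E''"
  by (auto simp: link_iso_def isotopic_def intro: equivclp_trans)

lemma triangle_move_link_iso:
  assumes "triangle_move E E'"
  shows "link_iso E E'"
proof -
  have "oriented_link E" "oriented_link E'" using assms unfolding triangle_move_def by blast+
  then show ?thesis using assms by (auto simp: link_iso_def isotopic_def)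
qed

lemma link_iso_delete_vertex:
  assumes "oriented_link (R \<union> {(a, p), (p, b)})"
    and "(a, p) \<notin> R" "(p, b) \<notin> R" "a \<noteq> b" "convex hull {a, b, p} \<inter> support R \<subseteq> {a, b}"
  shows "link_iso (R \<union> {(a, p), (p, b)}) (R \<union> {(a, b)})"
  using delete_vertex[OF assms] triangle_move_link_iso link_iso_sym by blast

lemma link_iso_insert_vertex:
  assumes "oriented_link (R \<union> {(a, b)})" "(a, b) \<notin> R"
    and "convex hull {a, b, p} \<inter> support R \<subseteq> {a, b}"
    and "closed_segment a p \<inter> closed_segment p b \<subseteq> {p}" "p \<noteq> a" "p \<noteq> b"
  shows "link_iso (R \<union> {(a, b)}) (R \<union> {(a, p), (p, b)})"
  using insert_vertex[OF assms] triangle_move_link_iso by blast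

lemma convex_hull_collinear:
  assumes "p \<in> closed_segment a b"
  shows "convex hull {a, b, p} = closed_segment a b"
proof -
  have "convex hull (insert p {a, b}) = convex hull {a, b}"
    using assms by (intro hull_redundant) (simp add: segment_convex_hull)
  then show ?thesis by (simp add: segment_convex_hull insert_commute)
qed

lemma link_iso_delete_collinear:
  assumes L: "oriented_link (R \<union> {(a, p), (p, b)})"
    and R: "(a, p) \<notin> R" "(p, b) \<notin> R" and p: "p \<in> open_segment a b"
  shows "link_iso (R \<union> {(a, p), (p, b)}) (R \<union> {(a, b)})"
proof (rule link_iso_delete_vertex[OF L R])
  show "a \<noteq> b" using p by auto
  have pab: "p \<in> closed_segment a b" using p by (simp add: open_segment_def)
  have "x \<in> {a, b}" if x: "x \<in> closed_segment a b" "x \<in> support R" for x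
  proof -
    obtain a' b' where e: "(a', b') \<in> R" "x \<in> closed_segment a' b'" using x(2) support_memE by blast
    have ne: "(a', b') \<noteq> (a, p)" "(a', b') \<noteq> (p, b)" using e R by auto
    have "x \<in> closed_segment a p \<union> closed_segment p b"
      using x(1) Un_closed_segment[OF pab] by simp
    then have "x \<in> {a, b, p}" "x \<in> {a', b'}"
      using oriented_link_meet[OF L, of a p a' b' x] oriented_link_meet[OF L, of p b a' b' x] e ne
      by auto
    moreover have "p \<noteq> a'" "p \<noteq> b'"
      using oriented_link_start_unique[OF L, of p b' b] oriented_link_end_unique[OF L, of a' p a] e ne
      by auto
    ultimately show ?thesis by auto
  qed
  then show "convex hull {a, b, p} \<inter> support R \<subseteq> {a, b}"
    unfolding convex_hull_collinear[OF pab] by blast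
qed

lemma link_iso_insert_collinear:
  assumes L: "oriented_link (R \<union> {(a, b)})" and R: "(a, b) \<notin> R" and p: "p \<in> open_segment a b"
  shows "link_iso (R \<union> {(a, b)}) (R \<union> {(a, p), (p, b)})"
proof (rule link_iso_insert_vertex[OF L R])
  have pab: "p \<in> closed_segment a b" and ne: "p \<noteq> a" "p \<noteq> b"
    using p by (auto simp: open_segment_def)
  then show "p \<noteq> a" "p \<noteq> b" by auto
  show "convex hull {a, b, p} \<inter> support R \<subseteq> {a, b}"
  proof
    fix x assume "x \<in> convex hull {a, b, p} \<inter> support R"
    then have x: "x \<in> closed_segment a b" "x \<in> support R"
      using convex_hull_collinear[OF pab] by auto
    obtain a' b' where e: "(a', b') \<in> R" "x \<in> closed_segment a' b'" using x(2) support_memE by blast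
    then have "(a, b) \<noteq> (a', b')" using R by auto
    then show "x \<in> {a, b}" using oriented_link_meet[OF L _ _ _ x(1) e(2)] e(1) by auto
  qed
  show "closed_segment a p \<inter> closed_segment p b \<subseteq> {p}"
    using Int_closed_segment[of p a b] pab by auto
qed

text \<open>This relates a closed braid to the polygon obtained from it by subdividing its straight
  strands, which is easier to move.\<close>

lemma link_iso_merge_edges:
  fixes m :: "point \<times> point \<Rightarrow> point"
  defines "halves e \<equiv> {(fst e, m e), (m e, snd e)}"
  assumes "finite J"
    and "oriented_link (X \<union> (\<Union>e\<in>J. halves e))"
    and "\<And>e. e \<in> J \<Longrightarrow> m e \<in> open_segment (fst e) (snd e)"
    and "\<And>e. e \<in> J \<Longrightarrow> halves e \<inter> (X \<union> J) = {}"
    and "\<And>e e'. e \<in> J \<Longrightarrow> e' \<in> J \<Longrightarrow> e \<noteq> e' \<Longrightarrow> halves e \<inter> halves e' = {}"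
  shows "link_iso (X \<union> (\<Union>e\<in>J. halves e)) (X \<union> J)"
  using assms(2-)
proof (induction J arbitrary: X rule: finite_induct)
  case empty
  then show ?case by (simp add: link_iso_refl)
next
  case (insert e J)
  let ?R = "X \<union> (\<Union>e\<in>J. halves e)"
  have eq: "X \<union> (\<Union>e\<in>insert e J. halves e) = ?R \<union> {(fst e, m e), (m e, snd e)}"
    by (auto simp: halves_def)
  have dis: "halves e \<inter> ?R = {}"
    using insert.prems(3)[of e] insert.prems(4)[of e] insert.hyps(2) by blast
  have step: "link_iso (?R \<union> {(fst e, m e), (m e, snd e)}) (?R \<union> {(fst e, snd e)})"
    by (rule link_iso_delete_collinear)
       (use insert.prems(1) dis insert.prems(2)[of e] in \<open>auto simp: halves_def Un_commute\<close>)
  have eq': "?R \<union> {(fst e, snd e)} = insert e X \<union> (\<Union>e\<in>J. halves e)" by auto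
  have "link_iso (insert e X \<union> (\<Union>e\<in>J. halves e)) (insert e X \<union> J)"
  proof (rule insert.IH)
    show "oriented_link (insert e X \<union> (\<Union>e\<in>J. halves e))"
      using step eq' by (simp add: link_iso_def)
    show "m e' \<in> open_segment (fst e') (snd e')" if "e' \<in> J" for e'
      using insert.prems(2)[of e'] that by simp
    show "halves e' \<inter> (insert e X \<union> J) = {}" if "e' \<in> J" for e'
      using insert.prems(3)[of e'] that by simp
    show "halves e' \<inter> halves e'' = {}" if "e' \<in> J" "e'' \<in> J" "e' \<noteq> e''" for e' e''
      using insert.prems(4)[of e' e''] that by simp
  qed
  from link_iso_trans[OF step[unfolded eq'] this] show ?case unfolding eq by simp
qed

lemma support_reverse: "support (prod.swap ` E) = support E"
  by (auto simp: support_def closed_segment_commute)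

lemma oriented_link_reverse:
  assumes "oriented_link E"
  shows "oriented_link (prod.swap ` E)"
proof -
  have "fst ` prod.swap ` E = snd ` prod.swap ` E"
    using oriented_link_parts(4)[OF assms] by (simp add: image_image)
  moreover have "inj_on fst (prod.swap ` E)" "inj_on snd (prod.swap ` E)"
    using oriented_link_parts(2,3)[OF assms] by (auto simp: inj_on_def)
  moreover have "E \<noteq> {}" using assms by (simp add: oriented_link_def)
  ultimately show ?thesis
  proof (intro oriented_linkI)
    fix a b a' b' x
    assume e: "(a, b) \<in> prod.swap ` E" "(a', b') \<in> prod.swap ` E" "(a, b) \<noteq> (a', b')"
      and x: "x \<in> closed_segment a b" "x \<in> closed_segment a' b'"
    have "(b, a) \<in> E" "(b', a') \<in> E" "(b, a) \<noteq> (b', a')" using e by auto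
    then show "x \<in> {a', b'}"
      using oriented_link_meet[OF assms, of b a b' a' x] x by (auto simp: closed_segment_commute)
  qed (use oriented_link_parts(1)[OF assms] oriented_link_nondegenerate[OF assms] in auto)
qed

text \<open>By reversal, a contraction of a path that starts from its first vertex also applies to its
  last one.\<close>

lemma link_iso_reverse:
  assumes "link_iso E E'"
  shows "link_iso (prod.swap ` E) (prod.swap ` E')"
proof -
  have move: "triangle_move (prod.swap ` E) (prod.swap ` E')" if tm: "triangle_move E E'" for E E'
  proof -
    obtain R a b p where R: "E = R \<union> {(a, b)}" "E' = R \<union> {(a, p), (p, b)}"
      "convex hull {a, b, p} \<inter> support R \<subseteq> {a, b}" and L: "oriented_link E" "oriented_link E'"
      using tm unfolding triangle_move_def by blast
    have "prod.swap ` E = prod.swap ` R \<union> {(b, a)}"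
      "prod.swap ` E' = prod.swap ` R \<union> {(b, p), (p, a)}"
      "convex hull {b, a, p} \<inter> support (prod.swap ` R) \<subseteq> {b, a}"
      using R by (auto simp: support_reverse insert_commute)
    then show ?thesis
      unfolding triangle_move_def using oriented_link_reverse L by blast
  qed
  have "isotopic E E'" using assms by (simp add: link_iso_def)
  then have "isotopic (prod.swap ` E) (prod.swap ` E')"
    unfolding isotopic_def
  proof (induction rule: equivclp_induct)
    case (step y z)
    then show ?case using move by (meson equivclp_into_equivclp)
  qed simp
  then show ?thesis using assms oriented_link_reverse by (auto simp: link_iso_def)
qed


section \<open>Closed polygonal braids as lists of slabs\<close>

lemma pt_nth [simp]: "pt x y z $ 1 = x" "pt x y z $ 2 = y" "pt x y z $ 3 = z"
  by (simp_all add: pt_def)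

lemma point_eq_iff: "(a :: point) = b \<longleftrightarrow> a $ 1 = b $ 1 \<and> a $ 2 = b $ 2 \<and> a $ 3 = b $ 3"
  by (simp add: vec_eq_iff forall_3)

definition lift :: "real \<Rightarrow> real \<times> real \<Rightarrow> point" where
  "lift y p = pt (fst p) y (snd p)"

lemma lift_nth [simp]: "lift y p $ 1 = fst p" "lift y p $ 2 = y" "lift y p $ 3 = snd p"
  by (simp_all add: lift_def)

lemma lift_eq_iff [simp]: "lift y p = lift y' p' \<longleftrightarrow> y = y' \<and> p = p'"
  by (auto simp: point_eq_iff prod_eq_iff)

lemma eq_lift_iff: "x = lift y p \<longleftrightarrow> x $ 1 = fst p \<and> x $ 2 = y \<and> x $ 3 = snd p"
  by (simp add: point_eq_iff)

lemma closed_segment_nthE: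
  fixes a b :: point
  assumes "x \<in> closed_segment a b"
  obtains t where "0 \<le> t" "t \<le> 1" "x = (1 - t) *\<^sub>R a + t *\<^sub>R b" "\<And>i. x $ i = (1 - t) * a $ i + t * b $ i"
  using assms unfolding in_segment by force

lemma convex_hull_nth_le:
  fixes S :: "point set"
  assumes "x \<in> convex hull S" "\<And>s. s \<in> S \<Longrightarrow> s $ i \<le> M"
  shows "x $ i \<le> M"
proof -
  have "convex {x :: point. x $ i \<le> M}"
    by (auto simp: convex_def) (metis (no_types, opaque_lifting) add_mono distrib_right mult_1 mult_left_mono)
  then have "convex hull S \<subseteq> {x. x $ i \<le> M}" using assms(2) by (intro hull_minimal) auto
  then show ?thesis using assms(1) by auto
qed

lemma convex_hull_nth_ge:
  fixes S :: "point set"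
  assumes "x \<in> convex hull S" "\<And>s. s \<in> S \<Longrightarrow> s $ i \<ge> M"
  shows "x $ i \<ge> M"
proof -
  have "convex {x :: point. x $ i \<ge> M}"
    by (auto simp: convex_def) (metis (no_types, opaque_lifting) add_mono distrib_right mult_1 mult_left_mono)
  then have "convex hull S \<subseteq> {x. x $ i \<ge> M}" using assms(2) by (intro hull_minimal) auto
  then show ?thesis using assms(1) by auto
qed

text \<open>The open half space below \<open>a\<close> remains convex when the point \<open>a\<close> on its boundary is added.\<close>

lemma convex_hull_apex_max:
  fixes a :: point
  assumes x: "x \<in> convex hull (insert a S)" "x $ i \<ge> a $ i" and S: "\<And>s. s \<in> S \<Longrightarrow> s $ i < a $ i"
  shows "x = a"
proof -
  let ?C = "insert a {x :: point. x $ i < a $ i}"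
  have "convex ?C"
    unfolding convex_alt
  proof (intro ballI allI impI)
    fix p q :: point and u :: real
    assume p: "p \<in> ?C" and q: "q \<in> ?C" and u: "0 \<le> u \<and> u \<le> 1"
    have le: "p $ i \<le> a $ i" "q $ i \<le> a $ i" using p q by auto
    show "(1 - u) *\<^sub>R p + u *\<^sub>R q \<in> ?C"
    proof (cases "u = 0 \<or> u = 1 \<or> (p = a \<and> q = a)")
      case True
      then show ?thesis using p q by (auto simp flip: scaleR_left_distrib)
    next
      case False
      then have u': "0 < u" "u < 1" and "p $ i < a $ i \<or> q $ i < a $ i" using u p q by auto
      then have "(1 - u) * p $ i + u * q $ i < (1 - u) * a $ i + u * a $ i"
        using le by (elim disjE; intro add_less_le_mono add_le_less_mono) (auto intro: mult_left_mono)
      then show ?thesis by (simp add: algebra_simps)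
    qed
  qed
  moreover have "insert a S \<subseteq> ?C" using S by auto
  ultimately have "convex hull (insert a S) \<subseteq> ?C" by (intro hull_minimal)
  then show ?thesis using x by auto
qed

lemma convex_hull_apex_min:
  fixes a :: point
  assumes x: "x \<in> convex hull (insert a S)" "x $ i \<le> a $ i" and S: "\<And>s. s \<in> S \<Longrightarrow> a $ i < s $ i"
  shows "x = a"
proof -
  have "convex hull (uminus ` insert a S) = uminus ` (convex hull (insert a S))"
    using convex_hull_linear_image[of uminus "insert a S"] by (simp add: linear_uminus)
  then have "- x \<in> convex hull (insert (- a) (uminus ` S))" using x(1) by auto
  then have "- x = - a"
    by (rule convex_hull_apex_max[where i = i]) (use x(2) S in auto)
  then show ?thesis by simp
qed

lemma closed_segment_apex_max:
  fixes a b :: point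
  assumes "x \<in> closed_segment a b" "b $ i < a $ i" "x $ i \<ge> a $ i"
  shows "x = a"
  using assms unfolding segment_convex_hull by (intro convex_hull_apex_max[of x a "{b}" i]) auto

lemma closed_segment_apex_min:
  fixes a b :: point
  assumes "x \<in> closed_segment a b" "a $ i < b $ i" "x $ i \<le> a $ i"
  shows "x = a"
  using assms unfolding segment_convex_hull by (intro convex_hull_apex_min[of x a "{b}" i]) auto

lemma closed_segment_nth_bounds:
  fixes a b :: point
  assumes "x \<in> closed_segment a b"
  shows "min (a $ i) (b $ i) \<le> x $ i" "x $ i \<le> max (a $ i) (b $ i)"
  using assms unfolding segment_convex_hull
  by (auto intro: convex_hull_nth_le[of x "{a, b}"] convex_hull_nth_ge[of x "{a, b}"])

text \<open>First \<open>v'\<close> is inserted behind \<open>v\<close>, then \<open>v\<close> is deleted. The edges from \<open>a\<close> lie above and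
  those to \<open>b\<close> below the horizontal plane through \<open>v\<close> and \<open>v'\<close>, so that they meet only in that
  plane.\<close>

lemma link_iso_move_vertex:
  fixes a b v v' :: point
  assumes L: "oriented_link (R \<union> {(a, v), (v, b)})" and R: "(a, v) \<notin> R" "(v, b) \<notin> R"
    and h: "v' $ 2 = v $ 2" "v $ 2 < a $ 2" "b $ 2 < v $ 2" and ne: "v' \<noteq> v"
    and Ha: "convex hull {a, v, v'} \<inter> support R \<subseteq> {a}"
    and Hb: "convex hull {b, v, v'} \<inter> support R \<subseteq> {b}"
  shows "link_iso (R \<union> {(a, v), (v, b)}) (R \<union> {(a, v'), (v', b)})"
proof -
  have eq1: "R \<union> {(a, v), (v, b)} = (R \<union> {(a, v)}) \<union> {(v, b)}"
    and eq2: "(R \<union> {(a, v)}) \<union> {(v, v'), (v', b)} = (R \<union> {(v', b)}) \<union> {(a, v), (v, v')}"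
    and eq3: "(R \<union> {(v', b)}) \<union> {(a, v')} = R \<union> {(a, v'), (v', b)}"
    by auto
  have vb: "v' \<noteq> b" "v' \<noteq> a" using h by auto
  have step1: "link_iso ((R \<union> {(a, v)}) \<union> {(v, b)}) ((R \<union> {(a, v)}) \<union> {(v, v'), (v', b)})"
  proof (rule link_iso_insert_vertex)
    show "oriented_link (R \<union> {(a, v)} \<union> {(v, b)})" using L eq1 by simp
    show "(v, b) \<notin> R \<union> {(a, v)}" using R h by auto
    show "closed_segment v v' \<inter> closed_segment v' b \<subseteq> {v'}"
    proof
      fix x assume x: "x \<in> closed_segment v v' \<inter> closed_segment v' b"
      then have "x $ 2 \<ge> v' $ 2" using closed_segment_nth_bounds[of x v v' 2] h by auto
      then have "x = v'" by (intro closed_segment_apex_max[of x v' b 2]) (use x h in auto)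
      then show "x \<in> {v'}" by simp
    qed
    show "convex hull {v, b, v'} \<inter> support (R \<union> {(a, v)}) \<subseteq> {v, b}"
    proof
      fix x assume x: "x \<in> convex hull {v, b, v'} \<inter> support (R \<union> {(a, v)})"
      show "x \<in> {v, b}"
      proof (cases "x \<in> support R")
        case True
        then show ?thesis using x Hb by (auto simp: insert_commute)
      next
        case False
        then have xs: "x \<in> closed_segment v a" using x by (auto simp: support_insert closed_segment_commute)
        have "x $ 2 \<le> v $ 2" using x h by (intro convex_hull_nth_le[of x "{v, b, v'}"]) auto
        then have "x = v" by (intro closed_segment_apex_min[of x v a 2]) (use xs h in auto)
        then show ?thesis by simp
      qed
    qed
  qed (use ne vb in auto)
  have step2: "link_iso ((R \<union> {(v', b)}) \<union> {(a, v), (v, v')}) ((R \<union> {(v', b)}) \<union> {(a, v')})"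
  proof (rule link_iso_delete_vertex)
    show "oriented_link (R \<union> {(v', b)} \<union> {(a, v), (v, v')})"
      using step1 unfolding eq2 by (simp add: link_iso_def)
    show "(a, v) \<notin> R \<union> {(v', b)}" using R vb by auto
    have "(v, v') \<notin> R" using oriented_link_start_unique[OF L, of v b v'] vb by auto
    then show "(v, v') \<notin> R \<union> {(v', b)}" using ne by auto
    show "a \<noteq> v'" using vb by simp
    show "convex hull {a, v', v} \<inter> support (R \<union> {(v', b)}) \<subseteq> {a, v'}"
    proof
      fix x assume x: "x \<in> convex hull {a, v', v} \<inter> support (R \<union> {(v', b)})"
      show "x \<in> {a, v'}"
      proof (cases "x \<in> support R")
        case True
        then show ?thesis using x Ha by (auto simp: insert_commute)
      next
        case False
        then have xs: "x \<in> closed_segment v' b" using x by (auto simp: support_insert)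
        have "x $ 2 \<ge> v' $ 2" using x h by (intro convex_hull_nth_ge[of x "{a, v', v}"]) auto
        then have "x = v'" by (intro closed_segment_apex_max[of x v' b 2]) (use xs h in auto)
        then show ?thesis by simp
      qed
    qed
  qed
  show ?thesis
    using link_iso_trans[OF step1[unfolded eq2] step2] unfolding eq1[symmetric] eq3 .
qed

text \<open>A slab is the part of a closed braid between two consecutive heights: a pair \<open>(p, q)\<close> is a
  straight strand that starts at \<open>p\<close> in the upper and ends at \<open>q\<close> in the lower horizontal plane, where
  points of these planes have the coordinates $(x, z)$. Heights are half-integral because a letter
  takes two slabs, so that the vertex of its strand with the bend lies between them.\<close>

type_synonym slab = "((real \<times> real) \<times> (real \<times> real)) set"

definition ht :: "nat \<Rightarrow> real" where
  "ht k = - real k / 2"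

lemma ht_less_iff [simp]: "ht k < ht l \<longleftrightarrow> l < k" and ht_le_iff [simp]: "ht k \<le> ht l \<longleftrightarrow> l \<le> k"
  and ht_eq_iff [simp]: "ht k = ht l \<longleftrightarrow> k = l" and ht_0 [simp]: "ht 0 = 0"
  and ht_nonpos [simp]: "ht k \<le> 0" "\<not> 0 < ht k" and ht_eq_0_iff [simp]: "ht k = 0 \<longleftrightarrow> k = 0"
  by (auto simp: ht_def)

lemma ht_neq_1 [simp]: "ht k \<noteq> 1" "1 \<noteq> ht k"
  using ht_nonpos[of k] by linarith+

definition slab_edges :: "nat \<Rightarrow> slab \<Rightarrow> polygon" where
  "slab_edges k S = (\<lambda>(p, q). (lift (ht k) p, lift (ht (Suc k)) q)) ` S"

definition arc_edges :: "nat \<Rightarrow> nat \<Rightarrow> polygon" where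
  "arc_edges m j =
     {(lift (ht m) (real j, 0), lift (ht m) (real j, -1)),
      (lift (ht m) (real j, -1), lift 1 (real j, -1)),
      (lift 1 (real j, -1), lift 0 (real j, 0))}"

definition slab_closure :: "nat \<Rightarrow> slab list \<Rightarrow> polygon" where
  "slab_closure n L =
     (\<Union>k<length L. slab_edges k (L ! k)) \<union> (\<Union>j\<in>{1..n}. arc_edges (length L) j)"

text \<open>On the way down, the difference of two strands runs through the segment between their
  differences at the two ends; the strands are disjoint iff that segment misses zero. The bound
  keeps the strands in front of the closing arcs, which lie at depth \<open>-1\<close>.\<close>

definition good_slab :: "slab \<Rightarrow> bool" where
  "good_slab S \<longleftrightarrow> finite S \<and> (\<forall>(p, q)\<in>S. -1 < snd p \<and> -1 < snd q) \<and>
     (\<forall>e\<in>S. \<forall>e'\<in>S. e \<noteq> e' \<longrightarrow> 0 \<notin> closed_segment (fst e - fst e') (snd e - snd e'))"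

fun slab_path :: "(real \<times> real) set \<Rightarrow> slab list \<Rightarrow> (real \<times> real) set \<Rightarrow> bool" where
  "slab_path A [] B \<longleftrightarrow> A = B"
| "slab_path A (S # L) B \<longleftrightarrow> good_slab S \<and> fst ` S = A \<and> slab_path (snd ` S) L B"

definition stations :: "nat \<Rightarrow> (real \<times> real) set" where
  "stations n = (\<lambda>j. (real j, 0)) ` {1..n}"

lemma slab_path_append:
  "slab_path A (L @ M) B \<longleftrightarrow> (\<exists>C. slab_path A L C \<and> slab_path C M B)"
  by (induction L arbitrary: A) auto

definition level :: "(real \<times> real) set \<Rightarrow> slab list \<Rightarrow> nat \<Rightarrow> (real \<times> real) set" where
  "level A L k = (if k = 0 then A else snd ` (L ! (k - 1)))"

lemma slab_path_nth:
  "slab_path A L B \<Longrightarrow> k < length L \<Longrightarrow> good_slab (L ! k) \<and> fst ` (L ! k) = level A L k"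
proof (induction L arbitrary: A k)
  case (Cons S L)
  then show ?case
  proof (cases k)
    case (Suc k')
    then show ?thesis using Cons.IH[of "snd ` S" k'] Cons.prems by (auto simp: level_def nth_Cons')
  qed (auto simp: level_def)
qed simp

lemma slab_path_level_length: "slab_path A L B \<Longrightarrow> level A L (length L) = B"
proof (induction L arbitrary: A)
  case (Cons S L)
  then show ?case
    using Cons.IH[of "snd ` S"] by (cases "L = []") (simp_all add: level_def nth_Cons')
qed (simp add: level_def)

lemma slab_path_last:
  assumes "slab_path A L B" "(p, q) \<in> L ! k" "Suc k = length L"
  shows "q \<in> B"
proof -
  have "length L - 1 = k" "length L \<noteq> 0" using assms(3) by linarith+
  then have "q \<in> level A L (length L)"
    using assms(2) unfolding level_def by (auto intro: image_eqI[of _ snd "(p, q)"])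
  then show ?thesis using slab_path_level_length[OF assms(1)] by simp
qed

lemma good_slab_separate:
  assumes "good_slab S" "e \<in> S" "e' \<in> S" "e \<noteq> e'"
  shows "fst e \<noteq> fst e'" "snd e \<noteq> snd e'"
proof -
  have "0 \<notin> closed_segment (fst e - fst e') (snd e - snd e')" using assms by (simp add: good_slab_def)
  then show "fst e \<noteq> fst e'" "snd e \<noteq> snd e'" by auto
qed

text \<open>A common point of a triangle with a horizontal side and an edge lies at one height on both.
  Subtracting the two points at that height writes zero as a convex combination.\<close>

lemma convex_hull_lift_meet:
  assumes y: "y \<noteq> y'"
    and x: "x \<in> convex hull {lift y p, lift y' v, lift y' v'}"
    and x': "x \<in> closed_segment (lift y a) (lift y' b)"
  shows "0 \<in> convex hull {p - a, v - b, v' - b}"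
proof -
  obtain u1 u2 u3 where u: "0 \<le> u1" "0 \<le> u2" "0 \<le> u3" "u1 + u2 + u3 = 1"
    "x = u1 *\<^sub>R lift y p + u2 *\<^sub>R lift y' v + u3 *\<^sub>R lift y' v'"
    using x unfolding convex_hull_3 by blast
  obtain t where t: "x = (1 - t) *\<^sub>R lift y a + t *\<^sub>R lift y' b"
    using x' unfolding in_segment by blast
  have eq: "u1 *\<^sub>R lift y p + u2 *\<^sub>R lift y' v + u3 *\<^sub>R lift y' v' = (1 - t) *\<^sub>R lift y a + t *\<^sub>R lift y' b"
    using u(5) t by simp
  have c1: "u1 * fst p + u2 * fst v + u3 * fst v' = (1 - t) * fst a + t * fst b"
    and c2: "u1 * y + u2 * y' + u3 * y' = (1 - t) * y + t * y'"
    and c3: "u1 * snd p + u2 * snd v + u3 * snd v' = (1 - t) * snd a + t * snd b"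
    using arg_cong[OF eq, of "\<lambda>x. x $ 1"] arg_cong[OF eq, of "\<lambda>x. x $ 2"] arg_cong[OF eq, of "\<lambda>x. x $ 3"]
    by simp_all
  have "t = u2 + u3"
  proof -
    have u1: "u1 = 1 - u2 - u3" using u(4) by simp
    have "(t - (u2 + u3)) * (y - y') = 0" using c2 unfolding u1 by (simp add: algebra_simps)
    then show ?thesis using y by simp
  qed
  moreover from this have "1 - t = u1" using u(4) by simp
  ultimately have "u1 * fst p + u2 * fst v + u3 * fst v' = u1 * fst a + (u2 + u3) * fst b"
    "u1 * snd p + u2 * snd v + u3 * snd v' = u1 * snd a + (u2 + u3) * snd b"
    using c1 c3 by metis+
  then have "u1 *\<^sub>R (p - a) + u2 *\<^sub>R (v - b) + u3 *\<^sub>R (v' - b) = 0"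
    by (simp add: prod_eq_iff algebra_simps)
  then show ?thesis unfolding convex_hull_3 using u(1-4) by force
qed

lemma slab_edge_meet:
  assumes "k' = Suc k" "x \<in> closed_segment (lift (ht k) p) (lift (ht k') q)"
    and "x \<in> closed_segment (lift (ht k) a) (lift (ht k') b)"
  shows "0 \<in> closed_segment (p - a) (q - b)"
proof -
  have "x \<in> convex hull {lift (ht k) p, lift (ht k') q, lift (ht k') q}"
    using assms(2) by (simp add: segment_convex_hull)
  then have "0 \<in> convex hull {p - a, q - b, q - b}"
    by (rule convex_hull_lift_meet[rotated]) (use assms in auto)
  then show ?thesis by (simp add: segment_convex_hull)
qed

text \<open>The strands of the various slabs and the three parts of a closing arc can be told apart by height
  and depth.\<close>

lemma slab_edge_points:
  assumes S: "good_slab S" "(p, q) \<in> S" and x: "x \<in> closed_segment (lift (ht k) p) (lift (ht (Suc k)) q)"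
  shows "x $ 2 \<le> ht k" "ht (Suc k) \<le> x $ 2" "-1 < x $ 3"
    "x $ 2 = ht k \<Longrightarrow> x = lift (ht k) p" "x $ 2 = ht (Suc k) \<Longrightarrow> x = lift (ht (Suc k)) q"
proof -
  show "x $ 2 \<le> ht k" "ht (Suc k) \<le> x $ 2"
    using closed_segment_nth_bounds[OF x, of 2] by (simp_all add: min_def max_def)
  have "-1 < snd p" "-1 < snd q" using S by (auto simp: good_slab_def)
  then show "-1 < x $ 3" using closed_segment_nth_bounds(1)[OF x, of 3] by simp
  show "x = lift (ht k) p" if "x $ 2 = ht k"
    using x that by (intro closed_segment_apex_max[of x _ _ 2]) auto
  show "x = lift (ht (Suc k)) q" if "x $ 2 = ht (Suc k)"
    using x that by (intro closed_segment_apex_min[of x _ "lift (ht k) p" 2]) (auto simp: closed_segment_commute)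
qed

lemma arc1_points:
  assumes "x \<in> closed_segment (lift (ht m) (real j, 0)) (lift (ht m) (real j, -1))"
  shows "x $ 1 = real j" "x $ 2 = ht m" "-1 \<le> x $ 3" "x $ 3 \<le> 0"
  using closed_segment_nth_bounds[OF assms, of 1] closed_segment_nth_bounds[OF assms, of 2]
    closed_segment_nth_bounds[OF assms, of 3] by auto

lemma arc2_points:
  assumes "x \<in> closed_segment (lift (ht m) (real j, -1)) (lift 1 (real j, -1))"
  shows "x $ 1 = real j" "ht m \<le> x $ 2" "x $ 2 \<le> 1" "x $ 3 = -1"
proof -
  have "ht m \<le> 1" using ht_nonpos[of m] by linarith
  then show "x $ 1 = real j" "ht m \<le> x $ 2" "x $ 2 \<le> 1" "x $ 3 = -1"
  using closed_segment_nth_bounds[OF assms, of 1] closed_segment_nth_bounds[OF assms, of 2]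
    closed_segment_nth_bounds[OF assms, of 3] by auto
qed

lemma arc3_points:
  assumes "x \<in> closed_segment (lift 1 (real j, -1)) (lift 0 (real j, 0))"
  shows "x $ 1 = real j" "0 \<le> x $ 2" "x $ 2 \<le> 1" "x $ 3 = - x $ 2"
  using assms by (auto elim!: closed_segment_nthE simp: algebra_simps)

lemma slab_closure_edgeE:
  assumes "(a, b) \<in> slab_closure n L"
  obtains (slab) k p q where "k < length L" "(p, q) \<in> L ! k" "a = lift (ht k) p" "b = lift (ht (Suc k)) q"
  | (arc1) j where "j \<in> {1..n}" "a = lift (ht (length L)) (real j, 0)" "b = lift (ht (length L)) (real j, -1)"
  | (arc2) j where "j \<in> {1..n}" "a = lift (ht (length L)) (real j, -1)" "b = lift 1 (real j, -1)"
  | (arc3) j where "j \<in> {1..n}" "a = lift 1 (real j, -1)" "b = lift 0 (real j, 0)"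
proof -
  consider "(a, b) \<in> (\<Union>k<length L. slab_edges k (L ! k))"
    | "(a, b) \<in> (\<Union>j\<in>{1..n}. arc_edges (length L) j)"
    using assms unfolding slab_closure_def by blast
  then show ?thesis
  proof cases
    case 1
    then show ?thesis using slab by (auto simp: slab_edges_def)
  next
    case 2
    then show ?thesis using arc1 arc2 arc3 unfolding arc_edges_def by blast
  qed
qed

text \<open>Two edges that are not strands of the same slab are separated by height, by depth or by the
  position of their closing arcs, up to common vertices.\<close>

lemma oriented_link_slab_closure:
  assumes path: "slab_path (stations n) L (stations n)" and n: "n \<ge> 1"
  shows "oriented_link (slab_closure n L)"
proof (rule oriented_linkI)
  let ?m = "length L"
  have good: "good_slab (L ! k)" and lev: "fst ` (L ! k) = level (stations n) L k" if "k < ?m" for k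
    using slab_path_nth[OF path that] by auto
  have last: "level (stations n) L ?m = stations n" by (rule slab_path_level_length[OF path])
  have bottom: "\<exists>j. q = (real j, 0)" if "(p, q) \<in> L ! k" "Suc k = ?m" for p q k
    using slab_path_last[OF path that] by (auto simp: stations_def)
  have z: "-1 < snd p" "-1 < snd q" if "(p, q) \<in> L ! k" "k < ?m" for p q k
    using good[OF that(2)] that(1) by (auto simp: good_slab_def)
  have "finite (L ! k)" if "k < ?m" for k using good[OF that] by (simp add: good_slab_def)
  then show "finite (slab_closure n L)"
    unfolding slab_closure_def slab_edges_def arc_edges_def by auto
  have "arc_edges ?m 1 \<subseteq> slab_closure n L" using n by (auto simp: slab_closure_def)
  then show "slab_closure n L \<noteq> {}" by (auto simp: arc_edges_def)
  show "a \<noteq> b" if "(a, b) \<in> slab_closure n L" for a b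
    using that by (cases rule: slab_closure_edgeE) auto
  have start: "b = b'" if "(a, b) \<in> slab_closure n L" "(a, b') \<in> slab_closure n L" for a b b'
    using that(1)
  proof (cases rule: slab_closure_edgeE)
    case (slab k p q)
    note 1 = slab
    from that(2) show ?thesis
    proof (cases rule: slab_closure_edgeE)
      case (slab k' p' q')
      then have "(p, q) \<in> L ! k" "(p, q') \<in> L ! k" "good_slab (L ! k)" using 1 good by auto
      then have "(p, q) = (p, q')" using good_slab_separate(1)[of "L ! k" "(p, q)" "(p, q')"] by auto
      then show ?thesis using 1 slab by auto
    qed (use 1 in auto)
  qed (use that(2) in \<open>auto elim!: slab_closure_edgeE\<close>)
  have "end": "a = a'" if "(a, b) \<in> slab_closure n L" "(a', b) \<in> slab_closure n L" for a b a'
    using that(1)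
  proof (cases rule: slab_closure_edgeE)
    case (slab k p q)
    note 1 = slab
    from that(2) show ?thesis
    proof (cases rule: slab_closure_edgeE)
      case (slab k' p' q')
      then have "(p, q) \<in> L ! k" "(p', q) \<in> L ! k" "good_slab (L ! k)" using 1 good by auto
      then have "(p, q) = (p', q)" using good_slab_separate(2)[of "L ! k" "(p, q)" "(p', q)"] by auto
      then show ?thesis using 1 slab by auto
    qed (use 1 z[of p q k] in auto)
  next
    case (arc1 j)
    note 1 = arc1
    from that(2) show ?thesis
    proof (cases rule: slab_closure_edgeE)
      case (slab k p q)
      then show ?thesis using 1 z[of p q k] by auto
    qed (use 1 in auto)
  qed (use that(2) in \<open>auto elim!: slab_closure_edgeE\<close>)
  show "inj_on fst (slab_closure n L)" "inj_on snd (slab_closure n L)"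
    using start "end" by (auto simp: inj_on_def)
  show "fst ` slab_closure n L = snd ` slab_closure n L"
  proof -
    let ?P = "\<lambda>k. lift (ht k) ` level (stations n) L k"
    let ?rest = "(\<lambda>j. lift (ht ?m) (real j, -1)) ` {1..n} \<union> (\<lambda>j. lift 1 (real j, -1)) ` {1..n}"
    have P0: "?P 0 = (\<lambda>j. lift 0 (real j, 0)) ` {1..n}"
      and Pm: "?P ?m = (\<lambda>j. lift (ht ?m) (real j, 0)) ` {1..n}"
      unfolding last by (auto simp: level_def stations_def)
    have f: "fst ` slab_edges k (L ! k) = ?P k" if "k < ?m" for k
      unfolding lev[OF that, symmetric] by (simp add: slab_edges_def image_image case_prod_beta)
    have s: "snd ` slab_edges k (L ! k) = ?P (Suc k)" if "k < ?m" for k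
      by (simp add: slab_edges_def level_def image_image case_prod_beta)
    have "fst ` slab_closure n L = (\<Union>k<?m. ?P k) \<union> ?P ?m \<union> ?rest"
    proof -
      have "(\<Union>k<?m. fst ` slab_edges k (L ! k)) = (\<Union>k<?m. ?P k)" using f by simp
      moreover have "(\<Union>j\<in>{1..n}. fst ` arc_edges ?m j)
          = (\<lambda>j. lift (ht ?m) (real j, 0)) ` {1..n} \<union> ?rest"
        unfolding arc_edges_def image_insert image_empty fst_conv by blast
      ultimately show ?thesis
        unfolding slab_closure_def image_Un image_UN Pm by (simp only: Un_assoc)
    qed
    also have "(\<Union>k<?m. ?P k) \<union> ?P ?m = (\<Union>k\<le>?m. ?P k)"
      unfolding lessThan_Suc_atMost[symmetric] lessThan_Suc by auto
    also have "\<dots> = ?P 0 \<union> (\<Union>k<?m. ?P (Suc k))"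
    proof -
      have "{..?m} = insert 0 (Suc ` {..<?m})" by (simp only: image_Suc_lessThan) auto
      then show ?thesis by simp
    qed
    also have "\<dots> \<union> ?rest = snd ` slab_closure n L"
    proof -
      have "(\<Union>k<?m. snd ` slab_edges k (L ! k)) = (\<Union>k<?m. ?P (Suc k))" using s by simp
      moreover have "(\<Union>j\<in>{1..n}. snd ` arc_edges ?m j)
          = (\<lambda>j. lift 0 (real j, 0)) ` {1..n} \<union> ?rest"
        unfolding arc_edges_def image_insert image_empty snd_conv by blast
      ultimately show ?thesis
        unfolding slab_closure_def image_Un image_UN P0 by (simp only: Un_ac)
    qed
    finally show ?thesis .
  qed
  fix a b a' b' x
  assume e: "(a, b) \<in> slab_closure n L" "(a', b') \<in> slab_closure n L" "(a, b) \<noteq> (a', b')"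
    and x: "x \<in> closed_segment a b" "x \<in> closed_segment a' b'"
  from e(1) show "x \<in> {a', b'}"
  proof (cases rule: slab_closure_edgeE)
    case (slab k p q)
    note 1 = slab
    note X = slab_edge_points[OF good[OF 1(1)] 1(2) x(1)[unfolded 1]]
    from e(2) show ?thesis
    proof (cases rule: slab_closure_edgeE)
      case (slab k' p' q')
      note X' = slab_edge_points[OF good[OF slab(1)] slab(2) x(2)[unfolded slab]]
      consider "k = k'" | "k < k'" | "k' < k" by linarith
      then show ?thesis
      proof cases
        case 1
        have "0 \<in> closed_segment (p - p') (q - q')"
          using slab_edge_meet[of "Suc k" k x p q p' q'] x \<open>a = _\<close> \<open>b = _\<close> slab 1 by simp
        moreover have "(p, q) \<noteq> (p', q')" using e(3) \<open>a = _\<close> \<open>b = _\<close> slab 1 by auto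
        moreover have "(p, q) \<in> L ! k" "(p', q') \<in> L ! k" "good_slab (L ! k)"
          using \<open>(p, q) \<in> L ! k\<close> slab 1 good by auto
        ultimately show ?thesis unfolding good_slab_def by fastforce
      next
        case 2
        then have "ht k' \<le> ht (Suc k)" by simp
        then have "x $ 2 = ht k'" using X(2) X'(1) by linarith
        then show ?thesis using X'(4) slab by simp
      next
        case 3
        then have "ht k \<le> ht (Suc k')" by simp
        then have "x $ 2 = ht (Suc k')" using X(1) X'(2) by linarith
        then show ?thesis using X'(5) slab by simp
      qed
    next
      case (arc1 j)
      note X' = arc1_points[OF x(2)[unfolded arc1]]
      have "ht ?m \<le> ht (Suc k)" using 1 by simp
      then have "x $ 2 = ht (Suc k)" "ht (Suc k) = ht ?m" using X(2) X'(2) by linarith+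
      then have "x = lift (ht (Suc k)) q" "Suc k = ?m" using X(5) by auto
      moreover then obtain j' where "q = (real j', 0)" using bottom 1 by blast
      ultimately show ?thesis using X'(1) arc1 by simp
    next
      case (arc2 j)
      then show ?thesis using X(3) arc2_points(4)[OF x(2)[unfolded arc2]] by simp
    next
      case (arc3 j)
      note X' = arc3_points[OF x(2)[unfolded arc3]]
      have "x $ 2 = 0" using X'(2) X(1) ht_nonpos[of k] by linarith
      then have "x = lift 0 (real j, 0)" using X' by (simp add: eq_lift_iff)
      then show ?thesis using arc3 by simp
    qed
  next
    case (arc1 j)
    note 1 = arc1 and X = arc1_points[OF x(1)[unfolded arc1]]
    from e(2) show ?thesis
    proof (cases rule: slab_closure_edgeE)
      case (slab k p q)
      note X' = slab_edge_points[OF good[OF slab(1)] slab(2) x(2)[unfolded slab]]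
      have "ht ?m \<le> ht (Suc k)" using slab by simp
      then have "x $ 2 = ht (Suc k)" using X'(2) X(2) by linarith
      then show ?thesis using X'(5) slab by simp
    next
      case (arc1 j')
      then show ?thesis using X(1) arc1_points(1)[OF x(2)[unfolded arc1]] 1 e(3) by simp
    next
      case (arc2 j')
      note X' = arc2_points[OF x(2)[unfolded arc2]]
      have "x = lift (ht ?m) (real j', -1)" using X X' by (simp add: eq_lift_iff)
      then show ?thesis using arc2 by simp
    next
      case (arc3 j')
      note X' = arc3_points[OF x(2)[unfolded arc3]]
      have "x $ 2 = 0" using X'(2) X(2) ht_nonpos[of ?m] by linarith
      then have "x = lift 0 (real j', 0)" using X' by (simp add: eq_lift_iff)
      then show ?thesis using arc3 by simp
    qed
  next
    case (arc2 j)
    note 1 = arc2 and X = arc2_points[OF x(1)[unfolded arc2]]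
    from e(2) show ?thesis
    proof (cases rule: slab_closure_edgeE)
      case (slab k p q)
      then show ?thesis using slab_edge_points(3)[OF good[OF slab(1)] slab(2) x(2)[unfolded slab]] X(4) by simp
    next
      case (arc1 j')
      note X' = arc1_points[OF x(2)[unfolded arc1]]
      have "x = lift (ht ?m) (real j', -1)" using X X' by (simp add: eq_lift_iff)
      then show ?thesis using arc1 by simp
    next
      case (arc2 j')
      then show ?thesis using X(1) arc2_points(1)[OF x(2)[unfolded arc2]] 1 e(3) by simp
    next
      case (arc3 j')
      note X' = arc3_points[OF x(2)[unfolded arc3]]
      have "x = lift 1 (real j', -1)" using X X' by (simp add: eq_lift_iff)
      then show ?thesis using arc3 by simp
    qed
  next
    case (arc3 j)
    note 1 = arc3 and X = arc3_points[OF x(1)[unfolded arc3]]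
    from e(2) show ?thesis
    proof (cases rule: slab_closure_edgeE)
      case (slab k p q)
      note X' = slab_edge_points[OF good[OF slab(1)] slab(2) x(2)[unfolded slab]]
      have "x $ 2 = ht k" using X(2) X'(1) ht_nonpos[of k] by linarith
      then show ?thesis using X'(4) slab by simp
    next
      case (arc1 j')
      note X' = arc1_points[OF x(2)[unfolded arc1]]
      have "ht ?m = x $ 2" "x $ 2 = 0" using X(2) X'(2) ht_nonpos[of ?m] by linarith+
      then have "x = lift (ht ?m) (real j', 0)" using X X' by (simp add: eq_lift_iff)
      then show ?thesis using arc1 by simp
    next
      case (arc2 j')
      note X' = arc2_points[OF x(2)[unfolded arc2]]
      have "x = lift 1 (real j', -1)" using X X' by (simp add: eq_lift_iff)
      then show ?thesis using arc2 by simp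
    next
      case (arc3 j')
      then show ?thesis using X(1) arc3_points(1)[OF x(2)[unfolded arc3]] 1 e(3) by simp
    qed
  qed
qed


section \<open>Moving the strands of a slab list\<close>

lemma slab_closure_insert_strand:
  fixes L n
  assumes "Suc k < length L"
  shows "slab_closure n (L[k := insert (p, w) (L ! k), Suc k := insert (w, q) (L ! Suc k)])
    = slab_closure n L \<union> {(lift (ht k) p, lift (ht (Suc k)) w), (lift (ht (Suc k)) w, lift (ht (Suc (Suc k))) q)}"
    (is "slab_closure n ?L = _ \<union> {?e, ?f}")
proof -
  have len: "length ?L = length L" by simp
  have e: "slab_edges i (?L ! i) = slab_edges i (L ! i) \<union> (if i = k then {?e} else if i = Suc k then {?f} else {})"
    if "i < length L" for i
    using that assms by (auto simp: nth_list_update slab_edges_def)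
  have "(\<Union>i<length L. slab_edges i (?L ! i))
     = (\<Union>i<length L. slab_edges i (L ! i)) \<union> (\<Union>i<length L. if i = k then {?e} else if i = Suc k then {?f} else {})"
    using e by (simp add: UN_Un_distrib)
  also have "(\<Union>i<length L. if i = k then {?e} else if i = Suc k then {?f} else {}) = {?e, ?f}"
  proof (intro equalityI subsetI)
    fix x assume "x \<in> {?e, ?f}"
    then show "x \<in> (\<Union>i<length L. if i = k then {?e} else if i = Suc k then {?f} else {})"
      using assms by (auto intro!: bexI[of _ k] bexI[of _ "Suc k"])
  qed (auto split: if_splits)
  finally show ?thesis unfolding slab_closure_def len by auto
qed

text \<open>The moving vertex sweeps out two triangles. At each height they are cut in an interval, and the
  conditions in the plane, \<open>H1\<close> and \<open>H2\<close>, say that no other strand passes through it.\<close>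

lemma link_iso_move_slab_vertex:
  fixes L n k p q
  defines "M w \<equiv> L[k := insert (p, w) (L ! k), Suc k := insert (w, q) (L ! Suc k)]"
  assumes n: "n \<ge> 1" and k: "Suc k < length L"
    and path: "slab_path (stations n) (M v) (stations n)"
    and new: "(p, v) \<notin> L ! k" "(v, q) \<notin> L ! Suc k"
    and z: "-1 < snd v'"
    and H1: "\<And>a b. (a, b) \<in> L ! k \<Longrightarrow> 0 \<notin> convex hull {p - a, v - b, v' - b}"
    and H2: "\<And>a b. (a, b) \<in> L ! Suc k \<Longrightarrow> 0 \<notin> convex hull {q - b, v - a, v' - a}"
  shows "link_iso (slab_closure n (M v)) (slab_closure n (M v'))"
proof (cases "v' = v")
  case True
  then show ?thesis using link_iso_refl oriented_link_slab_closure[OF path n] by simp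
next
  case False
  let ?m = "length L"
  let ?a = "lift (ht k) p" and ?v = "lift (ht (Suc k)) v" and ?v' = "lift (ht (Suc k)) v'"
    and ?b = "lift (ht (Suc (Suc k))) q"
  let ?R = "slab_closure n L"
  have M: "slab_closure n (M w) = ?R \<union> {(?a, lift (ht (Suc k)) w), (lift (ht (Suc k)) w, ?b)}" for w
    unfolding M_def by (rule slab_closure_insert_strand[OF k])
  have len: "length (M v) = ?m" by (simp add: M_def)
  have good: "good_slab (M v ! i)" and lev: "fst ` (M v ! i) = level (stations n) (M v) i" if "i < ?m" for i
    using slab_path_nth[OF path] that len by auto
  have sub: "L ! i \<subseteq> M v ! i" if "i < ?m" for i
    using that k by (auto simp: M_def nth_list_update)
  have Mk: "M v ! k = insert (p, v) (L ! k)" "M v ! Suc k = insert (v, q) (L ! Suc k)"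
    using k by (simp_all add: M_def)
  have z': "-1 < snd p" "-1 < snd v" "-1 < snd q"
    using good[of k] good[of "Suc k"] k unfolding Mk by (auto simp: good_slab_def)
  \<comment> \<open>a strand that ends on a plane continues below it, and conversely; the point of a neighbouring
    slab on that plane is thus also an end of a strand of the slab itself\<close>
  have succ: "\<exists>q0. (q', q0) \<in> M v ! Suc k" if "(p', q') \<in> M v ! k" for p' q'
  proof -
    have "q' \<in> level (stations n) (M v) (Suc k)" using that by (force simp: level_def)
    then have "q' \<in> fst ` (M v ! Suc k)" using lev[of "Suc k"] k by simp
    then show ?thesis by (metis imageE prod.collapse)
  qed
  have pred: "\<exists>p0. (p0, p') \<in> M v ! k" if "(p', q') \<in> M v ! Suc k" for p' q'
  proof -
    have "p' \<in> level (stations n) (M v) (Suc k)" using that lev[of "Suc k"] k by force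
    then have "p' \<in> snd ` (M v ! k)" by (simp add: level_def)
    then show ?thesis by (metis imageE prod.collapse)
  qed
  have lower: "x = ?a" if x: "x \<in> convex hull {?a, ?v, ?v'}" "x \<in> support ?R" for x
  proof -
    have hi: "x $ 2 \<le> ht k" using x(1) by (rule convex_hull_nth_le) auto
    have lo: "ht (Suc k) \<le> x $ 2" using x(1) by (rule convex_hull_nth_ge) auto
    have "min (snd p) (min (snd v) (snd v')) \<le> x $ 3" using x(1) by (rule convex_hull_nth_ge) auto
    then have zx: "-1 < x $ 3" using z z' by linarith
    have top: "x = ?a" if "x $ 2 \<ge> ht k"
      using x(1) that by (intro convex_hull_apex_max[of x ?a "{?v, ?v'}" 2]) auto
    obtain a' b' where e: "(a', b') \<in> ?R" and xe: "x \<in> closed_segment a' b'"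
      using x(2) support_memE by blast
    from e show ?thesis
    proof (cases rule: slab_closure_edgeE)
      case (slab i p' q')
      note X' = slab_edge_points[OF good[OF slab(1)] subsetD[OF sub[OF slab(1)] slab(2)] xe[unfolded slab]]
      consider "i < k" | "i = k" | "k < i" by linarith
      then show ?thesis
      proof cases
        case 1
        then have "ht k \<le> ht (Suc i)" by simp
        then show ?thesis using X'(2) top by linarith
      next
        case 2
        have "0 \<in> convex hull {p - p', v - q', v' - q'}"
          by (rule convex_hull_lift_meet[OF _ x(1)]) (use xe slab 2 in auto)
        then show ?thesis using H1 slab 2 by blast
      next
        case 3
        then have "ht i \<le> ht (Suc k)" by simp
        then have "x $ 2 = ht i" "ht i = ht (Suc k)" using X'(1) lo by linarith+
        then have xi: "x = lift (ht (Suc k)) p'" and i: "i = Suc k" using X'(4) by auto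
        have pq': "(p', q') \<in> L ! Suc k" using slab i by simp
        then have "(p', q') \<in> M v ! Suc k" using Mk by simp
        then obtain p0 where p0: "(p0, p') \<in> M v ! k" using pred by blast
        show ?thesis
        proof (cases "(p0, p') = (p, v)")
          case True
          have "(p', q') = (v, q)"
            using good_slab_separate(1)[OF good[OF k], of "(p', q')" "(v, q)"] True pq' Mk by auto
          then show ?thesis using pq' new by simp
        next
          case False
          then have p0': "(p0, p') \<in> L ! k" using p0 False unfolding Mk by blast
          have "0 \<in> convex hull {p - p0, v - p', v' - p'}"
            by (rule convex_hull_lift_meet[OF _ x(1)]) (use xi in auto)
          then show ?thesis using H1[OF p0'] by blast
        qed
      qed
    next
      case (arc1 j)
      have "ht ?m < ht (Suc k)" using k by simp
      then show ?thesis using arc1_points(2)[OF xe[unfolded arc1]] lo by linarith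
    next
      case (arc2 j)
      then show ?thesis using arc2_points(4)[OF xe[unfolded arc2]] zx by simp
    next
      case (arc3 j)
      show ?thesis using arc3_points(2)[OF xe[unfolded arc3]] ht_nonpos[of k] top by linarith
    qed
  qed
  have upper: "x = ?b" if x: "x \<in> convex hull {?b, ?v, ?v'}" "x \<in> support ?R" for x
  proof -
    have hi: "x $ 2 \<le> ht (Suc k)" using x(1) by (rule convex_hull_nth_le) auto
    have lo: "ht (Suc (Suc k)) \<le> x $ 2" using x(1) by (rule convex_hull_nth_ge) auto
    have "min (snd q) (min (snd v) (snd v')) \<le> x $ 3" using x(1) by (rule convex_hull_nth_ge) auto
    then have zx: "-1 < x $ 3" using z z' by linarith
    have bot: "x = ?b" if "x $ 2 \<le> ht (Suc (Suc k))"
      using x(1) that by (intro convex_hull_apex_min[of x ?b "{?v, ?v'}" 2]) auto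
    obtain a' b' where e: "(a', b') \<in> ?R" and xe: "x \<in> closed_segment a' b'"
      using x(2) support_memE by blast
    from e show ?thesis
    proof (cases rule: slab_closure_edgeE)
      case (slab i p' q')
      note X' = slab_edge_points[OF good[OF slab(1)] subsetD[OF sub[OF slab(1)] slab(2)] xe[unfolded slab]]
      consider "Suc k < i" | "i = Suc k" | "i < Suc k" by linarith
      then show ?thesis
      proof cases
        case 1
        then have "ht i \<le> ht (Suc (Suc k))" by simp
        then show ?thesis using X'(1) bot by linarith
      next
        case 2
        have "0 \<in> convex hull {q - q', v - p', v' - p'}"
          by (rule convex_hull_lift_meet[OF _ x(1)]) (use xe slab 2 in \<open>auto simp: closed_segment_commute\<close>)
        then show ?thesis using H2 slab 2 by blast
      next
        case 3
        then have "ht (Suc k) \<le> ht (Suc i)" by simp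
        then have "x $ 2 = ht (Suc i)" "ht (Suc i) = ht (Suc k)" using X'(2) hi by linarith+
        then have xi: "x = lift (ht (Suc k)) q'" and i: "i = k" using X'(5) by auto
        have pq': "(p', q') \<in> L ! k" using slab i by simp
        then have "(p', q') \<in> M v ! k" using Mk by simp
        then obtain q0 where q0: "(q', q0) \<in> M v ! Suc k" using succ by blast
        show ?thesis
        proof (cases "(q', q0) = (v, q)")
          case True
          have "(p', q') = (p, v)"
            using good_slab_separate(2)[OF good, of k "(p', q')" "(p, v)"] True pq' Mk k by auto
          then show ?thesis using pq' new by simp
        next
          case False
          then have q0': "(q', q0) \<in> L ! Suc k" using q0 False unfolding Mk by blast
          have "0 \<in> convex hull {q - q0, v - q', v' - q'}"
            by (rule convex_hull_lift_meet[OF _ x(1)]) (use xi in auto)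
          then show ?thesis using H2[OF q0'] by blast
        qed
      qed
    next
      case (arc1 j)
      have "ht ?m \<le> ht (Suc (Suc k))" using k by simp
      then show ?thesis using arc1_points(2)[OF xe[unfolded arc1]] bot by linarith
    next
      case (arc2 j)
      then show ?thesis using arc2_points(4)[OF xe[unfolded arc2]] zx by simp
    next
      case (arc3 j)
      have "ht (Suc k) < ht 0" by (simp only: ht_less_iff)
      then show ?thesis using arc3_points(2)[OF xe[unfolded arc3]] hi by simp
    qed
  qed
  show ?thesis unfolding M
  proof (rule link_iso_move_vertex)
    show "oriented_link (?R \<union> {(?a, ?v), (?v, ?b)})"
      using oriented_link_slab_closure[OF path n] unfolding M .
    show "(?a, ?v) \<notin> ?R" using new k by (auto elim!: slab_closure_edgeE)
    show "(?v, ?b) \<notin> ?R" using new k by (auto elim!: slab_closure_edgeE)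
    show "?v' \<noteq> ?v" using False by simp
  qed (use lower upper in auto)
qed

text \<open>In a configuration \<open>C k j\<close> is the position at level \<open>k\<close> of the strand that is labelled \<open>j\<close>. The
  slabs forget the labels, which serve to follow a strand while it is moved.\<close>

definition strands :: "nat \<Rightarrow> (nat \<Rightarrow> nat \<Rightarrow> real \<times> real) \<Rightarrow> nat \<Rightarrow> slab" where
  "strands n C k = (\<lambda>j. (C k j, C (Suc k) j)) ` {1..n}"

definition config_slabs :: "nat \<Rightarrow> (nat \<Rightarrow> nat \<Rightarrow> real \<times> real) \<Rightarrow> nat \<Rightarrow> slab list" where
  "config_slabs n C m = map (strands n C) [0..<m]"

lemma slab_path_config:
  "(\<And>k. k < m \<Longrightarrow> good_slab (strands n C k)) \<Longrightarrow>
    slab_path (C 0 ` {1..n}) (config_slabs n C m) (C m ` {1..n})"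
proof (induction m)
  case (Suc m)
  have "fst ` strands n C m = C m ` {1..n}" "snd ` strands n C m = C (Suc m) ` {1..n}"
    by (simp_all add: strands_def image_image)
  then show ?case using Suc by (auto simp: config_slabs_def slab_path_append)
qed (simp add: config_slabs_def)

text \<open>If all differences between old and new positions of two strands lie in one convex set without
  zero, then so do the differences in every intermediate configuration, in which some of the
  vertices are moved and others are not.\<close>

definition separated :: "nat \<Rightarrow> nat \<Rightarrow> (nat \<Rightarrow> nat \<Rightarrow> real \<times> real) \<Rightarrow> (nat \<Rightarrow> nat \<Rightarrow> real \<times> real) \<Rightarrow> bool" where
  "separated n m C C' \<longleftrightarrow> (\<forall>k<m. \<forall>i\<in>{1..n}. \<forall>j\<in>{1..n}. i \<noteq> j \<longrightarrow>
     (\<exists>K. convex K \<and> 0 \<notin> K \<and> (\<forall>l\<in>{k, Suc k}. \<forall>a\<in>{C l i, C' l i}. \<forall>b\<in>{C l j, C' l j}. a - b \<in> K)))"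

lemma separated_good_slab:
  assumes sep: "separated n m C C'" and k: "k < m"
    and D: "\<And>l j. j \<in> {1..n} \<Longrightarrow> D l j \<in> {C l j, C' l j}"
    and z: "\<And>l j. l \<le> m \<Longrightarrow> j \<in> {1..n} \<Longrightarrow> -1 < snd (D l j)"
  shows "good_slab (strands n D k)"
proof -
  have *: "0 \<notin> closed_segment (D k i - D k j) (D (Suc k) i - D (Suc k) j)"
    if ij: "i \<in> {1..n}" "j \<in> {1..n}" "i \<noteq> j" for i j
  proof -
    obtain K where K: "convex K" "0 \<notin> K" "\<And>l a b. l \<in> {k, Suc k} \<Longrightarrow> a \<in> {C l i, C' l i} \<Longrightarrow> b \<in> {C l j, C' l j} \<Longrightarrow> a - b \<in> K"
      using sep k ij unfolding separated_def by metis
    have "closed_segment (D k i - D k j) (D (Suc k) i - D (Suc k) j) \<subseteq> K"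
      using K(3) D ij by (intro closed_segment_subset K(1)) blast+
    then show ?thesis using K(2) by blast
  qed
  have "0 \<notin> closed_segment (fst e - fst e') (snd e - snd e')"
    if e: "e \<in> strands n D k" "e' \<in> strands n D k" "e \<noteq> e'" for e e'
  proof -
    obtain i j where "i \<in> {1..n}" "e = (D k i, D (Suc k) i)" "j \<in> {1..n}" "e' = (D k j, D (Suc k) j)"
      using e(1,2) unfolding strands_def by blast
    then show ?thesis using *[of i j] e(3) by auto
  qed
  then show ?thesis using z k unfolding good_slab_def by (auto simp: strands_def)
qed

lemma link_iso_move_config_vertex:
  assumes n: "n \<ge> 1" and sep: "separated n m C C'" and k0: "0 < k0" "k0 < m" and j0: "j0 \<in> {1..n}"
    and D: "\<And>l j. j \<in> {1..n} \<Longrightarrow> D l j \<in> {C l j, C' l j}" and w: "w \<in> {C k0 j0, C' k0 j0}"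
    and z: "\<And>l j. l \<le> m \<Longrightarrow> j \<in> {1..n} \<Longrightarrow> -1 < snd (D l j)" "-1 < snd w"
    and L1: "slab_path (stations n) L1 (D 0 ` {1..n})" and L2: "slab_path (D m ` {1..n}) L2 (stations n)"
  shows "link_iso (slab_closure n (L1 @ config_slabs n D m @ L2))
    (slab_closure n (L1 @ config_slabs n (D(k0 := (D k0)(j0 := w))) m @ L2))"
proof -
  define k where "k = k0 - 1"
  have k: "k0 = Suc k" "Suc k < m" using k0 by (simp_all add: k_def)
  \<comment> \<open>the window without strand \<open>j0\<close> in the two slabs that meet at level \<open>k0\<close>\<close>
  define T where "T = map (\<lambda>l. (\<lambda>j. (D l j, D (Suc l) j)) ` ({1..n} - (if l = k \<or> l = Suc k then {j0} else {}))) [0..<m]"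
  let ?D = "\<lambda>w. D(k0 := (D k0)(j0 := w))"
  let ?p = "D k j0" and ?q = "D (Suc (Suc k)) j0"
  let ?L = "L1 @ T @ L2" and ?kk = "length L1 + k"
  have lenT: "length T = m" by (simp add: T_def)
  have insT: "T[k := insert (?p, w) (T ! k), Suc k := insert (w, ?q) (T ! Suc k)] = config_slabs n (?D w) m" for w
  proof (rule nth_equalityI)
    show "length (T[k := insert (?p, w) (T ! k), Suc k := insert (w, ?q) (T ! Suc k)]) = length (config_slabs n (?D w) m)"
      by (simp add: lenT config_slabs_def)
    fix l assume "l < length (T[k := insert (?p, w) (T ! k), Suc k := insert (w, ?q) (T ! Suc k)])"
    then have l: "l < m" by (simp add: lenT)
    have split: "f ` {1..n} = insert (f j0) (f ` ({1..n} - {j0}))" for f :: "nat \<Rightarrow> (real \<times> real) \<times> (real \<times> real)"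
      using j0 by blast
    have "config_slabs n (?D w) m ! l = (\<lambda>j. (?D w l j, ?D w (Suc l) j)) ` {1..n}"
      using l by (simp add: config_slabs_def strands_def)
    also have "\<dots> = T[k := insert (?p, w) (T ! k), Suc k := insert (w, ?q) (T ! Suc k)] ! l"
    proof (cases "l = k \<or> l = Suc k")
      case True
      then show ?thesis
        unfolding split using k l by (auto simp: T_def nth_list_update)
    next
      case False
      then show ?thesis using k l by (auto simp: T_def nth_list_update)
    qed
    finally show "T[k := insert (?p, w) (T ! k), Suc k := insert (w, ?q) (T ! Suc k)] ! l = config_slabs n (?D w) m ! l" ..
  qed
  have nthL: "?L ! ?kk = T ! k" "?L ! Suc ?kk = T ! Suc k"
    using k by (simp_all add: nth_append lenT)
  have M: "?L[?kk := insert (?p, w) (?L ! ?kk), Suc ?kk := insert (w, ?q) (?L ! Suc ?kk)]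
      = L1 @ config_slabs n (?D w) m @ L2" for w
    unfolding nthL using k insT[of w] by (simp add: list_update_append lenT)
  have D0: "?D (D k0 j0) = D" by simp
  have goodD: "good_slab (strands n D l)" if "l < m" for l
    by (rule separated_good_slab[OF sep that D z(1)])
  have pathD: "slab_path (stations n) (L1 @ config_slabs n D m @ L2) (stations n)"
    unfolding slab_path_append using L1 L2 slab_path_config[of m n D, OF goodD] by blast
  have Tk: "T ! k = (\<lambda>j. (D k j, D (Suc k) j)) ` ({1..n} - {j0})"
    "T ! Suc k = (\<lambda>j. (D (Suc k) j, D (Suc (Suc k)) j)) ` ({1..n} - {j0})"
    using k by (simp_all add: T_def)
  have hull: "0 \<notin> convex hull {D l j0 - D l j, D k0 j0 - D k0 j, w - D k0 j}"
    if l: "l = k \<or> l = Suc (Suc k)" and j: "j \<in> {1..n} - {j0}" for l j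
  proof -
    let ?l = "if l = k then k else Suc k"
    have "?l < m" using k by simp
    then obtain K where K: "convex K" "0 \<notin> K" "\<And>l a b. l \<in> {?l, Suc ?l} \<Longrightarrow> a \<in> {C l j0, C' l j0} \<Longrightarrow> b \<in> {C l j, C' l j} \<Longrightarrow> a - b \<in> K"
      using sep j0 j unfolding separated_def by (metis Diff_iff singletonI)
    have ll: "l \<in> {?l, Suc ?l}" "k0 \<in> {?l, Suc ?l}" using l k by auto
    have jn: "j \<in> {1..n}" using j by simp
    have "{D l j0 - D l j, D k0 j0 - D k0 j, w - D k0 j} \<subseteq> K"
      using K(3)[OF ll(1) D[OF j0] D[OF jn]] K(3)[OF ll(2) D[OF j0] D[OF jn]]
        K(3)[OF ll(2) w D[OF jn]] by simp
    then have "convex hull {D l j0 - D l j, D k0 j0 - D k0 j, w - D k0 j} \<subseteq> K"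
      by (intro hull_minimal K(1))
    then show ?thesis using K(2) by blast
  qed
  have ne: "D l j \<noteq> D l j0" if "l = k \<or> l = Suc (Suc k)" "j \<in> {1..n} - {j0}" for l j
    using hull[OF that] hull_inc[of 0] by (auto simp: hull_inc)
  have "link_iso (slab_closure n (?L[?kk := insert (?p, D k0 j0) (?L ! ?kk), Suc ?kk := insert (D k0 j0, ?q) (?L ! Suc ?kk)]))
      (slab_closure n (?L[?kk := insert (?p, w) (?L ! ?kk), Suc ?kk := insert (w, ?q) (?L ! Suc ?kk)]))"
  proof (rule link_iso_move_slab_vertex[OF n])
    show "Suc ?kk < length ?L" using k by (simp add: lenT)
    show "slab_path (stations n) (?L[?kk := insert (?p, D k0 j0) (?L ! ?kk), Suc ?kk := insert (D k0 j0, ?q) (?L ! Suc ?kk)]) (stations n)"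
      unfolding M D0 by (rule pathD)
    show "(?p, D k0 j0) \<notin> ?L ! ?kk" unfolding nthL Tk using ne by fastforce
    show "(D k0 j0, ?q) \<notin> ?L ! Suc ?kk" unfolding nthL Tk using ne by fastforce
    show "0 \<notin> convex hull {?p - a, D k0 j0 - b, w - b}" if "(a, b) \<in> ?L ! ?kk" for a b
      using that hull[of k] unfolding nthL Tk k(1) by auto
    show "0 \<notin> convex hull {?q - b, D k0 j0 - a, w - a}" if "(a, b) \<in> ?L ! Suc ?kk" for a b
      using that hull[of "Suc (Suc k)"] unfolding nthL Tk k(1) by auto
  qed (rule z(2))
  then show ?thesis unfolding M D0 .
qed

text \<open>The vertices are moved one after another; \<open>X\<close> is the set of those already moved.\<close>

theorem link_iso_separated:
  assumes n: "n \<ge> 1" and sep: "separated n m C C'"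
    and ends: "\<And>j. j \<in> {1..n} \<Longrightarrow> C' 0 j = C 0 j" "\<And>j. j \<in> {1..n} \<Longrightarrow> C' m j = C m j"
    and z: "\<And>l j. l \<le> m \<Longrightarrow> j \<in> {1..n} \<Longrightarrow> -1 < snd (C l j) \<and> -1 < snd (C' l j)"
    and L1: "slab_path (stations n) L1 (C 0 ` {1..n})" and L2: "slab_path (C m ` {1..n}) L2 (stations n)"
  shows "link_iso (slab_closure n (L1 @ config_slabs n C m @ L2)) (slab_closure n (L1 @ config_slabs n C' m @ L2))"
proof -
  define mix where "mix X = (\<lambda>l j. if (l, j) \<in> X then C' l j else C l j)" for X
  have mem: "mix X l j \<in> {C l j, C' l j}" for X l j by (simp add: mix_def)
  have zm: "-1 < snd (mix X l j)" if "l \<le> m" "j \<in> {1..n}" for X l j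
    using z[OF that] by (simp add: mix_def)
  have path: "slab_path (stations n) (L1 @ config_slabs n C m @ L2) (stations n)"
    unfolding slab_path_append
    using L1 L2 slab_path_config[of m n C] separated_good_slab[OF sep, of _ C] z by blast
  have "link_iso (slab_closure n (L1 @ config_slabs n C m @ L2)) (slab_closure n (L1 @ config_slabs n (mix X) m @ L2))"
    if "finite X" "X \<subseteq> {1..<m} \<times> {1..n}" for X
    using that
  proof (induction X rule: finite_induct)
    case empty
    have "mix {} = C" by (simp add: mix_def fun_eq_iff)
    then show ?case using link_iso_refl oriented_link_slab_closure[OF path n] by simp
  next
    case (insert x X)
    obtain k0 j0 where x: "x = (k0, j0)" by (cases x)
    have k0: "0 < k0" "k0 < m" and j0: "j0 \<in> {1..n}" using insert.prems x by auto
    have eq: "mix (insert x X) = (mix X)(k0 := (mix X k0)(j0 := C' k0 j0))"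
      by (auto simp: mix_def x fun_eq_iff)
    have e0: "mix X 0 j = C 0 j" "mix X m j = C m j" for j
      using insert.prems by (auto simp: mix_def)
    have "link_iso (slab_closure n (L1 @ config_slabs n (mix X) m @ L2))
        (slab_closure n (L1 @ config_slabs n (mix (insert x X)) m @ L2))"
      unfolding eq
      by (rule link_iso_move_config_vertex[OF n sep k0 j0 mem])
         (use zm z[of k0 j0] k0 j0 L1 L2 e0 in auto)
    then show ?case using insert.IH insert.prems link_iso_trans by blast
  qed
  then have "link_iso (slab_closure n (L1 @ config_slabs n C m @ L2))
      (slab_closure n (L1 @ config_slabs n (mix ({1..<m} \<times> {1..n})) m @ L2))" by simp
  moreover have "config_slabs n (mix ({1..<m} \<times> {1..n})) m = config_slabs n C' m"
  proof -
    have "mix ({1..<m} \<times> {1..n}) l j = C' l j" if "l \<le> m" "j \<in> {1..n}" for l j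
      using that ends[of j] by (cases "l = 0 \<or> l = m") (auto simp: mix_def)
    then show ?thesis unfolding config_slabs_def strands_def by (auto intro!: image_cong)
  qed
  ultimately show ?thesis by simp
qed


section \<open>Closures of braid words with blank letters\<close>

text \<open>A blank letter \<open>None\<close> stands for a layer without crossing. It leaves the heights of all other
  letters unchanged when a crossing is removed.\<close>

type_synonym letter = "(nat \<times> bool) option"

text \<open>A letter has the levels $0$, $1$ and $2$. The strand from \<open>i\<close> crosses straight at depth $0$; at
  level $1$ the strand from \<open>i + 1\<close> is in front of it or behind it.\<close>

definition letter_cfg :: "letter \<Rightarrow> nat \<Rightarrow> nat \<Rightarrow> real \<times> real" where
  "letter_cfg x k j = (case x of None \<Rightarrow> (real j, 0)
     | Some (i, b) \<Rightarrow>
        if j = i then (real i + real k / 2, 0)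
        else if j = Suc i then
          (real i + 1 - real k / 2, if k = 1 then (if b then 1/2 else -1/2) else 0)
        else (real j, 0))"

definition letter_perm :: "letter \<Rightarrow> nat \<Rightarrow> nat" where
  "letter_perm x = (case x of None \<Rightarrow> id | Some (i, b) \<Rightarrow> (\<lambda>j. if j = i then Suc i else if j = Suc i then i else j))"

text \<open>A strand keeps the label of its position at the top of the word, so every letter permutes the
  labels that the following letters see.\<close>

fun word_cfg :: "letter list \<Rightarrow> nat \<Rightarrow> nat \<Rightarrow> real \<times> real" where
  "word_cfg [] k j = (real j, 0)"
| "word_cfg (x # w) k j = (if k \<le> 2 then letter_cfg x k j else word_cfg w (k - 2) (letter_perm x j))"

definition letter_slabs :: "nat \<Rightarrow> letter \<Rightarrow> slab list" where
  "letter_slabs n x = config_slabs n (letter_cfg x) 2"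

definition word_slabs :: "nat \<Rightarrow> letter list \<Rightarrow> slab list" where
  "word_slabs n w = concat (map (letter_slabs n) w)"

definition letters :: "nat \<Rightarrow> letter set" where
  "letters n = insert None (Some ` ({1..<n} \<times> UNIV))"

lemma word_slabs_simps [simp]:
  "word_slabs n [] = []" "word_slabs n (x # w) = letter_slabs n x @ word_slabs n w"
  "word_slabs n (v @ w) = word_slabs n v @ word_slabs n w"
  by (simp_all add: word_slabs_def)

lemma length_letter_slabs [simp]: "length (letter_slabs n x) = 2"
  by (simp add: letter_slabs_def config_slabs_def)

lemma length_word_slabs [simp]: "length (word_slabs n w) = 2 * length w"
  by (induction w) simp_all

lemma letter_perm_image:
  assumes "x \<in> letters n"
  shows "letter_perm x ` {1..n} = {1..n}"
proof -
  have sub: "letter_perm x j \<in> {1..n}" if "j \<in> {1..n}" for j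
    using assms that by (auto simp: letters_def letter_perm_def)
  have inv: "letter_perm x (letter_perm x j) = j" for j
    by (auto simp: letter_perm_def split: option.split)
  show ?thesis
  proof (intro equalityI subsetI)
    fix j assume j: "j \<in> {1..n}"
    show "j \<in> letter_perm x ` {1..n}"
      using inv[of j, symmetric] sub[OF j] by (rule image_eqI)
  qed (use sub in blast)
qed

lemma letter_cfg_0: "letter_cfg x 0 j = (real j, 0)"
  by (auto simp: letter_cfg_def split: option.split)

lemma letter_cfg_2: "letter_cfg x 2 j = (real (letter_perm x j), 0)"
  by (auto simp: letter_cfg_def letter_perm_def split: option.split)

lemma word_cfg_0: "word_cfg w 0 j = (real j, 0)"
  by (cases w) (simp_all add: letter_cfg_0)

lemma word_slabs_config:
  "set w \<subseteq> letters n \<Longrightarrow> word_slabs n w = config_slabs n (word_cfg w) (2 * length w)"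
proof (induction w)
  case Nil
  then show ?case by (simp add: config_slabs_def)
next
  case (Cons x w)
  let ?m = "2 * length w"
  have x: "x \<in> letters n" using Cons.prems by simp
  have first: "strands n (word_cfg (x # w)) k = strands n (letter_cfg x) k" if "k < 2" for k
    using that by (simp add: strands_def)
  have rest: "strands n (word_cfg (x # w)) (k + 2) = strands n (word_cfg w) k" for k
  proof -
    have c: "word_cfg (x # w) (k + 2) j = word_cfg w k (letter_perm x j)" for k j
      by (cases "k = 0") (simp_all add: letter_cfg_2[unfolded numeral_2_eq_2] word_cfg_0)
    have "strands n (word_cfg (x # w)) (k + 2)
        = (\<lambda>j. (word_cfg w k j, word_cfg w (Suc k) j)) ` (letter_perm x ` {1..n})"
      unfolding strands_def image_image using c[of k] c[of "Suc k"] by simp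
    then show ?thesis unfolding letter_perm_image[OF x] strands_def .
  qed
  have "config_slabs n (word_cfg (x # w)) (2 * length (x # w))
      = map (strands n (word_cfg (x # w))) [0..<2] @ map (strands n (word_cfg (x # w))) [2..<?m + 2]"
    unfolding config_slabs_def map_append[symmetric] using upt_add_eq_append[of 0 2 ?m] by simp
  also have "[2..<?m + 2] = map (\<lambda>k. k + 2) [0..<?m]"
    by (rule map_add_upt[symmetric])
  also have "map (strands n (word_cfg (x # w))) \<dots> = config_slabs n (word_cfg w) ?m"
    unfolding config_slabs_def map_map o_def rest ..
  also have "map (strands n (word_cfg (x # w))) [0..<2] = letter_slabs n x"
    unfolding letter_slabs_def config_slabs_def by (rule map_cong) (use first in auto)
  finally show ?case using Cons by simp
qed

lemma letter_slabs_crossing: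
  fixes b :: bool
  assumes i: "i \<in> {1..<n}"
  defines "h \<equiv> (if b then 1/2 else -1/2 :: real)"
    and "J \<equiv> (\<lambda>j. ((real j, 0 :: real), (real j, 0 :: real))) ` ({1..n} - {i, Suc i})"
  shows "letter_slabs n (Some (i, b)) =
    [insert ((real (Suc i), 0), (real i + 1/2, h)) (insert ((real i, 0), (real i + 1/2, 0)) J),
     insert ((real i + 1/2, h), (real i, 0)) (insert ((real i + 1/2, 0), (real (Suc i), 0)) J)]"
proof -
  have "{1..n} = insert (Suc i) (insert i ({1..n} - {i, Suc i}))" using i by auto
  then have img: "f ` {1..n} = insert (f (Suc i)) (insert (f i) (f ` ({1..n} - {i, Suc i})))"
    for f :: "nat \<Rightarrow> (real \<times> real) \<times> (real \<times> real)" by (metis image_insert)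
  have "f ` ({1..n} - {i, Suc i}) = g ` ({1..n} - {i, Suc i})"
    if "\<And>j. j \<noteq> i \<Longrightarrow> j \<noteq> Suc i \<Longrightarrow> f j = g j" for f g :: "nat \<Rightarrow> (real \<times> real) \<times> (real \<times> real)"
    using that by (intro image_cong) auto
  note cong = this
  have J: "(\<lambda>j. (letter_cfg (Some (i, b)) k j, letter_cfg (Some (i, b)) (Suc k) j)) ` ({1..n} - {i, Suc i}) = J" for k
    unfolding J_def by (rule cong) (simp add: letter_cfg_def)
  show ?thesis
    by (simp add: letter_slabs_def config_slabs_def strands_def upt_rec img J del: One_nat_def)
       (simp add: letter_cfg_def h_def add_ac)
qed

text \<open>The relations describe, for the difference of two positions, the six convex sets that suffice
  for all moves below: the half planes of points to the left and to the right of zero, and the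
  half planes of points in front of and behind zero together with one half of the boundary
  line.\<close>

definition apart :: "(nat \<Rightarrow> nat \<Rightarrow> real \<times> real) \<Rightarrow> (nat \<Rightarrow> nat \<Rightarrow> real \<times> real) \<Rightarrow> nat \<Rightarrow> nat \<Rightarrow> nat \<Rightarrow> nat \<Rightarrow> bool" where
  "apart C C' l l' p q \<longleftrightarrow> (\<exists>P\<in>{\<lambda>a b. fst a < fst b, \<lambda>a b. fst b < fst a,
       \<lambda>a b. snd a < snd b \<or> snd a = snd b \<and> fst a < fst b,
       \<lambda>a b. snd a < snd b \<or> snd a = snd b \<and> fst b < fst a,
       \<lambda>a b. snd b < snd a \<or> snd a = snd b \<and> fst a < fst b,
       \<lambda>a b. snd b < snd a \<or> snd a = snd b \<and> fst b < fst a}.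
     \<forall>k\<in>{l, l'}. \<forall>a\<in>{C k p, C' k p}. \<forall>b\<in>{C k q, C' k q}. P a b)"

lemma apart_convex:
  assumes "apart C C' l l' p q"
  shows "\<exists>K. convex K \<and> 0 \<notin> K \<and> (\<forall>k\<in>{l, l'}. \<forall>a\<in>{C k p, C' k p}. \<forall>b\<in>{C k q, C' k q}. a - b \<in> K)"
proof -
  have lin: "convex {v :: real \<times> real. \<sigma> * fst v > 0}" for \<sigma>
  proof (rule convexI)
    fix x y :: "real \<times> real" and u v :: real
    assume h: "x \<in> {v. 0 < \<sigma> * fst v}" "y \<in> {v. 0 < \<sigma> * fst v}" "0 \<le> u" "0 \<le> v" "u + v = 1"
    then have "0 < u * (\<sigma> * fst x) + v * (\<sigma> * fst y)"
      by (cases "u = 0") (auto intro!: add_pos_nonneg)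
    then show "u *\<^sub>R x + v *\<^sub>R y \<in> {v. 0 < \<sigma> * fst v}" by (simp add: algebra_simps)
  qed
  have lex: "convex {v :: real \<times> real. \<sigma> * snd v > 0 \<or> snd v = 0 \<and> \<tau> * fst v > 0}" for \<sigma> \<tau>
  proof (rule convexI)
    fix x y :: "real \<times> real" and u v :: real
    assume h: "x \<in> {v. \<sigma> * snd v > 0 \<or> snd v = 0 \<and> \<tau> * fst v > 0}"
      "y \<in> {v. \<sigma> * snd v > 0 \<or> snd v = 0 \<and> \<tau> * fst v > 0}" "0 \<le> u" "0 \<le> v" "u + v = 1"
    show "u *\<^sub>R x + v *\<^sub>R y \<in> {v. \<sigma> * snd v > 0 \<or> snd v = 0 \<and> \<tau> * fst v > 0}"
    proof (cases "u = 0 \<or> v = 0")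
      case True
      then show ?thesis using h by auto
    next
      case False
      then have uv: "0 < u" "0 < v" using h by auto
      have ge: "\<sigma> * snd x \<ge> 0" "\<sigma> * snd y \<ge> 0" using h by auto
      show ?thesis
      proof (cases "snd x = 0 \<and> \<tau> * fst x > 0 \<and> snd y = 0 \<and> \<tau> * fst y > 0")
        case True
        then have "0 < u * (\<tau> * fst x) + v * (\<tau> * fst y)" using uv by (simp add: add_pos_pos)
        then show ?thesis using True by (simp add: algebra_simps)
      next
        case False
        then have "\<sigma> * snd x > 0 \<or> \<sigma> * snd y > 0" using h by auto
        then have "0 < u * (\<sigma> * snd x) + v * (\<sigma> * snd y)"
          using uv ge by (auto intro: add_pos_nonneg add_nonneg_pos)
        then show ?thesis by (simp add: algebra_simps)
      qed
    qed
  qed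
  let ?Q = "\<lambda>P. \<forall>k\<in>{l, l'}. \<forall>a\<in>{C k p, C' k p}. \<forall>b\<in>{C k q, C' k q}. P a b"
  have wit: ?thesis if "convex K" "0 \<notin> K" "\<And>a b. P a b \<Longrightarrow> a - b \<in> K" "?Q P" for K P
    using that by blast
  from assms show ?thesis
    unfolding apart_def
    apply (elim bexE insertE emptyE)
    subgoal by (rule wit[OF lin[of "-1"]]) auto
    subgoal by (rule wit[OF lin[of 1]]) auto
    subgoal by (rule wit[OF lex[of "-1" "-1"]]) auto
    subgoal by (rule wit[OF lex[of "-1" 1]]) auto
    subgoal by (rule wit[OF lex[of 1 "-1"]]) auto
    subgoal by (rule wit[OF lex[of 1 1]]) auto
    done
qed

lemma separatedI:
  assumes "\<And>k p q. k < m \<Longrightarrow> p < q \<Longrightarrow> apart C C' k (Suc k) p q"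
  shows "separated n m C C'"
  unfolding separated_def
proof (intro allI impI ballI)
  fix k i j :: nat assume k: "k < m" and ij: "i \<noteq> j"
  let ?Q = "\<lambda>i j K. \<forall>l\<in>{k, Suc k}. \<forall>a\<in>{C l i, C' l i}. \<forall>b\<in>{C l j, C' l j}. a - b \<in> K"
  show "\<exists>K. convex K \<and> 0 \<notin> K \<and> ?Q i j K"
  proof (cases "i < j")
    case True
    then show ?thesis using apart_convex[OF assms[OF k True]] by simp
  next
    case False
    then have "j < i" using ij by simp
    then obtain K where K: "convex K" "0 \<notin> K" "?Q j i K"
      using apart_convex[OF assms[OF k]] by blast
    have "convex (uminus ` K)" using K(1) by (rule convex_negations)
    moreover have "0 \<notin> uminus ` K" using K(2) by (metis imageE neg_equal_0_iff_equal)
    moreover have "?Q i j (uminus ` K)" using K(3) by (metis image_eqI minus_diff_eq)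
    ultimately show ?thesis by blast
  qed
qed

lemma apart_fst:
  "(\<And>k. k \<in> {l, l'} \<Longrightarrow> fst (C k p) < fst (C k q) \<and> fst (C k p) < fst (C' k q)
      \<and> fst (C' k p) < fst (C k q) \<and> fst (C' k p) < fst (C' k q)) \<Longrightarrow> apart C C' l l' p q"
  unfolding apart_def by (intro bexI[of _ "\<lambda>a b. fst a < fst b"]) auto

lemma less_4_cases: "k < 4 \<Longrightarrow> k = 0 \<or> k = 1 \<or> k = 2 \<or> k = (3::nat)"
  by auto

lemma less_6_cases: "k < 6 \<Longrightarrow> k = 0 \<or> k = 1 \<or> k = 2 \<or> k = 3 \<or> k = 4 \<or> k = (5::nat)"
  by auto

lemma separated_letter: "separated n 2 (letter_cfg x) (letter_cfg x)"
proof (rule separatedI)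
  fix k p q :: nat assume k: "k < 2" and pq: "p < q"
  show "apart (letter_cfg x) (letter_cfg x) k (Suc k) p q"
  proof (cases "\<exists>i b. x = Some (i, b) \<and> p = i \<and> q = Suc i")
    case True
    then obtain i b where x: "x = Some (i, b)" "p = i" "q = Suc i" by blast
    have "k = 0 \<or> k = 1" using k by auto
    then show ?thesis unfolding x by (elim disjE) (simp_all add: apart_def letter_cfg_def)
  next
    case False
    show ?thesis
    proof (rule apart_fst)
      fix l assume "l \<in> {k, Suc k}"
      then have "l \<le> 2" using k by auto
      then have l: "0 \<le> real l / 2" "real l / 2 \<le> 1" by auto
      have "fst (letter_cfg x l p) < fst (letter_cfg x l q)"
      proof (cases x)
        case None
        then show ?thesis using pq by (simp add: letter_cfg_def)
      next
        case (Some y)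
        obtain i b where y: "y = (i, b)" by (cases y)
        consider "p = i" "Suc i < q" | "q = i" | "p = Suc i" | "q = Suc i" "p < i"
          | "p \<notin> {i, Suc i}" "q \<notin> {i, Suc i}"
          using False Some y pq by force
        then show ?thesis
          using l pq by cases (auto simp: letter_cfg_def Some y)
      qed
      then show "fst (letter_cfg x l p) < fst (letter_cfg x l q) \<and> fst (letter_cfg x l p) < fst (letter_cfg x l q)
        \<and> fst (letter_cfg x l p) < fst (letter_cfg x l q) \<and> fst (letter_cfg x l p) < fst (letter_cfg x l q)"
        by simp
    qed
  qed
qed

lemma letter_cfg_z: "-1 < snd (letter_cfg x k j)"
  by (auto simp: letter_cfg_def split: option.split)

lemma word_cfg_z: "-1 < snd (word_cfg w k j)"
  by (induction w k j rule: word_cfg.induct) (auto simp: letter_cfg_z)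

lemma stations_eq: "(\<lambda>j. (real j, 0)) ` {1..n} = stations n"
  by (simp add: stations_def)

lemma slab_path_letter:
  assumes "x \<in> letters n"
  shows "slab_path (stations n) (letter_slabs n x) (stations n)"
proof -
  have "slab_path (letter_cfg x 0 ` {1..n}) (letter_slabs n x) (letter_cfg x 2 ` {1..n})"
    unfolding letter_slabs_def
    by (rule slab_path_config) (rule separated_good_slab[OF separated_letter], auto intro: letter_cfg_z)
  moreover have "letter_cfg x 2 ` {1..n} = (\<lambda>j. (real j, 0)) ` letter_perm x ` {1..n}"
    by (simp add: image_image letter_cfg_2)
  ultimately show ?thesis
    by (simp add: letter_cfg_0 stations_eq letter_perm_image[OF assms] del: One_nat_def)
qed

lemma slab_path_word:
  "set w \<subseteq> letters n \<Longrightarrow> slab_path (stations n) (word_slabs n w) (stations n)"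
  by (induction w) (auto simp: slab_path_append intro: slab_path_letter)

definition blank_closure :: "nat \<Rightarrow> letter list \<Rightarrow> polygon" where
  "blank_closure n w = slab_closure n (word_slabs n w)"

lemma oriented_link_blank_closure:
  "n \<ge> 1 \<Longrightarrow> set w \<subseteq> letters n \<Longrightarrow> oriented_link (blank_closure n w)"
  unfolding blank_closure_def by (intro oriented_link_slab_closure slab_path_word)

text \<open>A configuration fills a window of \<open>m\<close> slabs between two arbitrary words.\<close>

definition cfg_iso :: "nat \<Rightarrow> nat \<Rightarrow> (nat \<Rightarrow> nat \<Rightarrow> real \<times> real) \<Rightarrow> (nat \<Rightarrow> nat \<Rightarrow> real \<times> real) \<Rightarrow> bool" where
  "cfg_iso n m C C' \<longleftrightarrow>
     (\<forall>u v. set u \<subseteq> letters n \<longrightarrow> set v \<subseteq> letters n \<longrightarrow>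
       link_iso (slab_closure n (word_slabs n u @ config_slabs n C m @ word_slabs n v))
         (slab_closure n (word_slabs n u @ config_slabs n C' m @ word_slabs n v)))"

lemma cfg_iso_sym: "cfg_iso n m C C' \<Longrightarrow> cfg_iso n m C' C"
  unfolding cfg_iso_def using link_iso_sym by blast

lemma cfg_iso_trans: "cfg_iso n m C C' \<Longrightarrow> cfg_iso n m C' C'' \<Longrightarrow> cfg_iso n m C C''"
  unfolding cfg_iso_def using link_iso_trans by blast

lemma cfg_isoI:
  assumes n: "n \<ge> 1" and sep: "separated n m C C'"
    and start: "\<And>j. C 0 j = (real j, 0)" "\<And>j. C' 0 j = (real j, 0)"
    and finish: "\<And>j. j \<in> {1..n} \<Longrightarrow> C' m j = C m j" "C m ` {1..n} = stations n"
    and z: "\<And>l j. -1 < snd (C l j) \<and> -1 < snd (C' l j)"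
  shows "cfg_iso n m C C'"
  unfolding cfg_iso_def
proof (intro allI impI)
  fix u v assume uv: "set u \<subseteq> letters n" "set v \<subseteq> letters n"
  have C0: "C 0 ` {1..n} = stations n" by (simp add: start stations_def)
  show "link_iso (slab_closure n (word_slabs n u @ config_slabs n C m @ word_slabs n v))
         (slab_closure n (word_slabs n u @ config_slabs n C' m @ word_slabs n v))"
    by (rule link_iso_separated[OF n sep])
       (simp_all only: start finish z C0 slab_path_word[OF uv(1)] slab_path_word[OF uv(2)] simp_thms)
qed

lemma cfg_iso_words:
  assumes iso: "cfg_iso n (2 * length w) (word_cfg w) (word_cfg w')" and len: "length w' = length w"
    and w: "set w \<subseteq> letters n" "set w' \<subseteq> letters n" and uv: "set u \<subseteq> letters n" "set v \<subseteq> letters n"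
  shows "link_iso (blank_closure n (u @ w @ v)) (blank_closure n (u @ w' @ v))"
  using iso uv word_slabs_config[OF w(1)] word_slabs_config[OF w(2)] len
  unfolding cfg_iso_def blank_closure_def by simp

lemma word_cfg_final:
  assumes "set w \<subseteq> letters n" "n \<ge> 1"
  shows "word_cfg w (2 * length w) ` {1..n} = stations n"
proof -
  have "slab_path (stations n) (config_slabs n (word_cfg w) (2 * length w)) (stations n)"
    using slab_path_word[OF assms(1)] word_slabs_config[OF assms(1)] by simp
  note path = this
  let ?L = "config_slabs n (word_cfg w) (2 * length w)"
  have len: "length ?L = 2 * length w" by (simp add: config_slabs_def)
  have "good_slab (strands n (word_cfg w) k)" if "k < 2 * length w" for k
    using slab_path_nth[OF path, of k] that by (simp add: config_slabs_def)
  from slab_path_config[of "2 * length w", OF this]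
  have "slab_path (stations n) ?L (word_cfg w (2 * length w) ` {1..n})"
    by (simp add: word_cfg_0 stations_eq del: One_nat_def)
  then show ?thesis
    using slab_path_level_length[OF path] slab_path_level_length len by metis
qed


section \<open>Reidemeister moves on braid words\<close>

text \<open>Every strand stays within an interval. Strands with disjoint intervals never meet, so that only
  the pairs within one block have to be examined.\<close>

definition in_blocks :: "(nat \<Rightarrow> nat) \<Rightarrow> (nat \<Rightarrow> nat) \<Rightarrow> (nat \<Rightarrow> nat \<Rightarrow> real \<times> real) \<Rightarrow> bool" where
  "in_blocks lo hi C \<longleftrightarrow> (\<forall>k j. real (lo j) \<le> fst (C k j) \<and> fst (C k j) \<le> real (hi j))"

definition word_in_blocks :: "(nat \<Rightarrow> nat) \<Rightarrow> (nat \<Rightarrow> nat) \<Rightarrow> letter list \<Rightarrow> bool" where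
  "word_in_blocks lo hi w \<longleftrightarrow> (\<forall>j. lo j \<le> j \<and> j \<le> hi j) \<and>
     (\<forall>i b. Some (i, b) \<in> set w \<longrightarrow> lo (Suc i) = lo i \<and> hi (Suc i) = hi i)"

lemma in_blocks_word_cfg:
  assumes "word_in_blocks lo hi w"
  shows "in_blocks lo hi (word_cfg w)"
proof -
  have "real (lo j) \<le> fst (word_cfg w k j) \<and> fst (word_cfg w k j) \<le> real (hi j)" for k j
    using assms
  proof (induction w arbitrary: k j)
    case Nil
    then show ?case by (simp add: word_in_blocks_def)
  next
    case (Cons x w)
    have all: "lo j \<le> j \<and> j \<le> hi j" for j using Cons.prems by (simp add: word_in_blocks_def)
    have w: "word_in_blocks lo hi w" using Cons.prems by (auto simp: word_in_blocks_def)
    show ?case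
    proof (cases x)
      case None
      then show ?thesis using Cons.IH[OF w] all[of j] by (simp add: letter_cfg_def letter_perm_def)
    next
      case (Some y)
      obtain i b where x: "x = Some (i, b)" using Some by (cases y) simp
      have i: "lo (Suc i) = lo i" "hi (Suc i) = hi i"
        using Cons.prems x by (auto simp: word_in_blocks_def)
      have inv: "lo (letter_perm x j) = lo j" "hi (letter_perm x j) = hi j"
        using i by (auto simp: x letter_perm_def)
      have b: "real (lo i) \<le> real i" "real i + 1 \<le> real (hi i)"
        using all[of i] all[of "Suc i"] i by auto
      show ?thesis
      proof (cases "k \<le> 2")
        case True
        then have "0 \<le> real k / 2" "real k / 2 \<le> 1" by auto
        then show ?thesis
          using True b i all[of j] by (auto simp: x letter_cfg_def)
      next
        case False
        then show ?thesis using Cons.IH[OF w, of "letter_perm x j" "k - 2"] inv by simp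
      qed
    qed
  qed
  then show ?thesis by (simp add: in_blocks_def)
qed

lemma separated_blocksI:
  assumes C: "in_blocks lo hi C" "in_blocks lo hi C'"
    and near: "\<And>k p q. k < m \<Longrightarrow> p < q \<Longrightarrow> lo q \<le> hi p \<Longrightarrow> apart C C' k (Suc k) p q"
  shows "separated n m C C'"
proof (rule separatedI)
  fix k p q :: nat assume k: "k < m" and pq: "p < q"
  show "apart C C' k (Suc k) p q"
  proof (cases "lo q \<le> hi p")
    case False
    then have "real (hi p) < real (lo q)" by simp
    then show ?thesis
      using C unfolding in_blocks_def by (intro apart_fst) (meson le_less_trans less_le_trans)
  qed (use near[OF k pq] in simp)
qed

text \<open>\<open>S\<close> prescribes new positions for some of the strands, the same at all inner levels.\<close>

definition override ::
  "nat \<Rightarrow> (nat \<Rightarrow> (real \<times> real) option) \<Rightarrow> (nat \<Rightarrow> nat \<Rightarrow> real \<times> real) \<Rightarrow> nat \<Rightarrow> nat \<Rightarrow> real \<times> real" where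
  "override m S C k j = (if 0 < k \<and> k < m then (case S j of None \<Rightarrow> C k j | Some p \<Rightarrow> p) else C k j)"

definition positions_ok :: "(nat \<Rightarrow> nat) \<Rightarrow> (nat \<Rightarrow> nat) \<Rightarrow> (nat \<Rightarrow> (real \<times> real) option) \<Rightarrow> bool" where
  "positions_ok lo hi S \<longleftrightarrow>
     (\<forall>j p. S j = Some p \<longrightarrow> real (lo j) \<le> fst p \<and> fst p \<le> real (hi j) \<and> -1 < snd p)"

lemma in_blocks_override:
  "in_blocks lo hi C \<Longrightarrow> positions_ok lo hi S \<Longrightarrow> in_blocks lo hi (override m S C)"
  unfolding in_blocks_def positions_ok_def override_def by (auto split: option.split)

lemma cfg_iso_override:
  assumes n: "n \<ge> 1" and w: "set w \<subseteq> letters n" and m: "m = 2 * length w"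
    and blocks: "word_in_blocks lo hi w" "positions_ok lo hi S"
    and near: "\<And>k p q. k < m \<Longrightarrow> p < q \<Longrightarrow> lo q \<le> hi p \<Longrightarrow>
      apart (word_cfg w) (override m S (word_cfg w)) k (Suc k) p q"
  shows "cfg_iso n m (word_cfg w) (override m S (word_cfg w))"
proof (rule cfg_isoI[OF n])
  have C: "in_blocks lo hi (word_cfg w)" by (rule in_blocks_word_cfg[OF blocks(1)])
  then have "in_blocks lo hi (override m S (word_cfg w))"
    using blocks(2) by (rule in_blocks_override)
  with C show "separated n m (word_cfg w) (override m S (word_cfg w))"
    using near by (rule separated_blocksI)
  show "-1 < snd (word_cfg w l j) \<and> -1 < snd (override m S (word_cfg w) l j)" for l j
    using blocks(2) word_cfg_z unfolding positions_ok_def override_def by (auto split: option.split)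
qed (use word_cfg_final[OF w n] m in \<open>auto simp: word_cfg_0 override_def\<close>)

text \<open>The strand from \<open>i + 1\<close> is placed in front of the strand from \<open>i\<close>, or behind it if \<open>b\<close> is false.
  From every word in which it always stays on that side of the other strand, or beside it, the two
  strands can be moved to this position.\<close>

definition stacked :: "nat \<Rightarrow> bool \<Rightarrow> nat \<Rightarrow> (real \<times> real) option" where
  "stacked i b j = Some (if j = i then (real i + 1/2, if b then -1/2 else 1/2)
     else if j = Suc i then (real i + 1/2, if b then 1/2 else -1/2) else (real j, 0))"

text \<open>Two of these words with the same permutation become equal when stacked, hence have isotopic
  closures. This yields the commutation of a crossing with a blank letter and the second
  Reidemeister move.\<close>

lemma cfg_iso_stacked:
  assumes n: "n \<ge> 1" and w: "set w \<subseteq> letters n"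
    and words: "w \<in> {[None, Some (i, b)], [Some (i, b), None], [Some (i, b), Some (i, \<not> b)], [None, None]}"
  shows "cfg_iso n 4 (word_cfg w) (override 4 (stacked i b) (word_cfg w))"
proof (rule cfg_iso_override[OF n w])
  let ?lo = "\<lambda>j. if j = Suc i then i else j" and ?hi = "\<lambda>j. if j = i then Suc i else j"
  show "word_in_blocks ?lo ?hi w" using words by (auto simp: word_in_blocks_def)
  show "positions_ok ?lo ?hi (stacked i b)" by (auto simp: positions_ok_def stacked_def)
  fix k p q :: nat assume k: "k < 4" and pq: "p < q" "?lo q \<le> ?hi p"
  have p: "p = i" and q: "q = Suc i" using pq by (auto split: if_splits)
  from less_4_cases[OF k] words
  show "apart (word_cfg w) (override 4 (stacked i b) (word_cfg w)) k (Suc k) p q"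
    unfolding p q
    by (elim disjE insertE emptyE; cases b)
      (simp_all add: apart_def override_def stacked_def letter_cfg_def letter_perm_def)
qed (use words in auto)

lemma override_cong:
  assumes "\<And>j. S j \<noteq> None" "\<And>j. C 0 j = C' 0 j" "\<And>k j. m \<le> k \<Longrightarrow> C k j = C' k j"
  shows "override m S C = override m S C'"
proof (intro ext)
  fix k j
  show "override m S C k j = override m S C' k j"
    using assms(1)[of j] assms(2)[of j] assms(3)[of k j] by (cases "k = 0") (auto simp: override_def)
qed

lemma stacked_not_None: "stacked i b j \<noteq> None"
  by (simp add: stacked_def)

lemma blank_closure_swap_blank:
  assumes n: "n \<ge> 1" and uv: "set u \<subseteq> letters n" "set v \<subseteq> letters n" and x: "x \<in> letters n"
  shows "link_iso (blank_closure n (u @ [None, x] @ v)) (blank_closure n (u @ [x, None] @ v))"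
proof (cases x)
  case None
  have "set (u @ [None, x] @ v) \<subseteq> letters n" using uv x None by auto
  from oriented_link_blank_closure[OF n this] show ?thesis
    using None by (simp add: link_iso_refl)
next
  case (Some y)
  then obtain i b where xi: "x = Some (i, b)" by (cases y) simp
  have w: "set [None, x] \<subseteq> letters n" "set [x, None] \<subseteq> letters n" using x by (auto simp: letters_def)
  have 1: "cfg_iso n 4 (word_cfg [None, x]) (override 4 (stacked i b) (word_cfg [None, x]))"
    by (rule cfg_iso_stacked[OF n w(1)]) (simp add: xi)
  have 2: "cfg_iso n 4 (word_cfg [x, None]) (override 4 (stacked i b) (word_cfg [x, None]))"
    by (rule cfg_iso_stacked[OF n w(2)]) (simp add: xi)
  have "override 4 (stacked i b) (word_cfg [None, x]) = override 4 (stacked i b) (word_cfg [x, None])"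
  proof (rule override_cong)
    fix k j :: nat assume k: "4 \<le> k"
    then have "k = 4 \<or> \<not> k \<le> 2 \<and> \<not> k - 2 \<le> 2" by linarith
    then show "word_cfg [None, x] k j = word_cfg [x, None] k j"
      by (elim disjE) (simp_all add: xi letter_cfg_def letter_perm_def)
  qed (simp_all only: stacked_not_None word_cfg_0 simp_thms)
  then have "cfg_iso n (2 * length [None, x]) (word_cfg [None, x]) (word_cfg [x, None])"
    using cfg_iso_trans[OF 1] cfg_iso_sym[OF 2] by simp
  then show ?thesis by (rule cfg_iso_words) (use w uv in simp_all)
qed

lemma blank_closure_cancel:
  assumes n: "n \<ge> 1" and uv: "set u \<subseteq> letters n" "set v \<subseteq> letters n" and i: "i \<in> {1..<n}"
  shows "link_iso (blank_closure n (u @ [Some (i, b), Some (i, \<not> b)] @ v))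
    (blank_closure n (u @ [None, None] @ v))"
proof -
  let ?w = "[Some (i, b), Some (i, \<not> b)]"
  have w: "set ?w \<subseteq> letters n" "set [None, None] \<subseteq> letters n" using i by (auto simp: letters_def)
  have 1: "cfg_iso n 4 (word_cfg ?w) (override 4 (stacked i b) (word_cfg ?w))"
    by (rule cfg_iso_stacked[OF n w(1)]) simp
  have 2: "cfg_iso n 4 (word_cfg [None, None]) (override 4 (stacked i b) (word_cfg [None, None]))"
    by (rule cfg_iso_stacked[OF n w(2)]) simp
  have "override 4 (stacked i b) (word_cfg ?w) = override 4 (stacked i b) (word_cfg [None, None])"
  proof (rule override_cong)
    fix k j :: nat assume k: "4 \<le> k"
    then have "k = 4 \<or> \<not> k \<le> 2 \<and> \<not> k - 2 \<le> 2" by linarith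
    then show "word_cfg ?w k j = word_cfg [None, None] k j"
      by (elim disjE) (simp_all add: letter_cfg_def letter_perm_def)
  qed (simp_all only: stacked_not_None word_cfg_0 simp_thms)
  then have "cfg_iso n (2 * length ?w) (word_cfg ?w) (word_cfg [None, None])"
    using cfg_iso_trans[OF 1] cfg_iso_sym[OF 2] by simp
  then show ?thesis by (rule cfg_iso_words) (use w uv in simp_all)
qed

definition stacked2 :: "nat \<Rightarrow> nat \<Rightarrow> nat \<Rightarrow> (real \<times> real) option" where
  "stacked2 i i' j = (if j \<in> {i, Suc i} then stacked i True j else stacked i' True j)"

lemma cfg_iso_stacked2:
  assumes n: "n \<ge> 1" and w: "set [Some (i, True), Some (i', True)] \<subseteq> letters n"
    and far: "1 < \<bar>int i - int i'\<bar>"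
  shows "cfg_iso n 4 (word_cfg [Some (i, True), Some (i', True)])
    (override 4 (stacked2 i i') (word_cfg [Some (i, True), Some (i', True)]))"
proof (rule cfg_iso_override[OF n w])
  let ?w = "[Some (i, True), Some (i', True)]"
  let ?lo = "\<lambda>j. if j = Suc i then i else if j = Suc i' then i' else j"
    and ?hi = "\<lambda>j. if j = i then Suc i else if j = i' then Suc i' else j"
  have ne: "i \<noteq> i'" "i \<noteq> Suc i'" "i' \<noteq> Suc i" "Suc i \<noteq> i'" "Suc i' \<noteq> i" using far by auto
  show "word_in_blocks ?lo ?hi ?w" using ne by (auto simp: word_in_blocks_def)
  show "positions_ok ?lo ?hi (stacked2 i i')"
    using ne by (auto simp: positions_ok_def stacked2_def stacked_def)
  fix k p q :: nat assume k: "k < 4" and pq: "p < q" "?lo q \<le> ?hi p"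
  have "p = i \<and> q = Suc i \<or> p = i' \<and> q = Suc i'" using pq far by (auto split: if_splits)
  with less_4_cases[OF k]
  show "apart (word_cfg ?w) (override 4 (stacked2 i i') (word_cfg ?w)) k (Suc k) p q"
    using ne by (elim disjE conjE)
      (simp_all add: apart_def override_def stacked2_def stacked_def letter_cfg_def letter_perm_def)
qed auto

lemma blank_closure_commute:
  assumes n: "n \<ge> 1" and uv: "set u \<subseteq> letters n" "set v \<subseteq> letters n"
    and i: "i \<in> {1..<n}" "i' \<in> {1..<n}" and far: "1 < \<bar>int i - int i'\<bar>"
  shows "link_iso (blank_closure n (u @ [Some (i, True), Some (i', True)] @ v))
    (blank_closure n (u @ [Some (i', True), Some (i, True)] @ v))"
proof -
  let ?w = "[Some (i, True), Some (i', True)]" and ?w' = "[Some (i', True), Some (i, True)]"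
  have w: "set ?w \<subseteq> letters n" "set ?w' \<subseteq> letters n" using i by (auto simp: letters_def)
  have ne: "i \<noteq> i'" "i \<noteq> Suc i'" "i' \<noteq> Suc i" "Suc i \<noteq> i'" "Suc i' \<noteq> i" using far by auto
  have 1: "cfg_iso n 4 (word_cfg ?w) (override 4 (stacked2 i i') (word_cfg ?w))"
    by (rule cfg_iso_stacked2[OF n w(1) far])
  have 2: "cfg_iso n 4 (word_cfg ?w') (override 4 (stacked2 i' i) (word_cfg ?w'))"
    by (rule cfg_iso_stacked2[OF n w(2)]) (use far in simp)
  have "stacked2 i' i = stacked2 i i'"
    using ne by (auto simp: fun_eq_iff stacked2_def stacked_def)
  moreover have "override 4 (stacked2 i i') (word_cfg ?w) = override 4 (stacked2 i i') (word_cfg ?w')"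
  proof (rule override_cong)
    fix k j :: nat assume k: "4 \<le> k"
    then have "k = 4 \<or> \<not> k \<le> 2 \<and> \<not> k - 2 \<le> 2" by linarith
    then show "word_cfg ?w k j = word_cfg ?w' k j"
      using ne by (elim disjE) (simp_all add: letter_cfg_def letter_perm_def)
  qed (simp_all add: stacked2_def stacked_def word_cfg_0)
  ultimately have "cfg_iso n (2 * length ?w) (word_cfg ?w) (word_cfg ?w')"
    using cfg_iso_trans[OF 1] cfg_iso_sym[OF 2] by simp
  then show ?thesis by (rule cfg_iso_words) (use w uv in simp_all)
qed

text \<open>In both sides of the braid relation the strand from \<open>i\<close> is behind the two others and that from
  \<open>i + 2\<close> in front of them. The strand between them has depth at most $1/2$ and at least $0$; with the
  outer ones at the depths $-1/2$ and $1$ it can be moved from its first position to its second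
  one.\<close>

definition outer_strands :: "nat \<Rightarrow> nat \<Rightarrow> (real \<times> real) option" where
  "outer_strands i j = (if j = i then Some (real i + 1, -1/2)
     else if j = Suc (Suc i) then Some (real i + 1, 1) else None)"

lemma blank_closure_braid:
  assumes n: "n \<ge> 1" and uv: "set u \<subseteq> letters n" "set v \<subseteq> letters n"
    and i: "i \<in> {1..<n}" "Suc i \<in> {1..<n}"
  shows "link_iso (blank_closure n (u @ [Some (i, True), Some (Suc i, True), Some (i, True)] @ v))
    (blank_closure n (u @ [Some (Suc i, True), Some (i, True), Some (Suc i, True)] @ v))"
proof -
  let ?w = "[Some (i, True), Some (Suc i, True), Some (i, True)]"
    and ?w' = "[Some (Suc i, True), Some (i, True), Some (Suc i, True)]"
  let ?lo = "\<lambda>j. if j = Suc i \<or> j = Suc (Suc i) then i else j"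
    and ?hi = "\<lambda>j. if j = i \<or> j = Suc i then Suc (Suc i) else j"
  let ?C = "override 6 (outer_strands i) (word_cfg ?w)" and ?C' = "override 6 (outer_strands i) (word_cfg ?w')"
  have w: "set ?w \<subseteq> letters n" "set ?w' \<subseteq> letters n" using i by (auto simp: letters_def)
  have bw: "word_in_blocks ?lo ?hi ?w" "word_in_blocks ?lo ?hi ?w'" by (auto simp: word_in_blocks_def)
  have pos: "positions_ok ?lo ?hi (outer_strands i)" by (auto simp: positions_ok_def outer_strands_def)
  have near: "p = i \<and> q = Suc i \<or> p = i \<and> q = Suc (Suc i) \<or> p = Suc i \<and> q = Suc (Suc i)"
    if "p < q" "?lo q \<le> ?hi p" for p q
    using that by (auto split: if_splits)
  have 1: "cfg_iso n 6 (word_cfg ?w) ?C"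
  proof (rule cfg_iso_override[OF n w(1) _ bw(1) pos])
    fix k p q :: nat assume k: "k < 6" and pq: "p < q" "?lo q \<le> ?hi p"
    from less_6_cases[OF k] near[OF pq]
    show "apart (word_cfg ?w) ?C k (Suc k) p q"
      by (elim disjE conjE)
        (simp_all add: apart_def override_def outer_strands_def letter_cfg_def letter_perm_def)
  qed simp
  have 2: "cfg_iso n 6 (word_cfg ?w') ?C'"
  proof (rule cfg_iso_override[OF n w(2) _ bw(2) pos])
    fix k p q :: nat assume k: "k < 6" and pq: "p < q" "?lo q \<le> ?hi p"
    from less_6_cases[OF k] near[OF pq]
    show "apart (word_cfg ?w') ?C' k (Suc k) p q"
      by (elim disjE conjE)
        (simp_all add: apart_def override_def outer_strands_def letter_cfg_def letter_perm_def)
  qed simp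
  have 3: "cfg_iso n 6 ?C ?C'"
  proof (rule cfg_isoI[OF n])
    have blk: "in_blocks ?lo ?hi ?C" "in_blocks ?lo ?hi ?C'"
      by (rule in_blocks_override[OF in_blocks_word_cfg[OF bw(1)] pos],
          rule in_blocks_override[OF in_blocks_word_cfg[OF bw(2)] pos])
    show "separated n 6 ?C ?C'"
    proof (rule separated_blocksI[OF blk])
      fix k p q :: nat assume k: "k < 6" and pq: "p < q" "?lo q \<le> ?hi p"
      from less_6_cases[OF k] near[OF pq]
      show "apart ?C ?C' k (Suc k) p q"
        by (elim disjE conjE)
          (simp_all add: apart_def override_def outer_strands_def letter_cfg_def letter_perm_def)
    qed
    show "?C 0 j = (real j, 0)" "?C' 0 j = (real j, 0)" for j
      by (simp_all only: override_def word_cfg_0 less_irrefl simp_thms if_False)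
    show "?C' 6 j = ?C 6 j" for j
      by (simp add: override_def letter_cfg_def letter_perm_def)
    have "?C 6 = word_cfg ?w (2 * length ?w)" by (simp add: override_def fun_eq_iff del: word_cfg.simps)
    then show "?C 6 ` {1..n} = stations n" using word_cfg_final[OF w(1) n] by simp
    show "-1 < snd (?C l j) \<and> -1 < snd (?C' l j)" for l j
      using pos word_cfg_z unfolding positions_ok_def override_def
      by (auto split: option.split simp del: word_cfg.simps)
  qed
  have "cfg_iso n (2 * length ?w) (word_cfg ?w) (word_cfg ?w')"
    using cfg_iso_trans[OF cfg_iso_trans[OF 1 3] cfg_iso_sym[OF 2]] by simp
  then show ?thesis by (rule cfg_iso_words) (use w uv in simp_all)
qed


section \<open>Removing blank letters\<close>

text \<open>All moves take place in the plane of the closing arc, in the region below the end of the braid,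
  where only this arc is found: \<open>p\<close> is deleted, \<open>q'\<close> is inserted into the edge that rises from \<open>q\<close>,
  and \<open>q\<close> is deleted.\<close>

lemma link_iso_shorten_arc:
  fixes j m :: nat
  defines "a \<equiv> lift (ht m) (real j, 0)" and "p \<equiv> lift (ht (Suc m)) (real j, 0)"
    and "q \<equiv> lift (ht (Suc m)) (real j, -1)" and "r \<equiv> lift 1 (real j, -1)"
    and "t \<equiv> lift 0 (real j, 0)" and "q' \<equiv> lift (ht m) (real j, -1)"
  assumes L: "oriented_link (R \<union> {(a, p), (p, q), (q, r), (r, t)})"
    and R: "\<And>x. x \<in> support R \<Longrightarrow> x $ 1 = real j \<Longrightarrow> x $ 2 \<le> ht m \<Longrightarrow> x = a"
  shows "link_iso (R \<union> {(a, p), (p, q), (q, r), (r, t)}) (R \<union> {(a, q'), (q', r), (r, t)})"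
proof -
  note defs = a_def p_def q_def r_def t_def q'_def
  have ht1: "ht (Suc m) < ht m" "ht m < 1" using ht_nonpos[of m] by (simp, linarith)
  have ne: "a \<noteq> p" "a \<noteq> q" "a \<noteq> q'" "p \<noteq> q" "p \<noteq> q'" "q \<noteq> q'" "a \<noteq> r" "p \<noteq> r" "q \<noteq> r" "q' \<noteq> r"
      "p \<noteq> t" "q \<noteq> t" "q' \<noteq> t" "r \<noteq> t"
    using ht1 by (auto simp: defs)
  have notR: "(x, y) \<notin> R" if "x $ 1 = real j \<and> x $ 2 \<le> ht m \<and> x \<noteq> a \<or> y $ 1 = real j \<and> y $ 2 \<le> ht m \<and> y \<noteq> a" for x y
    using that R edge_ends_in_support[of x y R] by blast
  have tri: "x $ 1 = real j \<and> x $ 2 \<le> ht m" if "x \<in> convex hull {u, v, w}" "{u, v, w} \<subseteq> {a, p, q, q'}" for x u v w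
  proof -
    have "s $ 1 = real j \<and> s $ 2 \<le> ht m" if "s \<in> {a, p, q, q'}" for s
      using that ht1 by (auto simp: defs)
    then have s: "s $ 1 = real j \<and> s $ 2 \<le> ht m" if "s \<in> {u, v, w}" for s
      using that \<open>{u, v, w} \<subseteq> {a, p, q, q'}\<close> by blast
    have "x $ 1 \<le> real j" "x $ 1 \<ge> real j" "x $ 2 \<le> ht m"
      by (rule convex_hull_nth_le[OF that(1)] convex_hull_nth_ge[OF that(1)], use s in force)+
    then show ?thesis by simp
  qed
  have rt: "x = a" if "x \<in> closed_segment r t" "x $ 2 \<le> ht m" for x
  proof -
    note X = arc3_points[OF that(1)[unfolded r_def t_def]]
    have "x $ 2 = 0" "ht m = 0" using X(2) that(2) ht_nonpos[of m] by linarith+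
    then show ?thesis using X by (simp add: a_def eq_lift_iff)
  qed
  have 1: "link_iso ((R \<union> {(q, r), (r, t)}) \<union> {(a, p), (p, q)}) ((R \<union> {(q, r), (r, t)}) \<union> {(a, q)})"
  proof (rule link_iso_delete_vertex)
    have "R \<union> {(q, r), (r, t)} \<union> {(a, p), (p, q)} = R \<union> {(a, p), (p, q), (q, r), (r, t)}" by auto
    then show "oriented_link (R \<union> {(q, r), (r, t)} \<union> {(a, p), (p, q)})" using L by simp
    have "(a, p) \<notin> R" "(p, q) \<notin> R" by (rule notR, use ne ht1 in \<open>simp add: defs\<close>)+
    then show "(a, p) \<notin> R \<union> {(q, r), (r, t)}" "(p, q) \<notin> R \<union> {(q, r), (r, t)}" using ne by auto
    show "a \<noteq> q" by (rule ne)
    show "convex hull {a, q, p} \<inter> support (R \<union> {(q, r), (r, t)}) \<subseteq> {a, q}"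
    proof
      fix x assume x: "x \<in> convex hull {a, q, p} \<inter> support (R \<union> {(q, r), (r, t)})"
      then have xj: "x $ 1 = real j" "x $ 2 \<le> ht m" using tri by auto
      from x consider "x \<in> support R" | "x \<in> closed_segment q r" | "x \<in> closed_segment r t"
        by (auto simp: support_Un support_insert support_def[of "{}"])
      then show "x \<in> {a, q}"
      proof cases
        case 2
        have "x $ 3 = -1" using arc2_points(4)[OF 2[unfolded q_def r_def]] .
        then have "x = q" using x by (intro convex_hull_apex_min[of x q "{a, p}" 3]) (auto simp: insert_commute defs)
        then show ?thesis by simp
      qed (use R rt xj in auto)
    qed
  qed
  have eq2: "(R \<union> {(q, r), (r, t)}) \<union> {(a, q)} = (R \<union> {(a, q), (r, t)}) \<union> {(q, r)}"
    and eq3: "(R \<union> {(a, q), (r, t)}) \<union> {(q, q'), (q', r)} = (R \<union> {(q', r), (r, t)}) \<union> {(a, q), (q, q')}"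
    by auto
  have 2: "link_iso ((R \<union> {(a, q), (r, t)}) \<union> {(q, r)}) ((R \<union> {(a, q), (r, t)}) \<union> {(q, q'), (q', r)})"
  proof (rule link_iso_insert_collinear)
    show "oriented_link (R \<union> {(a, q), (r, t)} \<union> {(q, r)})" using 1 eq2 by (simp add: link_iso_def)
    have "(q, r) \<notin> R" by (rule notR) (use ne ht1 in \<open>simp add: defs\<close>)
    then show "(q, r) \<notin> R \<union> {(a, q), (r, t)}" using ne by auto
    show "q' \<in> open_segment q r"
    proof -
      let ?u = "(ht m - ht (Suc m)) / (1 - ht (Suc m))"
      have pos: "0 < ht m - ht (Suc m)" "ht m - ht (Suc m) < 1 - ht (Suc m)" "0 < 1 - ht (Suc m)"
        using ht1 by linarith+
      have u: "0 < ?u" "?u < 1" using pos by (simp_all only: divide_pos_pos divide_less_eq_1_pos)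
      have "?u * (1 - ht (Suc m)) = ht m - ht (Suc m)" using pos(3) by simp
      then have "(1 - ?u) * ht (Suc m) + ?u * 1 = ht m" by (simp only: left_diff_distrib right_diff_distrib)
      then have "q' = (1 - ?u) *\<^sub>R q + ?u *\<^sub>R r"
        by (simp add: point_eq_iff defs algebra_simps)
      then show ?thesis unfolding in_segment using u ne(9) by blast
    qed
  qed
  have 3: "link_iso ((R \<union> {(q', r), (r, t)}) \<union> {(a, q), (q, q')}) ((R \<union> {(q', r), (r, t)}) \<union> {(a, q')})"
  proof (rule link_iso_delete_vertex)
    show "oriented_link (R \<union> {(q', r), (r, t)} \<union> {(a, q), (q, q')})" using 2 eq3 by (simp add: link_iso_def)
    have "(a, q) \<notin> R" "(q, q') \<notin> R" by (rule notR, use ne ht1 in \<open>simp add: defs\<close>)+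
    then show "(a, q) \<notin> R \<union> {(q', r), (r, t)}" "(q, q') \<notin> R \<union> {(q', r), (r, t)}" using ne by auto
    show "a \<noteq> q'" by (rule ne)
    show "convex hull {a, q', q} \<inter> support (R \<union> {(q', r), (r, t)}) \<subseteq> {a, q'}"
    proof
      fix x assume x: "x \<in> convex hull {a, q', q} \<inter> support (R \<union> {(q', r), (r, t)})"
      then have xj: "x $ 1 = real j" "x $ 2 \<le> ht m" using tri by auto
      from x consider "x \<in> support R" | "x \<in> closed_segment q' r" | "x \<in> closed_segment r t"
        by (auto simp: support_Un support_insert support_def[of "{}"])
      then show "x \<in> {a, q'}"
      proof cases
        case 2
        note X = arc2_points[OF 2[unfolded q'_def r_def]]
        have "x = q'" using X xj by (simp add: q'_def eq_lift_iff)
        then show ?thesis by simp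
      qed (use R rt xj in auto)
    qed
  qed
  have "R \<union> {(a, p), (p, q), (q, r), (r, t)} = (R \<union> {(q, r), (r, t)}) \<union> {(a, p), (p, q)}"
    "R \<union> {(a, q'), (q', r), (r, t)} = (R \<union> {(q', r), (r, t)}) \<union> {(a, q')}" by auto
  then show ?thesis
    using link_iso_trans[OF 1[unfolded eq2] link_iso_trans[OF 2[unfolded eq3] 3]] by simp
qed

text \<open>The arcs are shortened one after another; \<open>J\<close> is the set of those already shortened.\<close>

lemma link_iso_drop_vertical_slab:
  assumes n: "n \<ge> 1" and path: "slab_path (stations n) L (stations n)"
  shows "link_iso (slab_closure n (L @ [(\<lambda>j. ((real j, 0), (real j, 0))) ` {1..n}])) (slab_closure n L)"
proof -
  let ?S = "(\<lambda>j. ((real j, 0 :: real), (real j, 0 :: real))) ` {1..n}"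
  let ?m = "length L"
  define X where "X = (\<Union>k<?m. slab_edges k (L ! k))"
  define N where "N j = {(lift (ht ?m) (real j, 0), lift (ht (Suc ?m)) (real j, 0)),
      (lift (ht (Suc ?m)) (real j, 0), lift (ht (Suc ?m)) (real j, -1)),
      (lift (ht (Suc ?m)) (real j, -1), lift 1 (real j, -1)),
      (lift 1 (real j, -1), lift 0 (real j, 0))}" for j
  define F where "F J = X \<union> (\<Union>j\<in>{1..n}. if j \<in> J then arc_edges ?m j else N j)" for J
  have S: "good_slab ?S" "fst ` ?S = stations n" "snd ` ?S = stations n"
    by (auto simp: good_slab_def stations_def image_image zero_prod_def)
  have path': "slab_path (stations n) (L @ [?S]) (stations n)"
    unfolding slab_path_append using path S by auto
  have F0: "F {} = slab_closure n (L @ [?S])"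
  proof -
    have "(\<Union>k<Suc ?m. slab_edges k ((L @ [?S]) ! k)) = X \<union> slab_edges ?m ?S"
      unfolding X_def lessThan_Suc by (auto simp: nth_append)
    moreover have "slab_edges ?m ?S \<union> (\<Union>j\<in>{1..n}. arc_edges (Suc ?m) j) = (\<Union>j\<in>{1..n}. N j)"
      unfolding slab_edges_def arc_edges_def N_def by auto
    ultimately show ?thesis by (simp add: F_def slab_closure_def Un_assoc)
  qed
  have F1: "F {1..n} = slab_closure n L" by (simp add: F_def X_def slab_closure_def)
  have Xfact: "x = lift (ht ?m) (real j, 0)"
    if x: "x \<in> support X" "x $ 1 = real j" "x $ 2 \<le> ht ?m" for x j
  proof -
    obtain a b where e: "(a, b) \<in> X" "x \<in> closed_segment a b" using x(1) support_memE by blast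
    then obtain k p q where k: "k < ?m" "(p, q) \<in> L ! k" "a = lift (ht k) p" "b = lift (ht (Suc k)) q"
      by (auto simp: X_def slab_edges_def)
    have good: "good_slab (L ! k)" using slab_path_nth[OF path k(1)] by simp
    note P = slab_edge_points[OF good k(2) e(2)[unfolded k]]
    have "ht ?m \<le> ht (Suc k)" using k(1) by simp
    then have "x $ 2 = ht (Suc k)" "ht (Suc k) = ht ?m" using P(2) x(3) by linarith+
    then have xq: "x = lift (ht ?m) q" and km: "Suc k = ?m" using P(5) by auto
    have "q \<in> stations n" using slab_path_last[OF path k(2) km] .
    then show ?thesis using xq x(2) by (auto simp: stations_def)
  qed
  have "link_iso (F {}) (F J)" if "finite J" "J \<subseteq> {1..n}" for J
    using that
  proof (induction J rule: finite_induct)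
    case empty
    then show ?case using link_iso_refl oriented_link_slab_closure[OF path' n] F0 by simp
  next
    case (insert j J)
    define R where "R = X \<union> (\<Union>i\<in>{1..n} - {j}. if i \<in> J then arc_edges ?m i else N i)"
    have j: "{1..n} = insert j ({1..n} - {j})" using insert.prems by auto
    have split: "(\<Union>i\<in>{1..n}. f i) = f j \<union> (\<Union>i\<in>{1..n} - {j}. f i)" for f :: "nat \<Rightarrow> polygon"
      using j by blast
    have FJ: "F J = R \<union> N j"
      unfolding F_def R_def split[of "\<lambda>i. if i \<in> J then arc_edges ?m i else N i"] using insert.hyps by auto
    have FjJ: "F (insert j J) = R \<union> arc_edges ?m j"
      unfolding F_def R_def split[of "\<lambda>i. if i \<in> insert j J then arc_edges ?m i else N i"] by auto
    have Rfact: "x = lift (ht ?m) (real j, 0)"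
      if x: "x \<in> support R" "x $ 1 = real j" "x $ 2 \<le> ht ?m" for x
    proof -
      obtain a b where e: "(a, b) \<in> R" "x \<in> closed_segment a b" using x(1) support_memE by blast
      have "(a, b) \<in> X"
      proof (rule ccontr)
        assume "(a, b) \<notin> X"
        then obtain i where i: "i \<noteq> j" "(a, b) \<in> arc_edges ?m i \<union> N i"
          using e(1) unfolding R_def by (auto split: if_splits)
        then have "a $ 1 = real i" "b $ 1 = real i" by (auto simp: arc_edges_def N_def)
        then show False using closed_segment_nth_bounds[OF e(2), of 1] x(2) i(1) by simp
      qed
      then show ?thesis using e(2) x by (intro Xfact support_memI)
    qed
    have IH: "link_iso (F {}) (F J)" using insert by auto
    then have "oriented_link (R \<union> N j)" using FJ by (simp add: link_iso_def)
    then have "link_iso (R \<union> N j) (R \<union> arc_edges ?m j)"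
      unfolding N_def arc_edges_def by (rule link_iso_shorten_arc) (rule Rfact)
    then show ?case using IH FJ FjJ link_iso_trans by metis
  qed
  from this[of "{1..n}"] show ?thesis using F0 F1 by simp
qed

lemma letter_slabs_None:
  "letter_slabs n None = [(\<lambda>j. ((real j, 0), (real j, 0))) ` {1..n}, (\<lambda>j. ((real j, 0), (real j, 0))) ` {1..n}]"
  by (simp add: letter_slabs_def config_slabs_def strands_def letter_cfg_def upt_rec)

lemma blank_closure_drop_last:
  assumes n: "n \<ge> 1" and w: "set w \<subseteq> letters n"
  shows "link_iso (blank_closure n (w @ [None])) (blank_closure n w)"
proof -
  let ?S = "(\<lambda>j. ((real j, 0 :: real), (real j, 0 :: real))) ` {1..n}"
  have path: "slab_path (stations n) (word_slabs n w) (stations n)" by (rule slab_path_word[OF w])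
  have "good_slab ?S" "fst ` ?S = stations n" "snd ` ?S = stations n"
    by (auto simp: good_slab_def stations_def image_image zero_prod_def)
  then have path': "slab_path (stations n) (word_slabs n w @ [?S]) (stations n)"
    unfolding slab_path_append using path by auto
  show ?thesis
    using link_iso_trans[OF link_iso_drop_vertical_slab[OF n path'] link_iso_drop_vertical_slab[OF n path]]
    by (simp add: blank_closure_def letter_slabs_None)
qed

text \<open>The blank letter is commuted to the end of the word.\<close>

lemma blank_closure_drop_blank:
  assumes n: "n \<ge> 1" 
  shows "set u \<subseteq> letters n \<Longrightarrow> set v \<subseteq> letters n \<Longrightarrow>
    link_iso (blank_closure n (u @ None # v)) (blank_closure n (u @ v))"
proof (induction v arbitrary: u)
  case Nil
  then show ?case using blank_closure_drop_last[OF n] by simp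
next
  case (Cons x v)
  have "link_iso (blank_closure n (u @ None # x # v)) (blank_closure n ((u @ [x]) @ None # v))"
    using blank_closure_swap_blank[OF n, of u v x] Cons.prems by simp
  also have "link_iso (blank_closure n ((u @ [x]) @ None # v)) (blank_closure n ((u @ [x]) @ v))"
    using Cons.prems by (intro Cons.IH) auto
  finally show ?case by simp
qed


section \<open>Stabilization\<close>

fun path_edges :: "point list \<Rightarrow> polygon" where
  "path_edges (x # y # xs) = insert (x, y) (path_edges (y # xs))"
| "path_edges _ = {}"

lemma path_edges_append:
  "xs \<noteq> [] \<Longrightarrow> ys \<noteq> [] \<Longrightarrow>
    path_edges (xs @ ys) = path_edges xs \<union> {(last xs, hd ys)} \<union> path_edges ys"
proof (induction xs rule: path_edges.induct)
  case (1 x y xs)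
  then show ?case by auto
next
  case ("2_2" v)
  then show ?case by (cases ys) auto
qed simp

lemma path_edges_loop:
  assumes "low \<noteq> []" "up \<noteq> []"
  shows "path_edges ([a] @ low @ [q, r] @ up @ [b])
    = {(a, hd low)} \<union> path_edges low \<union> {(last low, q), (q, r), (r, hd up)} \<union> path_edges up \<union> {(last up, b)}"
proof -
  have "path_edges ([a] @ (low @ ([q, r] @ (up @ [b]))))
      = path_edges [a] \<union> {(a, hd low)} \<union> (path_edges low \<union> {(last low, q)} \<union>
        (path_edges [q, r] \<union> {(r, hd up)} \<union> (path_edges up \<union> {(last up, b)} \<union> path_edges [b])))"
    using assms by (simp only: path_edges_append append_is_Nil_conv not_Cons_self2 list.distinct
        hd_append2 last.simps list.sel simp_thms if_False if_True)
  then show ?thesis by auto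
qed

lemma path_edges_rev: "path_edges (rev xs) = prod.swap ` path_edges xs"
proof (induction xs rule: path_edges.induct)
  case (1 x y xs)
  have "path_edges (rev (x # y # xs)) = path_edges (rev (y # xs) @ [x])" by simp
  also have "\<dots> = path_edges (rev (y # xs)) \<union> {(y, x)} \<union> path_edges [x]"
    by (subst path_edges_append) (simp_all add: last_rev)
  finally show ?case using 1 by auto
qed simp_all

lemma path_edges_upt: "path_edges (map f [a..<Suc b]) = (\<lambda>k. (f k, f (Suc k))) ` {a..<b}"
proof (cases "a \<le> b")
  case True
  then show ?thesis
  proof (induction b rule: dec_induct)
    case (step b)
    have "[a..<Suc (Suc b)] = [a..<Suc b] @ [Suc b]" using step by simp
    moreover have "path_edges (map f [a..<Suc b] @ map f [Suc b])
        = path_edges (map f [a..<Suc b]) \<union> {(f b, f (Suc b))}"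
      using step by (subst path_edges_append) (auto simp: last_map)
    ultimately show ?case using step by (auto simp: atLeastLessThanSuc)
  qed simp
qed simp

lemma path_edges_ends: "(x, y) \<in> path_edges xs \<Longrightarrow> x \<in> set xs \<and> y \<in> set xs"
  by (induction xs rule: path_edges.induct) auto

lemma path_edges_start_not_last:
  "distinct xs \<Longrightarrow> (x, y) \<in> path_edges (xs @ [w]) \<Longrightarrow> x \<in> set xs \<and> (y \<noteq> w \<longrightarrow> y \<in> set xs) \<and> (y = w \<longrightarrow> w \<in> set xs \<or> x = last xs)"
  by (induction xs rule: path_edges.induct) auto

lemma convex_hull_face:
  fixes v x y :: point
  assumes p: "p \<in> convex hull {v, x, y}" and c: "x $ i = c" "y $ i = c" "v $ i < c" "p $ i = c"
  shows "p \<in> closed_segment x y"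
proof -
  obtain \<alpha> \<beta> \<gamma> where a: "0 \<le> \<alpha>" "0 \<le> \<beta>" "0 \<le> \<gamma>" "\<alpha> + \<beta> + \<gamma> = 1" "p = \<alpha> *\<^sub>R v + \<beta> *\<^sub>R x + \<gamma> *\<^sub>R y"
    using p unfolding convex_hull_3 by blast
  have "\<beta> + \<gamma> = 1 - \<alpha>" using a(4) by simp
  moreover have "p $ i = \<alpha> * v $ i + (\<beta> + \<gamma>) * c" unfolding a(5) using c by (simp add: algebra_simps)
  ultimately have "c = \<alpha> * v $ i + (1 - \<alpha>) * c" using c(4) by simp
  moreover have "\<alpha> * (v $ i - c) = (\<alpha> * v $ i + (1 - \<alpha>) * c) - c" by (simp add: algebra_simps)
  ultimately have "\<alpha> * (v $ i - c) = 0" by linarith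
  then have "\<alpha> = 0" using c(3) by simp
  then have "\<beta> = 1 - \<gamma>" "p = (1 - \<gamma>) *\<^sub>R x + \<gamma> *\<^sub>R y" "\<gamma> \<le> 1" using a by auto
  then show ?thesis unfolding in_segment using a(3) by blast
qed

text \<open>The loop through the plane $x = c$ is contracted by a fan of triangles with apex \<open>v\<close>: its vertices
  are deleted in turn. A triangle meets that plane only in its side on the loop, so the edge that
  leads back to \<open>w\<close> is the only one that might get in the way. Outside of the plane, each point of
  that edge is higher, in the third coordinate, than the points of the triangle with the same first coordinate, because
  \<open>w\<close> is higher than \<open>v\<close> and the loop nowhere exceeds the level of its last vertex.\<close>

lemma link_iso_contract_loop:
  fixes v w :: point
  assumes "oriented_link (R \<union> path_edges (v # xs @ [w]))" and "distinct (v # xs @ [w])" and "xs \<noteq> []"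
    and "\<And>x. x \<in> set xs \<Longrightarrow> x $ 1 = c \<and> x $ 3 \<le> last xs $ 3"
    and v: "v $ 1 < c" "w $ 1 = v $ 1" "v $ 3 < w $ 3"
    and R: "\<And>y. y \<in> support R \<Longrightarrow> v $ 1 \<le> y $ 1 \<Longrightarrow> y = v \<or> y = w"
  shows "link_iso (R \<union> path_edges (v # xs @ [w])) (R \<union> {(v, w)})"
  using assms(1-4)
proof (induction xs)
  case Nil
  then show ?case by simp
next
  case (Cons x xs)
  have x: "x $ 1 = c" using Cons.prems(4) by simp
  have vw: "v \<noteq> w" using v by auto
  have notR: "(p, q) \<notin> R" if "p = x \<or> q = x" for p q
  proof
    assume "(p, q) \<in> R"
    then have "x \<in> support R" using that edge_ends_in_support[of p q R x] by auto
    then have "x = v \<or> x = w" using R x v by auto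
    then show False using x v by auto
  qed
  have ge: "v $ 1 \<le> y $ 1" if "y \<in> convex hull {a, b, e}" "{a, b, e} \<subseteq> {v, w, x} \<union> set xs" for y a b e
  proof (rule convex_hull_nth_ge[OF that(1)])
    fix s assume "s \<in> {a, b, e}"
    then have "s \<in> {v, w, x} \<union> set xs" using that(2) by blast
    then show "v $ 1 \<le> s $ 1" using Cons.prems(4) v by auto
  qed
  show ?case
  proof (cases xs)
    case Nil
    have eq: "R \<union> path_edges (v # (x # xs) @ [w]) = R \<union> {(v, x), (x, w)}" by (simp add: Nil)
    show ?thesis unfolding eq
    proof (rule link_iso_delete_vertex)
      show "oriented_link (R \<union> {(v, x), (x, w)})" using Cons.prems(1) unfolding eq .
      show "convex hull {v, w, x} \<inter> support R \<subseteq> {v, w}"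
      proof
        fix y assume y: "y \<in> convex hull {v, w, x} \<inter> support R"
        then have "v $ 1 \<le> y $ 1" using ge[of y v w x] by blast
        then show "y \<in> {v, w}" using R y by auto
      qed
    qed (use notR vw in auto)
  next
    case (Cons x2 xs')
    note xs = Cons
    let ?tail = "path_edges (xs @ [w])"
    have x2: "x2 $ 1 = c" using Cons.prems(4) xs by simp
    have eq: "R \<union> path_edges (v # (x # xs) @ [w]) = (R \<union> ?tail) \<union> {(v, x), (x, x2)}"
      and eq': "(R \<union> ?tail) \<union> {(v, x2)} = R \<union> path_edges (v # xs @ [w])"
      using xs by auto
    let ?l = "last xs"
    have l: "?l \<in> set xs" "?l $ 1 = c" using Cons.prems(4) xs by auto
    have L: "oriented_link ((R \<union> ?tail) \<union> {(v, x), (x, x2)})" using Cons.prems(1) unfolding eq .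
    have d: "v \<notin> set (xs @ [w])" "x \<notin> set (xs @ [w])" "distinct xs" "w \<notin> set xs"
      using Cons.prems(2) by auto
    have tail: "y = x2" if y: "y \<in> convex hull {v, x2, x}" "y \<in> support ?tail" for y
    proof -
      obtain p q where e: "(p, q) \<in> ?tail" "y \<in> closed_segment p q" using y(2) support_memE by blast
      have pq: "p \<in> set xs" "q \<noteq> w \<Longrightarrow> q \<in> set xs" "q = w \<Longrightarrow> p = ?l"
        using path_edges_start_not_last[OF d(3) e(1)] d(4) by auto
      have yc: "y $ 1 = c"
      proof (cases "q = w")
        case False
        then have "p $ 1 = c" "q $ 1 = c" using pq Cons.prems(4) by auto
        then show ?thesis using closed_segment_nth_bounds[OF e(2), of 1] by simp
      next
        case True
        have yl: "y \<in> closed_segment ?l w" using e(2) True pq(3) by simp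
        obtain t where t: "0 \<le> t" "t \<le> 1" "\<And>i. y $ i = (1 - t) * ?l $ i + t * w $ i"
          using yl by (rule closed_segment_nthE) blast
        obtain \<alpha> \<beta> \<gamma> where a: "0 \<le> \<alpha>" "0 \<le> \<beta>" "0 \<le> \<gamma>" "\<alpha> + \<beta> + \<gamma> = 1"
          "y = \<alpha> *\<^sub>R v + \<beta> *\<^sub>R x2 + \<gamma> *\<^sub>R x"
          using y(1) unfolding convex_hull_3 by blast
        have "\<alpha> * v $ 1 + (\<beta> + \<gamma>) * c = (1 - t) * c + t * v $ 1"
          using t(3)[of 1] l v x x2 unfolding a(5) by (simp add: algebra_simps)
        moreover have \<beta>\<gamma>: "\<beta> + \<gamma> = 1 - \<alpha>" using a(4) by simp
        ultimately have "(\<alpha> - t) * (v $ 1 - c) = 0" by (simp add: algebra_simps)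
        \<comment> \<open>equal first coordinates, so that the third coordinates can be compared\<close>
        then have \<alpha>: "\<alpha> = t" using v by simp
        have "\<beta> * x2 $ 3 \<le> \<beta> * ?l $ 3" "\<gamma> * x $ 3 \<le> \<gamma> * ?l $ 3"
          using Cons.prems(4)[of x] Cons.prems(4)[of x2] a(2,3) xs by (auto intro!: mult_left_mono)
        then have "\<beta> * x2 $ 3 + \<gamma> * x $ 3 \<le> (\<beta> + \<gamma>) * ?l $ 3" by (simp add: algebra_simps)
        moreover have "t * v $ 3 + (\<beta> * x2 $ 3 + \<gamma> * x $ 3) = (1 - t) * ?l $ 3 + t * w $ 3"
          using t(3)[of 3] unfolding a(5) \<alpha> by simp
        ultimately have "t * (w $ 3 - v $ 3) \<le> 0" unfolding \<beta>\<gamma> \<alpha> by (simp add: algebra_simps)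
        then have "t = 0" using t(1) v(3) by (simp add: mult_le_0_iff)
        then show ?thesis using t(3)[of 1] l by simp
      qed
      then have "y \<in> closed_segment x2 x"
        using convex_hull_face[OF y(1) x2 x v(1)] by simp
      then have yx: "y \<in> closed_segment x x2" by (simp add: closed_segment_commute)
      have "(x, x2) \<noteq> (p, q)" using pq(1) d(2) by auto
      then have "y \<in> {x, x2}" "y \<in> {p, q}"
        using oriented_link_meet[OF L, of x x2 p q y] e yx by auto
      moreover have "x \<notin> {p, q}" using pq d(2) by auto
      ultimately show ?thesis by auto
    qed
    have "link_iso ((R \<union> ?tail) \<union> {(v, x), (x, x2)}) ((R \<union> ?tail) \<union> {(v, x2)})"
    proof (rule link_iso_delete_vertex[OF L])
      have "(v, x) \<notin> ?tail" "(x, x2) \<notin> ?tail" using d(1,2) path_edges_ends by blast+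
      then show "(v, x) \<notin> R \<union> ?tail" "(x, x2) \<notin> R \<union> ?tail" using notR by auto
      show "v \<noteq> x2" using x2 v by auto
      show "convex hull {v, x2, x} \<inter> support (R \<union> ?tail) \<subseteq> {v, x2}"
      proof
        fix y assume y: "y \<in> convex hull {v, x2, x} \<inter> support (R \<union> ?tail)"
        show "y \<in> {v, x2}"
        proof (cases "y \<in> support R")
          case True
          have "v $ 1 \<le> y $ 1" using ge[of y v x2 x] y xs by auto
          then consider "y = v" | "y = w" using R True by auto
          then show ?thesis
          proof cases
            case 2
            have "w = v"
              using y v x x2 2 by (intro convex_hull_apex_min[of w v "{x2, x}" 1]) auto
            then show ?thesis using vw by simp
          qed simp
        next
          case False
          then show ?thesis using tail[of y] y by (auto simp: support_Un)
        qed
      qed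
    qed
    then have step: "link_iso (R \<union> path_edges (v # (x # xs) @ [w])) (R \<union> path_edges (v # xs @ [w]))"
      unfolding eq eq' .
    have "link_iso (R \<union> path_edges (v # xs @ [w])) (R \<union> {(v, w)})"
    proof (rule Cons.IH)
      show "oriented_link (R \<union> path_edges (v # xs @ [w]))" using step by (simp add: link_iso_def)
    qed (use Cons.prems xs in auto)
    with step show ?thesis by (rule link_iso_trans)
  qed
qed

lemma slab_fst_le:
  assumes "set w \<subseteq> letters n" "S \<in> set (word_slabs n w)" "(p, q) \<in> S"
  shows "fst p \<le> real n" "fst q \<le> real n"
proof -
  obtain x where x: "x \<in> letters n" "S \<in> set (letter_slabs n x)"
    using assms(1,2) by (auto simp: word_slabs_def)
  then obtain k where k: "k < 2" "S = strands n (letter_cfg x) k"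
    by (auto simp: letter_slabs_def config_slabs_def)
  have "fst (letter_cfg x l j) \<le> real n" if "j \<in> {1..n}" "l \<le> 2" for l j
  proof -
    have "0 \<le> real l / 2" "real l / 2 \<le> 1" using that(2) by auto
    then show ?thesis using x(1) that(1) by (auto simp: letters_def letter_cfg_def)
  qed
  then show "fst p \<le> real n" "fst q \<le> real n"
    using assms(3) k by (auto simp: strands_def)
qed

lemma letter_slabs_Suc:
  assumes "x \<in> letters n"
  shows "letter_slabs (Suc n) x = map (insert ((real (Suc n), 0), (real (Suc n), 0))) (letter_slabs n x)"
proof -
  have "{1..Suc n} = insert (Suc n) {1..n}" by auto
  moreover have "letter_cfg x k (Suc n) = (real (Suc n), 0)" for k
    using assms by (auto simp: letters_def letter_cfg_def)
  ultimately show ?thesis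
    by (simp add: letter_slabs_def config_slabs_def strands_def del: One_nat_def)
qed

lemma word_slabs_Suc:
  "set w \<subseteq> letters n \<Longrightarrow>
    word_slabs (Suc n) w = map (insert ((real (Suc n), 0), (real (Suc n), 0))) (word_slabs n w)"
  by (induction w) (simp_all add: letter_slabs_Suc)

lemma letters_Suc: "letters n \<subseteq> letters (Suc n)"
  by (auto simp: letters_def)

text \<open>The last strand runs from \<open>A0\<close> over \<open>A1\<close> to the position \<open>n + 1\<close>, once around the closing arc
  through the points \<open>xs\<close>, and back over \<open>B1\<close> to \<open>B2\<close>. The path from \<open>A1\<close> to \<open>B1\<close> is the loop that
  stabilization removes.\<close>

lemma slab_closure_stabilized:
  fixes n :: nat and u v :: "letter list" and b :: bool
  defines "h \<equiv> (if b then 1/2 else -1/2 :: real)" and "K \<equiv> 2 * length u"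
    and "m \<equiv> 2 * length u + 2 + 2 * length v"
    and "I \<equiv> (\<lambda>j. ((real j, 0 :: real), (real j, 0 :: real))) ` {1..<n}"
    and "Y \<equiv> \<lambda>k. lift (ht k) (real (Suc n), 0)"
  defines "L \<equiv> word_slabs n u @ [I, I] @ word_slabs n v"
    and "A0 \<equiv> lift (ht K) (real n, 0)" and "A1 \<equiv> lift (ht (Suc K)) (real n + 1/2, 0)"
    and "B1 \<equiv> lift (ht (Suc K)) (real n + 1/2, h)" and "B2 \<equiv> lift (ht (Suc (Suc K))) (real n, 0)"
  defines "xs \<equiv> map Y [Suc (Suc K)..<Suc m] @ [lift (ht m) (real (Suc n), -1), lift 1 (real (Suc n), -1)] @ map Y [0..<Suc K]"
  assumes n: "n \<ge> 1" and u: "set u \<subseteq> letters n" and v: "set v \<subseteq> letters n"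
  shows "blank_closure (Suc n) (u @ [Some (n, b)] @ v)
    = slab_closure n L \<union> {(A0, A1), (B1, B2)} \<union> path_edges (A1 # xs @ [B1])"
proof -
  let ?v = "((real (Suc n), 0 :: real), (real (Suc n), 0 :: real))"
  let ?S1 = "insert ((real n, 0), (real n + 1/2, 0)) (insert ((real (Suc n), 0), (real n + 1/2, h)) I)"
  let ?S2 = "insert ((real n + 1/2, 0), (real (Suc n), 0)) (insert ((real n + 1/2, h), (real n, 0)) I)"
  let ?M = "map (insert ?v) (word_slabs n u) @ [?S1, ?S2] @ map (insert ?v) (word_slabs n v)"
  let ?new = "\<lambda>k. if k = K then {(A0, A1), (Y K, B1)} else if k = Suc K then {(A1, Y (Suc (Suc K))), (B1, B2)}
      else {(Y k, Y (Suc k))}"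
  have M: "word_slabs (Suc n) (u @ [Some (n, b)] @ v) = ?M"
  proof -
    have "{1..Suc n} - {n, Suc n} = {1..<n}" by auto
    then have "letter_slabs (Suc n) (Some (n, b)) = [?S1, ?S2]"
      using letter_slabs_crossing[of n "Suc n" b] n by (simp add: h_def I_def insert_commute)
    then show ?thesis using word_slabs_Suc[OF u] word_slabs_Suc[OF v] by simp
  qed
  have lenM: "length ?M = m" and lenL: "length L = m" by (simp_all add: m_def L_def)
  have nth: "slab_edges k (?M ! k) = slab_edges k (L ! k) \<union> ?new k" if k: "k < m" for k
  proof -
    consider "k < K" | "k = K" | "k = Suc K" | "Suc K < k" by linarith
    then show ?thesis
    proof cases
      case 1
      then have "?M ! k = insert ?v (word_slabs n u ! k)" "L ! k = word_slabs n u ! k"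
        by (simp_all add: L_def nth_append K_def)
      then show ?thesis using 1 by (simp add: slab_edges_def Y_def)
    next
      case 2
      then have "?M ! k = ?S1" "L ! k = I" by (simp_all add: L_def nth_append K_def)
      then show ?thesis using 2 by (auto simp: slab_edges_def Y_def A0_def A1_def B1_def)
    next
      case 3
      then have "?M ! k = ?S2" "L ! k = I" by (simp_all add: L_def nth_append K_def)
      then show ?thesis using 3 by (auto simp: slab_edges_def Y_def B2_def A1_def B1_def)
    next
      case 4
      then obtain d where d: "k = Suc (Suc K) + d" by (metis Suc_leI le_Suc_ex)
      then have dv: "d < length (word_slabs n v)" using k by (simp add: m_def K_def)
      have "?M ! k = insert ?v (word_slabs n v ! d)" "L ! k = word_slabs n v ! d"
        using d dv by (simp_all add: L_def nth_append K_def)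
      then show ?thesis using 4 by (simp add: slab_edges_def Y_def)
    qed
  qed
  have Km: "Suc K < m" by (simp add: m_def K_def)
  have new: "(\<Union>k<m. ?new k) = {(A0, A1), (B1, B2)} \<union> {(Y K, B1), (A1, Y (Suc (Suc K)))}
      \<union> (\<lambda>k. (Y k, Y (Suc k))) ` {0..<K} \<union> (\<lambda>k. (Y k, Y (Suc k))) ` {Suc (Suc K)..<m}"
  proof -
    have "{..<m} = {K, Suc K} \<union> {0..<K} \<union> {Suc (Suc K)..<m}" using Km by auto
    moreover have "(\<Union>k\<in>{0..<K}. ?new k) = (\<lambda>k. (Y k, Y (Suc k))) ` {0..<K}"
      "(\<Union>k\<in>{Suc (Suc K)..<m}. ?new k) = (\<lambda>k. (Y k, Y (Suc k))) ` {Suc (Suc K)..<m}"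
      by auto
    moreover have "(\<Union>k\<in>{K, Suc K}. ?new k) = {(A0, A1), (B1, B2)} \<union> {(Y K, B1), (A1, Y (Suc (Suc K)))}"
      by auto
    ultimately show ?thesis by (simp only: UN_Un)
  qed
  have arcs: "(\<Union>j\<in>{1..Suc n}. arc_edges m j) = (\<Union>j\<in>{1..n}. arc_edges m j) \<union> arc_edges m (Suc n)"
    by (simp add: atLeastAtMostSuc_conv Un_commute)
  have path: "path_edges (A1 # xs @ [B1]) = {(A1, Y (Suc (Suc K)))} \<union> (\<lambda>k. (Y k, Y (Suc k))) ` {Suc (Suc K)..<m}
      \<union> arc_edges m (Suc n) \<union> (\<lambda>k. (Y k, Y (Suc k))) ` {0..<K} \<union> {(Y K, B1)}"
  proof -
    let ?low = "map Y [Suc (Suc K)..<Suc m]" and ?up = "map Y [0..<Suc K]"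
    have low: "hd ?low = Y (Suc (Suc K))" "last ?low = Y m" "?low \<noteq> []"
      using Km by (simp_all add: hd_map last_map hd_upt last_upt del: upt_Suc)
    have up: "hd ?up = Y 0" "last ?up = Y K" "?up \<noteq> []"
      by (simp_all add: hd_map last_map hd_upt last_upt del: upt_Suc)
    have arc: "{(Y m, lift (ht m) (real (Suc n), -1)), (lift (ht m) (real (Suc n), -1), lift 1 (real (Suc n), -1)),
        (lift 1 (real (Suc n), -1), Y 0)} = arc_edges m (Suc n)"
      by (simp add: arc_edges_def Y_def)
    have "path_edges ([A1] @ ?low @ [lift (ht m) (real (Suc n), -1), lift 1 (real (Suc n), -1)] @ ?up @ [B1])
      = {(A1, Y (Suc (Suc K)))} \<union> path_edges ?low \<union> arc_edges m (Suc n) \<union> path_edges ?up \<union> {(Y K, B1)}"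
      unfolding path_edges_loop[OF low(3) up(3)] low(1,2) up(1,2) arc ..
    then show ?thesis unfolding xs_def path_edges_upt by simp
  qed
  have "blank_closure (Suc n) (u @ [Some (n, b)] @ v)
      = (\<Union>k<m. slab_edges k (L ! k)) \<union> (\<Union>k<m. ?new k) \<union> ((\<Union>j\<in>{1..n}. arc_edges m j) \<union> arc_edges m (Suc n))"
    unfolding blank_closure_def M slab_closure_def lenM arcs using nth by (simp add: UN_Un_distrib)
  also have "\<dots> = slab_closure n L \<union> {(A0, A1), (B1, B2)} \<union> path_edges (A1 # xs @ [B1])"
    unfolding new path slab_closure_def lenL by blast
  finally show ?thesis .
qed


text \<open>The closing arc of the last strand lies at nonpositive depth. For a positive crossing the loop is
  contracted with the apex \<open>A1\<close>, since \<open>B1\<close> is in front of it; for a negative crossing \<open>A1\<close> is in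
  front of \<open>B1\<close>, and the loop is contracted in the opposite direction with the apex \<open>B1\<close>. What remains
  of the crossing is a bend of strand \<open>n\<close>, which is straightened to a blank letter.\<close>

theorem blank_closure_stabilize:
  assumes n: "n \<ge> 1" and u: "set u \<subseteq> letters n" and v: "set v \<subseteq> letters n"
  shows "link_iso (blank_closure (Suc n) (u @ [Some (n, b)] @ v)) (blank_closure n (u @ [None] @ v))"
proof -
  define h where "h = (if b then 1/2 else -1/2 :: real)"
  define K where "K = 2 * length u"
  define m where "m = 2 * length u + 2 + 2 * length v"
  define I where "I = (\<lambda>j. ((real j, 0 :: real), (real j, 0 :: real))) ` {1..<n}"
  define Y where "Y = (\<lambda>k. lift (ht k) (real (Suc n), 0))"
  define L where "L = word_slabs n u @ [I, I] @ word_slabs n v"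
  define A0 where "A0 = lift (ht K) (real n, 0)"
  define A1 where "A1 = lift (ht (Suc K)) (real n + 1/2, 0)"
  define B1 where "B1 = lift (ht (Suc K)) (real n + 1/2, h)"
  define B2 where "B2 = lift (ht (Suc (Suc K))) (real n, 0)"
  define xs where "xs = map Y [Suc (Suc K)..<Suc m] @ [lift (ht m) (real (Suc n), -1), lift 1 (real (Suc n), -1)] @ map Y [0..<Suc K]"
  let ?w = "u @ [Some (n, b)] @ v" and ?c = "real n + 1" and ?x = "real n + 1/2"
  let ?base = "slab_closure n L"
  let ?R = "?base \<union> {(A0, A1), (B1, B2)}"
  have E: "blank_closure (Suc n) ?w = ?R \<union> path_edges (A1 # xs @ [B1])"
    unfolding L_def A0_def A1_def B1_def B2_def xs_def Y_def h_def K_def m_def I_def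
    by (rule slab_closure_stabilized[OF n u v])
  have "set ?w \<subseteq> letters (Suc n)" using u v letters_Suc[of n] n by (auto simp: letters_def)
  then have link: "oriented_link (?R \<union> path_edges (A1 # xs @ [B1]))"
    using oriented_link_blank_closure[of "Suc n" ?w] E by simp
  have lenL: "length L = m" by (simp add: L_def m_def)
  have Km: "Suc K < m" by (simp add: m_def K_def)
  have LK: "L ! K = I" "L ! Suc K = I" by (simp_all add: L_def nth_append K_def)
  have R0: "y $ 1 \<le> real n" if y: "y \<in> support ?base" for y
  proof -
    obtain p q where e: "(p, q) \<in> ?base" "y \<in> closed_segment p q" using y support_memE by blast
    have "p $ 1 \<le> real n \<and> q $ 1 \<le> real n"
      using e(1)
    proof (cases rule: slab_closure_edgeE)
      case (slab k p' q')
      have "L ! k \<in> set L" using slab by simp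
      then have "L ! k = I \<or> L ! k \<in> set (word_slabs n u) \<or> L ! k \<in> set (word_slabs n v)"
        by (auto simp: L_def)
      then show ?thesis
        using slab slab_fst_le[OF u _ slab(2)] slab_fst_le[OF v _ slab(2)] by (auto simp: I_def)
    qed auto
    then show ?thesis using closed_segment_nth_bounds(2)[OF e(2), of 1] by linarith
  qed
  have A0A1: "y = A1" if "y \<in> closed_segment A0 A1" "?x \<le> y $ 1" for y
    using that by (intro closed_segment_apex_max[of y A1 A0 1]) (auto simp: closed_segment_commute A0_def A1_def)
  have B1B2: "y = B1" if "y \<in> closed_segment B1 B2" "?x \<le> y $ 1" for y
    using that by (intro closed_segment_apex_max[of y B1 B2 1]) (auto simp: B1_def B2_def)
  have R: "y = A1 \<or> y = B1" if "y \<in> support ?R" "?x \<le> y $ 1" for y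
    using that A0A1[of y] B1B2[of y] R0[of y] by (auto simp: support_Un support_insert support_def[of "{}"])
  have dist: "distinct (A1 # xs @ [B1])"
  proof -
    have "inj Y" by (rule injI) (simp add: Y_def)
    then have "distinct (map Y [Suc (Suc K)..<Suc m])" "distinct (map Y [0..<Suc K])"
      by (simp_all add: distinct_map inj_on_def inj_def del: upt_Suc)
    moreover have "set (map Y [Suc (Suc K)..<Suc m]) \<inter> set (map Y [0..<Suc K]) = {}"
      by (auto simp: Y_def)
    ultimately have "distinct xs"
      unfolding xs_def by (auto simp: Y_def simp del: upt_Suc)
    moreover have "y $ 1 = ?c" if "y \<in> set xs" for y
      using that by (auto simp: xs_def Y_def)
    then have "A1 \<notin> set xs" "B1 \<notin> set xs" by (force simp: A1_def B1_def)+
    moreover have "A1 \<noteq> B1" by (simp add: A1_def B1_def h_def)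
    ultimately show ?thesis by simp
  qed
  have xs_ne: "xs \<noteq> []" by (simp add: xs_def)
  have plane: "y $ 1 = ?c \<and> y $ 3 \<le> 0" if "y \<in> set xs" for y
    using that by (auto simp: xs_def Y_def)
  have ends3: "last xs $ 3 = 0" "hd xs $ 3 = 0"
    using Km by (simp_all add: xs_def hd_append hd_map last_map hd_upt Y_def del: upt_Suc)
  have 1: "link_iso (blank_closure (Suc n) ?w) (?R \<union> {(A1, B1)})"
  proof (cases b)
    case True
    show ?thesis
      unfolding E
      by (rule link_iso_contract_loop[OF link dist xs_ne, of ?c])
         (use plane ends3 R True in \<open>auto simp: A1_def B1_def h_def\<close>)
  next
    case False
    have swap: "prod.swap ` (?R \<union> path_edges (A1 # xs @ [B1])) = prod.swap ` ?R \<union> path_edges (B1 # rev xs @ [A1])"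
      using path_edges_rev[of "A1 # xs @ [B1]"] by (simp add: image_Un)
    have "link_iso (prod.swap ` ?R \<union> path_edges (B1 # rev xs @ [A1])) (prod.swap ` ?R \<union> {(B1, A1)})"
    proof (rule link_iso_contract_loop[where c = ?c])
      show "oriented_link (prod.swap ` ?R \<union> path_edges (B1 # rev xs @ [A1]))"
        using oriented_link_reverse[OF link] unfolding swap .
      show "y = B1 \<or> y = A1" if "y \<in> support (prod.swap ` ?R)" "B1 $ 1 \<le> y $ 1" for y
        using R[of y] that unfolding support_reverse by (auto simp: B1_def)
    qed (use dist xs_ne plane ends3 False in \<open>auto simp: last_rev A1_def B1_def h_def\<close>)
    then have "link_iso (prod.swap ` (?R \<union> path_edges (A1 # xs @ [B1]))) (prod.swap ` (?R \<union> {(A1, B1)}))"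
      unfolding swap by (simp add: image_Un)
    from link_iso_reverse[OF this] show ?thesis unfolding E by (simp add: image_image)
  qed
  have eq: "?R \<union> {(A1, B1)} = (?base \<union> {(B1, B2)}) \<union> {(A0, A1), (A1, B1)}"
    and eq': "(?base \<union> {(B1, B2)}) \<union> {(A0, B1)} = ?base \<union> {(A0, B1), (B1, B2)}" by auto
  have 2: "link_iso ((?base \<union> {(B1, B2)}) \<union> {(A0, A1), (A1, B1)}) ((?base \<union> {(B1, B2)}) \<union> {(A0, B1)})"
  proof (rule link_iso_delete_vertex)
    show "oriented_link (?base \<union> {(B1, B2)} \<union> {(A0, A1), (A1, B1)})"
      using 1 unfolding eq by (simp add: link_iso_def)
    have notR0: "(p, q) \<notin> ?base" if "p = A1 \<or> q = A1" for p q
    proof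
      assume "(p, q) \<in> ?base"
      then have "A1 \<in> support ?base" using that edge_ends_in_support[of p q ?base A1] by auto
      then show False using R0[of A1] by (simp add: A1_def)
    qed
    have ne: "A1 \<noteq> B1" "A1 \<noteq> B2" "A0 \<noteq> B1" by (auto simp: A0_def A1_def B1_def B2_def h_def)
    then show "A0 \<noteq> B1" by simp
    show "(A0, A1) \<notin> ?base \<union> {(B1, B2)}" "(A1, B1) \<notin> ?base \<union> {(B1, B2)}"
      using notR0[of A0 A1] notR0[of A1 B1] ne by auto
    show "convex hull {A0, B1, A1} \<inter> support (?base \<union> {(B1, B2)}) \<subseteq> {A0, B1}"
    proof
      fix y assume y: "y \<in> convex hull {A0, B1, A1} \<inter> support (?base \<union> {(B1, B2)})"
      then consider "y \<in> support ?base" | "y \<in> closed_segment B1 B2"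
        by (auto simp: support_insert)
      then show "y \<in> {A0, B1}"
      proof cases
        case 1
        have "y = A0"
          using y R0[OF 1] by (intro convex_hull_apex_min[of y A0 "{B1, A1}" 1]) (auto simp: A0_def A1_def B1_def)
        then show ?thesis by simp
      next
        case 2
        have "ht (Suc K) \<le> y $ 2"
          using y by (intro convex_hull_nth_ge[of y "{A0, B1, A1}"]) (auto simp: A0_def A1_def B1_def)
        then have "y = B1"
          using 2 by (intro closed_segment_apex_max[of y B1 B2 2]) (auto simp: B1_def B2_def)
        then show ?thesis by simp
      qed
    qed
  qed
  \<comment> \<open>straighten the bend at \<open>B1\<close>\<close>
  define C :: "nat \<Rightarrow> nat \<Rightarrow> real \<times> real" where "C = (\<lambda>k j. if k = 1 \<and> j = n then (?x, h) else (real j, 0))"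
  have 3: "?base \<union> {(A0, B1), (B1, B2)} = slab_closure n (word_slabs n u @ config_slabs n C 2 @ word_slabs n v)"
  proof -
    have "{1..n} = insert n {1..<n}" using n by auto
    then have "config_slabs n C 2 = [insert ((real n, 0), (?x, h)) I, insert ((?x, h), (real n, 0)) I]"
      by (auto simp: config_slabs_def strands_def upt_rec C_def I_def simp del: One_nat_def)
    then have "word_slabs n u @ config_slabs n C 2 @ word_slabs n v
        = L[K := insert ((real n, 0), (?x, h)) (L ! K), Suc K := insert ((?x, h), (real n, 0)) (L ! Suc K)]"
      unfolding LK unfolding L_def K_def by (simp add: list_update_append)
    then show ?thesis
      using slab_closure_insert_strand[of K L n "(real n, 0)" "(?x, h)" "(real n, 0)"] Km lenL
      by (simp add: A0_def B1_def B2_def)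
  qed
  have 4: "cfg_iso n 2 C (word_cfg [None])"
  proof (rule cfg_isoI[OF n])
    show "separated n 2 C (word_cfg [None])"
    proof (rule separatedI)
      fix k p q :: nat assume "k < 2" "p < q"
      then show "apart C (word_cfg [None]) k (Suc k) p q"
        by (intro apart_fst) (auto simp: C_def letter_cfg_def)
    qed
    show "C 2 ` {1..n} = stations n" by (simp add: C_def stations_def)
    show "-1 < snd (C l j) \<and> -1 < snd (word_cfg [None] l j)" for l j
      using word_cfg_z[of "[None]" l j] by (simp add: C_def h_def del: word_cfg.simps)
  qed (simp_all add: C_def letter_cfg_def)
  have "word_slabs n [None] = config_slabs n (word_cfg [None]) 2"
    using word_slabs_config[of "[None]" n] by (simp add: letters_def del: word_slabs_simps)
  then have "link_iso (slab_closure n (word_slabs n u @ config_slabs n C 2 @ word_slabs n v)) (blank_closure n (u @ [None] @ v))"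
    using 4 u v unfolding cfg_iso_def blank_closure_def by simp
  then show ?thesis
    using link_iso_trans[OF 1[unfolded eq] 2[unfolded eq' 3]] link_iso_trans by blast
qed


section \<open>Evaluating Laurent polynomials\<close>

text \<open>Sums over the supports of different polynomials are compared on a common finite set.\<close>

lemma laurent_eval_superset:
  assumes "finite A" "Poly_Mapping.keys p \<subseteq> A"
  shows "laurent_eval p s = (\<Sum>k\<in>A. of_int (Poly_Mapping.lookup p k) * s powi k)"
  unfolding laurent_eval_def using assms
  by (intro sum.mono_neutral_left) (auto simp: in_keys_iff)

lemma laurent_eval_add: "laurent_eval (p + q) s = laurent_eval p s + laurent_eval q s"
proof -
  let ?A = "Poly_Mapping.keys p \<union> Poly_Mapping.keys q"
  have "Poly_Mapping.keys (p + q) \<subseteq> ?A" by (rule Poly_Mapping.keys_add)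
  then show ?thesis
    by (simp add: laurent_eval_superset[of ?A] lookup_add distrib_right sum.distrib)
qed

lemma laurent_eval_diff: "laurent_eval (p - q) s = laurent_eval p s - laurent_eval q s"
  using laurent_eval_add[of "p - q" q s] by simp

lemma laurent_eval_single: "laurent_eval (Poly_Mapping.single k a) s = of_int a * s powi k"
  by (simp add: laurent_eval_superset[of "{k}"])

lemma laurent_eval_s_power_mult:
  assumes "s \<noteq> 0"
  shows "laurent_eval (s_power k * p) s = s powi k * laurent_eval p s"
proof (induction p rule: update_induct)
  case const
  then show ?case by (simp add: laurent_eval_def)
next
  case (update p l a)
  have "Poly_Mapping.update l a p = p + Poly_Mapping.single l a"
    using update(1) by (intro poly_mapping_eqI)
      (auto simp: lookup_add lookup_update lookup_single in_keys_iff when_def)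
  then show ?case
    using update assms
    by (simp add: distrib_left laurent_eval_add s_power_def mult_single laurent_eval_single power_int_add)
qed

lemma laurent_eval_1: "laurent_eval 1 s = 1"
  using laurent_eval_single[of 0 1 s] by simp

lemma s_power_add: "s_power k * s_power l = s_power (k + l)"
  by (simp add: s_power_def mult_single)

section \<open>Skein triples of closed braids\<close>

text \<open>Used for a face of the octahedron of a skein triple that is parallel to no coordinate plane.\<close>

lemma convex_hull_sum_ge:
  fixes S :: "point set"
  assumes x: "x \<in> convex hull S" and S: "\<And>s. s \<in> S \<Longrightarrow> M \<le> s $ i + s $ j"
  shows "M \<le> x $ i + x $ j"
proof -
  have "convex {x :: point. M \<le> x $ i + x $ j}"
    using convex_halfspace_ge[of M "axis i 1 + axis j (1 :: real)"]
    by (simp add: inner_add_left inner_axis' add.commute)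
  then have "convex hull S \<subseteq> {x. M \<le> x $ i + x $ j}" using S by (intro hull_minimal) auto
  then show ?thesis using x by auto
qed

lemma letter_slabs_blank:
  assumes i: "i \<in> {1..<n}"
  defines "J \<equiv> (\<lambda>j. ((real j, 0 :: real), (real j, 0 :: real))) ` ({1..n} - {i, Suc i})"
  shows "letter_slabs n None =
    [insert ((real (Suc i), 0), (real (Suc i), 0)) (insert ((real i, 0), (real i, 0)) J),
     insert ((real (Suc i), 0), (real (Suc i), 0)) (insert ((real i, 0), (real i, 0)) J)]"
proof -
  have "{1..n} = insert (Suc i) (insert i ({1..n} - {i, Suc i}))" using i by auto
  then have "f ` {1..n} = insert (f (Suc i)) (insert (f i) (f ` ({1..n} - {i, Suc i})))"
    for f :: "nat \<Rightarrow> (real \<times> real) \<times> (real \<times> real)" by (metis image_insert)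
  then show ?thesis unfolding letter_slabs_None J_def by simp
qed

text \<open>The strands of a crossing, or of a smoothed crossing, split off from the rest of the closed
  braid.\<close>

lemma slab_closure_two_strands:
  fixes n u v i and w1 w2 q1 q2 :: "real \<times> real" and J :: slab
  defines "K \<equiv> 2 * length u"
  shows "slab_closure n (word_slabs n u @
      [insert (p2, w2) (insert (p1, w1) J), insert (w2, q2) (insert (w1, q1) J)] @ word_slabs n v)
    = slab_closure n (word_slabs n u @ [J, J] @ word_slabs n v)
      \<union> {(lift (ht K) p1, lift (ht (Suc K)) w1), (lift (ht (Suc K)) w1, lift (ht (Suc (Suc K))) q1)}
      \<union> {(lift (ht K) p2, lift (ht (Suc K)) w2), (lift (ht (Suc K)) w2, lift (ht (Suc (Suc K))) q2)}"
proof -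
  let ?L = "\<lambda>A B. word_slabs n u @ [A, B] @ word_slabs n v"
  have upd: "?L (insert (p, w) A) (insert (w, q) B)
      = (?L A B)[K := insert (p, w) (?L A B ! K), Suc K := insert (w, q) (?L A B ! Suc K)]"
    for p w q :: "real \<times> real" and A B
    by (simp add: K_def list_update_append nth_append)
  have "Suc K < length (?L A B)" for A B by (simp add: K_def)
  then have "slab_closure n (?L (insert (p, w) A) (insert (w, q) B)) = slab_closure n (?L A B)
      \<union> {(lift (ht K) p, lift (ht (Suc K)) w), (lift (ht (Suc K)) w, lift (ht (Suc (Suc K))) q)}"
    for p w q :: "real \<times> real" and A B
    unfolding upd by (rule slab_closure_insert_strand)
  then show ?thesis by simp
qed

text \<open>A crossing of a braid word is already in the position that a skein triple asks for, once the
  subdivisions at half height of the straight strands are undone: the strand from \<open>a\<close> to \<open>d\<close> is straight,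
  and that from \<open>b\<close> to \<open>c\<close> is bent towards the viewer or away.\<close>

theorem blank_closure_skein_triple:
  assumes n: "n \<ge> 1" and uv: "set u \<subseteq> letters n" "set v \<subseteq> letters n" and i: "i \<in> {1..<n}"
  obtains Lp Lm L0 where "skein_triple Lp Lm L0"
    "link_iso (blank_closure n (u @ [Some (i, True)] @ v)) Lp"
    "link_iso (blank_closure n (u @ [Some (i, False)] @ v)) Lm"
    "link_iso (blank_closure n (u @ [None] @ v)) L0"
proof -
  define J where "J = (\<lambda>j. ((real j, 0 :: real), (real j, 0 :: real))) ` ({1..n} - {i, Suc i})"
  define K where "K = 2 * length u"
  define L where "L = word_slabs n u @ [J, J] @ word_slabs n v"
  let ?R = "slab_closure n L"
  define a where "a = lift (ht K) (real i, 0)"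
  define b where "b = lift (ht K) (real (Suc i), 0)"
  define c where "c = lift (ht (Suc (Suc K))) (real i, 0)"
  define d where "d = lift (ht (Suc (Suc K))) (real (Suc i), 0)"
  define m where "m = lift (ht (Suc K)) (real i + 1/2, 0)"
  define o' where "o' = pt 0 0 (1/2)"
  define ac where "ac = lift (ht (Suc K)) (real i, 0)"
  define bd where "bd = lift (ht (Suc K)) (real (Suc i), 0)"
  note pts = a_def b_def c_def d_def m_def o'_def ac_def bd_def
  have mo: "m + o' = lift (ht (Suc K)) (real i + 1/2, 1/2)" "m - o' = lift (ht (Suc K)) (real i + 1/2, -1/2)"
    by (simp_all add: point_eq_iff m_def o'_def)
  have ht: "ht K = ht (Suc K) + 1/2" "ht (Suc (Suc K)) = ht (Suc K) - 1/2"
    by (simp_all add: ht_def field_simps)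
  have P: "blank_closure n (u @ [Some (i, s)] @ v)
      = ?R \<union> {(a, m), (m, d)} \<union> {(b, if s then m + o' else m - o'), (if s then m + o' else m - o', c)}" for s
    unfolding blank_closure_def L_def pts(1-5) J_def K_def
    using slab_closure_two_strands[of n u "(real (Suc i), 0)" "(real i + 1/2, if s then 1/2 else -1/2)"
        "(real i, 0)" "(real i + 1/2, 0)" J "(real i, 0)" "(real (Suc i), 0)" v]
      letter_slabs_crossing[OF i, of s] mo
    by (simp add: J_def K_def m_def del: of_nat_Suc)
  have Z: "blank_closure n (u @ [None] @ v) = ?R \<union> {(a, ac), (ac, c)} \<union> {(b, bd), (bd, d)}"
    unfolding blank_closure_def L_def pts
    using slab_closure_two_strands[of n u "(real (Suc i), 0)" "(real (Suc i), 0)"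
        "(real i, 0)" "(real i, 0)" J "(real (Suc i), 0)" "(real i, 0)" v]
      letter_slabs_blank[OF i]
    by (simp add: J_def K_def del: of_nat_Suc)
  have link: "oriented_link (blank_closure n (u @ [x] @ v))" if "x \<in> {None, Some (i, True), Some (i, False)}" for x
    by (rule oriented_link_blank_closure[OF n]) (use that uv i in \<open>auto simp: letters_def\<close>)
  have lenL: "length L = K + 2 + 2 * length v" by (simp add: L_def K_def)
  have Lu: "L ! k = word_slabs n u ! k" if "k < K" for k using that by (simp add: L_def K_def nth_append)
  have LJ: "L ! K = J" "L ! Suc K = J" by (simp_all add: L_def K_def nth_append)
  have Lv: "L ! (K + 2 + k) = word_slabs n v ! k" for k by (simp add: L_def K_def nth_append)
  have pathu: "slab_path (stations n) (word_slabs n u) (stations n)"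
    and pathv: "slab_path (stations n) (word_slabs n v) (stations n)"
    using slab_path_word uv by auto
  \<comment> \<open>the rest of the link meets the octahedron only in its four corners\<close>
  have corner: "y \<in> {a, b, c, d}" if y: "y \<in> convex hull {a, b, c, d, m + o', m - o'}" "y \<in> support ?R" for y
  proof -
    have y1: "real i \<le> y $ 1" "y $ 1 \<le> real (Suc i)" and y2: "ht (Suc (Suc K)) \<le> y $ 2" "y $ 2 \<le> ht K"
      and y3: "-1/2 \<le> y $ 3"
      using y(1) by (rule convex_hull_nth_ge convex_hull_nth_le, use ht in \<open>auto simp: pts(1-4) mo\<close>)+
    \<comment> \<open>near its lower edge the octahedron is thin, so that the closing arcs below stay outside\<close>
    have y23: "ht (Suc (Suc K)) \<le> y $ 2 + y $ 3"
      using y(1) by (rule convex_hull_sum_ge) (use ht in \<open>auto simp: pts(1-4) mo\<close>)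
    have top: ?thesis if "y = lift (ht K) (real j, 0)" for j
    proof -
      have "j = i \<or> j = Suc i" using y1 that by auto
      then show ?thesis using that by (auto simp: a_def b_def)
    qed
    have bot: ?thesis if "y = lift (ht (Suc (Suc K))) (real j, 0)" for j
    proof -
      have "j = i \<or> j = Suc i" using y1 that by auto
      then show ?thesis using that by (auto simp: c_def d_def)
    qed
    obtain p q where e: "(p, q) \<in> ?R" "y \<in> closed_segment p q" using y(2) support_memE by blast
    from e(1) show ?thesis
    proof (cases rule: slab_closure_edgeE)
      case (slab k p' q')
      consider "k < K" | "k = K \<or> k = Suc K" | "Suc K < k" by linarith
      then show ?thesis
      proof cases
        case 1
        have ku: "k < length (word_slabs n u)" "(p', q') \<in> word_slabs n u ! k"
          using 1 Lu slab by (auto simp: K_def)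
        have good: "good_slab (word_slabs n u ! k)" using slab_path_nth[OF pathu ku(1)] by simp
        note X = slab_edge_points[OF good ku(2) e(2)[unfolded slab]]
        have "ht K \<le> ht (Suc k)" using 1 by simp
        then have "y $ 2 = ht (Suc k)" "ht (Suc k) = ht K" using X(2) y2 by linarith+
        then have yq: "y = lift (ht K) q'" and kK: "Suc k = K" using X(5) by auto
        have "q' \<in> stations n" using slab_path_last[OF pathu ku(2)] kK by (simp add: K_def)
        then show ?thesis using yq top by (auto simp: stations_def)
      next
        case 2
        then have "(p', q') \<in> J" using slab(2) LJ by auto
        then obtain j where j: "j \<noteq> i" "j \<noteq> Suc i" "p' = (real j, 0)" "q' = (real j, 0)"
          by (auto simp: J_def)
        then have "y $ 1 = real j" using closed_segment_nth_bounds[OF e(2), of 1] slab by simp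
        then have "i \<le> j" "j \<le> Suc i" using y1 by auto
        then show ?thesis using j by simp
      next
        case 3
        then obtain k' where k': "k = K + 2 + k'" by (metis Suc_leI add_2_eq_Suc' le_Suc_ex)
        have kv: "k' < length (word_slabs n v)" "(p', q') \<in> word_slabs n v ! k'"
          using k' Lv[of k'] slab lenL by auto
        have path: "good_slab (word_slabs n v ! k')" "fst ` (word_slabs n v ! k') = level (stations n) (word_slabs n v) k'"
          using slab_path_nth[OF pathv kv(1)] by simp_all
        note X = slab_edge_points[OF path(1) kv(2) e(2)[unfolded slab]]
        have "ht k \<le> ht (Suc (Suc K))" using k' by simp
        then have "y $ 2 = ht k" "ht k = ht (Suc (Suc K))" using X(1) y2 by linarith+
        then have yp: "y = lift (ht (Suc (Suc K))) p'" and "k' = 0" using X(4) k' by auto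
        then have "p' \<in> stations n" using path(2) kv(2) by (force simp: level_def)
        then show ?thesis using yp bot by (auto simp: stations_def)
      qed
    next
      case (arc1 j)
      note X = arc1_points[OF e(2)[unfolded arc1]]
      have "ht (length L) \<le> ht (Suc (Suc K))" using lenL by simp
      then have "y $ 2 = ht (Suc (Suc K))" using X(2) y2 by linarith
      moreover then have "y $ 3 = 0" using y23 X(4) by linarith
      ultimately show ?thesis using X(1) by (intro bot[of j]) (simp add: eq_lift_iff)
    next
      case (arc2 j)
      then show ?thesis using arc2_points(4)[OF e(2)[unfolded arc2]] y3 by simp
    next
      case (arc3 j)
      note X = arc3_points[OF e(2)[unfolded arc3]]
      have "y $ 2 = 0" "ht K = 0" using X(2) y2 ht_nonpos[of K] by linarith+
      then show ?thesis using X by (intro top[of j]) (simp add: eq_lift_iff)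
    qed
  qed
  have notR: "(p, q) \<notin> ?R" if pq: "p \<in> {m, ac, bd} \<or> q \<in> {m, ac, bd}" for p q
  proof
    assume "(p, q) \<in> ?R"
    then obtain y where y: "y \<in> {m, ac, bd}" "y \<in> support ?R"
      using pq edge_ends_in_support[of p q ?R] by blast
    have S: "{a, b, c, d} \<subseteq> convex hull {a, b, c, d, m + o', m - o'}" by (auto intro: hull_inc)
    have mid: "m = midpoint a d" "ac = midpoint a c" "bd = midpoint b d"
      using ht by (simp_all add: point_eq_iff midpoint_def pts)
    have "midpoint s t \<in> convex hull {a, b, c, d, m + o', m - o'}" if "s \<in> {a, b, c, d}" "t \<in> {a, b, c, d}" for s t
    proof -
      have "closed_segment s t \<subseteq> convex hull {a, b, c, d, m + o', m - o'}"
        using S that by (intro closed_segment_subset convex_convex_hull) auto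
      then show ?thesis by auto
    qed
    then have "y \<in> convex hull {a, b, c, d, m + o', m - o'}" using y(1) mid by auto
    then have "y \<in> {a, b, c, d}" using corner y(2) by blast
    then show False using y(1) by (auto simp: pts)
  qed
  have ne: "a \<noteq> m" "a \<noteq> d" "m \<noteq> d" "a \<noteq> c" "b \<noteq> d" "a \<noteq> b" "c \<noteq> d" "m \<noteq> m + o'" "m \<noteq> m - o'"
      "a \<noteq> m + o'" "a \<noteq> m - o'" "ac \<noteq> bd" "b \<noteq> m" "c \<noteq> m" "a \<noteq> ac" "ac \<noteq> c" "b \<noteq> bd" "bd \<noteq> d" "a \<noteq> bd" "b \<noteq> ac"
      "bd \<noteq> c" "ac \<noteq> d"
    by (auto simp: pts point_eq_iff)
  have mids: "m \<in> open_segment a d" "m \<in> open_segment b c" "ac \<in> open_segment a c" "bd \<in> open_segment b d"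
  proof -
    have "m = midpoint a d" "m = midpoint b c" "ac = midpoint a c" "bd = midpoint b d"
      using ht by (simp_all add: point_eq_iff midpoint_def pts)
    moreover have "b \<noteq> c" by (simp add: pts)
    ultimately show "m \<in> open_segment a d" "m \<in> open_segment b c" "ac \<in> open_segment a c" "bd \<in> open_segment b d"
      using ne by (metis midpoint_in_open_segment)+
  qed
  define X where "X s = (if s then m + o' else m - o')" for s
  have cross: "link_iso (blank_closure n (u @ [Some (i, s)] @ v)) (?R \<union> {(a, d), (b, X s), (X s, c)})" for s
  proof -
    have eq: "blank_closure n (u @ [Some (i, s)] @ v) = (?R \<union> {(b, X s), (X s, c)}) \<union> {(a, m), (m, d)}"
      unfolding P X_def by auto
    have eq': "?R \<union> {(a, d), (b, X s), (X s, c)} = (?R \<union> {(b, X s), (X s, c)}) \<union> {(a, d)}" by auto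
    show ?thesis unfolding eq eq'
    proof (rule link_iso_delete_collinear)
      show "oriented_link (?R \<union> {(b, X s), (X s, c)} \<union> {(a, m), (m, d)})"
        using link[of "Some (i, s)"] unfolding eq by (cases s) auto
    qed (use notR ne mids in \<open>auto simp: X_def\<close>)
  qed
  have smooth: "link_iso (blank_closure n (u @ [None] @ v)) (?R \<union> {(a, c), (b, d)})"
  proof -
    have 1: "link_iso ((?R \<union> {(b, bd), (bd, d)}) \<union> {(a, ac), (ac, c)}) ((?R \<union> {(b, bd), (bd, d)}) \<union> {(a, c)})"
    proof (rule link_iso_delete_collinear)
      show "oriented_link (?R \<union> {(b, bd), (bd, d)} \<union> {(a, ac), (ac, c)})"
        using link[of None] unfolding Z by (simp add: Un_ac insert_commute)
    qed (use notR ne mids in auto)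
    have eq: "(?R \<union> {(b, bd), (bd, d)}) \<union> {(a, c)} = (?R \<union> {(a, c)}) \<union> {(b, bd), (bd, d)}" by auto
    have 2: "link_iso ((?R \<union> {(a, c)}) \<union> {(b, bd), (bd, d)}) ((?R \<union> {(a, c)}) \<union> {(b, d)})"
    proof (rule link_iso_delete_collinear)
      show "oriented_link (?R \<union> {(a, c)} \<union> {(b, bd), (bd, d)})"
        using 1 unfolding eq by (simp add: link_iso_def)
    qed (use notR ne mids in auto)
    have "?R \<union> {(a, ac), (ac, c)} \<union> {(b, bd), (bd, d)} = (?R \<union> {(b, bd), (bd, d)}) \<union> {(a, ac), (ac, c)}"
      "(?R \<union> {(a, c)}) \<union> {(b, d)} = ?R \<union> {(a, c), (b, d)}" by auto
    then show ?thesis unfolding Z using link_iso_trans[OF 1[unfolded eq] 2] by simp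
  qed
  have "cross3 (c - b) (d - a) \<bullet> o' > 0"
    using ht by (simp add: cross3_simps pts inner_vec_def sum_3)
  note positive = this
  have "skein_triple (?R \<union> {(a, d), (b, m + o'), (m + o', c)}) (?R \<union> {(a, d), (b, m - o'), (m - o', c)})
      (?R \<union> {(a, c), (b, d)})"
    unfolding skein_triple_def
    apply (intro conjI)
    subgoal using cross[of True] by (simp add: link_iso_def X_def)
    subgoal using cross[of False] by (simp add: link_iso_def X_def)
    subgoal using smooth by (simp add: link_iso_def)
    apply (rule exI[of _ ?R], rule exI[of _ a], rule exI[of _ b], rule exI[of _ c],
        rule exI[of _ d], rule exI[of _ m], rule exI[of _ o'])
    apply (intro conjI HOL.refl mids positive)
    using corner by blast
  then have "skein_triple (?R \<union> {(a, d), (b, X True), (X True, c)}) (?R \<union> {(a, d), (b, X False), (X False, c)})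
      (?R \<union> {(a, c), (b, d)})" by (simp add: X_def)
  then show ?thesis using that cross smooth by blast
qed


section \<open>The closure of a braid word\<close>

lemma nth_concat_pairs:
  assumes "\<And>x. length (f x) = 2" "k < length w" "r < 2"
  shows "concat (map f w) ! (2 * k + r) = f (w ! k) ! r"
  using assms(2)
proof (induction w arbitrary: k)
  case (Cons x w)
  show ?case
  proof (cases k)
    case 0
    then show ?thesis using assms(1,3) by (simp add: nth_append)
  next
    case (Suc k')
    then have "concat (map f (x # w)) ! (2 * k + r) = concat (map f w) ! (2 * k' + r)"
      using assms(1) by (simp add: nth_append)
    then show ?thesis using Cons Suc by simp
  qed
qed simp

lemma UN_pairs: "(\<Union>k<2 * l. A k) = (\<Union>k<l. A (2 * k) \<union> A (Suc (2 * k)))"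
proof (induction l)
  case (Suc l)
  have "{..<2 * Suc l} = insert (2 * l) (insert (Suc (2 * l)) {..<2 * l})" by auto
  then have "(\<Union>k<2 * Suc l. A k) = A (2 * l) \<union> A (Suc (2 * l)) \<union> (\<Union>k<2 * l. A k)" by auto
  then show ?case using Suc by (simp add: lessThan_Suc)
qed simp

definition layer_straight :: "nat \<Rightarrow> nat \<Rightarrow> nat \<times> bool \<Rightarrow> polygon" where
  "layer_straight n k x = insert
     (lift (ht (2 * k)) (real (fst x), 0), lift (ht (2 * Suc k)) (real (Suc (fst x)), 0))
     ((\<lambda>j. (lift (ht (2 * k)) (real j, 0), lift (ht (2 * Suc k)) (real j, 0))) ` ({1..n} - {fst x, Suc (fst x)}))"

definition layer_over :: "nat \<Rightarrow> nat \<times> bool \<Rightarrow> polygon" where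
  "layer_over k x = (let m = lift (ht (Suc (2 * k))) (real (fst x) + 1/2, if snd x then 1/2 else -1/2) in
     {(lift (ht (2 * k)) (real (Suc (fst x)), 0), m), (m, lift (ht (2 * Suc k)) (real (fst x), 0))})"

definition edge_halves :: "point \<times> point \<Rightarrow> polygon" where
  "edge_halves e = {(fst e, midpoint (fst e) (snd e)), (midpoint (fst e) (snd e), snd e)}"

lemma lift_eq_pt: "lift y (x, z) = pt x y z"
  by (simp add: lift_def)

lemma ht_double: "ht (2 * k) = - real k" "ht (Suc (2 * k)) = - real k - 1/2"
  by (simp_all add: ht_def field_simps)

lemma braid_layer_eq: "braid_layer n k x = layer_straight n k x \<union> layer_over k x"
proof -
  obtain i b where x: "x = (i, b)" by (cases x)
  have h: "ht (2 * k) = - real k" "ht (2 * Suc k) = - real k - 1" "ht (Suc (2 * k)) = - real k - 1/2"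
    "real (Suc i) = real i + 1"
    by (simp_all add: ht_def field_simps)
  show ?thesis
    unfolding x braid_layer.simps Let_def layer_straight_def layer_over_def fst_conv snd_conv lift_eq_pt h
    unfolding Suc_eq_plus1 by blast
qed

lemma midpoint_lift: "midpoint (lift y p) (lift y' q) = lift ((y + y') / 2) ((fst p + fst q) / 2, (snd p + snd q) / 2)"
  by (simp add: point_eq_iff midpoint_def)

lemma ht_middle: "(ht (2 * k) + ht (2 * Suc k)) / 2 = ht (Suc (2 * k))"
  by (simp add: ht_def field_simps)

lemma letter_slab_edges:
  assumes "fst x \<in> {1..<n}"
  shows "slab_edges (2 * k) (letter_slabs n (Some x) ! 0) \<union> slab_edges (Suc (2 * k)) (letter_slabs n (Some x) ! 1)
    = layer_over k x \<union> (\<Union>e\<in>layer_straight n k x. edge_halves e)"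
proof -
  obtain i b where x: "x = (i, b)" by (cases x)
  have i: "i \<in> {1..<n}" using assms x by simp
  have half: "edge_halves (lift (ht (2 * k)) (real j, 0), lift (ht (2 * Suc k)) (real j, 0))
      = {(lift (ht (2 * k)) (real j, 0), lift (ht (Suc (2 * k))) (real j, 0)),
         (lift (ht (Suc (2 * k))) (real j, 0), lift (ht (Suc (Suc (2 * k)))) (real j, 0))}" for j
    unfolding edge_halves_def fst_conv snd_conv midpoint_lift ht_middle by simp
  have half': "edge_halves (lift (ht (2 * k)) (real i, 0), lift (ht (2 * Suc k)) (real (Suc i), 0))
      = {(lift (ht (2 * k)) (real i, 0), lift (ht (Suc (2 * k))) (real i + 1/2, 0)),
         (lift (ht (Suc (2 * k))) (real i + 1/2, 0), lift (ht (Suc (Suc (2 * k)))) (real (Suc i), 0))}"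
    unfolding edge_halves_def fst_conv snd_conv midpoint_lift ht_middle by (simp add: field_simps)
  let ?A = "{1..n} - {i, Suc i}"
  let ?f = "\<lambda>j. (lift (ht (2 * k)) (real j, 0), lift (ht (Suc (2 * k))) (real j, 0))"
    and ?g = "\<lambda>j. (lift (ht (Suc (2 * k))) (real j, 0), lift (ht (Suc (Suc (2 * k)))) (real j, 0))"
  have two: "2 * Suc k = Suc (Suc (2 * k))" by simp
  have ins: "slab_edges l (insert (p, q) S) = insert (lift (ht l) p, lift (ht (Suc l)) q) (slab_edges l S)" for l p q S
    by (simp add: slab_edges_def)
  have img: "slab_edges l ((\<lambda>j. ((real j, 0), (real j, 0))) ` B)
      = (\<lambda>j. (lift (ht l) (real j, 0), lift (ht (Suc l)) (real j, 0))) ` B" for l B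
    by (simp add: slab_edges_def image_image)
  have straight: "(\<Union>e\<in>layer_straight n k (i, b). edge_halves e)
      = {(lift (ht (2 * k)) (real i, 0), lift (ht (Suc (2 * k))) (real i + 1/2, 0)),
         (lift (ht (Suc (2 * k))) (real i + 1/2, 0), lift (ht (Suc (Suc (2 * k)))) (real (Suc i), 0))}
        \<union> (\<Union>j\<in>?A. {?f j, ?g j})"
    unfolding layer_straight_def fst_conv UN_insert half' UN_simps(10) half ..
  have UN: "(\<Union>j\<in>?A. {?f j, ?g j}) = ?f ` ?A \<union> ?g ` ?A" by blast
  show ?thesis
    unfolding x straight UN unfolding letter_slabs_crossing[OF i] nth_Cons_0 nth_Cons_Suc One_nat_def ins img
      layer_over_def Let_def fst_conv snd_conv two
    by blast
qed

text \<open>The midpoints of the straight strands are recognized by being at depth zero and at the middle of a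
  layer, where the original polygon has no vertices.\<close>

theorem link_iso_braid_closure:
  assumes n: "n \<ge> 1" and u: "u \<in> braid_words n"
  shows "link_iso (blank_closure n (map Some u)) (braid_closure n u)"
proof -
  let ?l = "length u"
  define J where "J = (\<Union>k<?l. layer_straight n k (u ! k))"
  define X where "X = (\<Union>k<?l. layer_over k (u ! k)) \<union> (\<Union>j\<in>{1..n}. arc_edges (2 * ?l) j)"
  \<comment> \<open>where the midpoints of straight strands are, but no vertex of the braid closure\<close>
  define special where "special p \<longleftrightarrow> p $ 3 = 0 \<and> (\<exists>k. p $ 2 = ht (Suc (2 * k)))" for p :: point
  have letter: "fst (u ! k) \<in> {1..<n}" if "k < ?l" for k
    using u nth_mem[OF that] by (auto simp: braid_words_def)
  have set: "set (map Some u) \<subseteq> letters n" using u by (auto simp: braid_words_def letters_def)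
  have "closing_arc ?l j = arc_edges (2 * ?l) j" for j
    unfolding closing_arc_def arc_edges_def lift_eq_pt ht_double ..
  then have orig: "braid_closure n u = X \<union> J"
    unfolding braid_closure_def braid_layer_eq X_def J_def by auto
  have "(\<Union>k<2 * ?l. slab_edges k (word_slabs n (map Some u) ! k))
      = (\<Union>k<?l. layer_over k (u ! k) \<union> (\<Union>e\<in>layer_straight n k (u ! k). edge_halves e))"
  proof -
    have "slab_edges (2 * k) (word_slabs n (map Some u) ! (2 * k)) \<union>
        slab_edges (Suc (2 * k)) (word_slabs n (map Some u) ! Suc (2 * k))
        = layer_over k (u ! k) \<union> (\<Union>e\<in>layer_straight n k (u ! k). edge_halves e)" if k: "k < ?l" for k
      using letter_slab_edges[OF letter[OF k], of k] k
        nth_concat_pairs[of "letter_slabs n" k "map Some u" 0] nth_concat_pairs[of "letter_slabs n" k "map Some u" 1]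
      by (simp add: word_slabs_def)
    then show ?thesis unfolding UN_pairs by (intro SUP_cong) auto
  qed
  then have sub: "blank_closure n (map Some u) = X \<union> (\<Union>e\<in>J. edge_halves e)"
    unfolding blank_closure_def slab_closure_def X_def J_def by auto
  have odd_even: "ht (2 * k) \<noteq> ht (Suc (2 * k'))" for k k' by (simp, presburger)
  have J_ends: "\<exists>k i j. e = (lift (ht (2 * k)) (real i, 0), lift (ht (2 * Suc k)) (real j, 0))" if "e \<in> J" for e
    using that unfolding J_def layer_straight_def by blast
  have J_plain: "\<not> special (fst e) \<and> \<not> special (snd e)" if "e \<in> J" for e
    using J_ends[OF that] odd_even unfolding special_def by (metis fst_conv lift_nth(2) snd_conv)
  have X_plain: "\<not> special (fst e) \<and> \<not> special (snd e)" if e: "e \<in> X" for e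
  proof -
    consider k where "e \<in> layer_over k (u ! k)" | j where "e \<in> arc_edges (2 * ?l) j"
      using e unfolding X_def by blast
    then show ?thesis
    proof cases
      case 1
      then show ?thesis using odd_even unfolding layer_over_def Let_def special_def
        by (auto simp del: ht_eq_iff mult_Suc_right split: if_splits)
    next
      case 2
      then show ?thesis using odd_even[of ?l] odd_even[of 0] ht_neq_1 unfolding arc_edges_def special_def
        by (auto simp del: ht_eq_iff)
    qed
  qed
  have mid: "special (midpoint (fst e) (snd e))" if eJ: "e \<in> J" for e
  proof -
    obtain k i j where e: "e = (lift (ht (2 * k)) (real i, 0), lift (ht (2 * Suc k)) (real j, 0))"
      using J_ends[OF eJ] by blast
    show ?thesis unfolding e fst_conv snd_conv midpoint_lift ht_middle special_def by auto
  qed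
  have "link_iso (X \<union> (\<Union>e\<in>J. {(fst e, midpoint (fst e) (snd e)), (midpoint (fst e) (snd e), snd e)})) (X \<union> J)"
  proof (rule link_iso_merge_edges)
    show "finite J" unfolding J_def layer_straight_def by auto
    show "oriented_link (X \<union> (\<Union>e\<in>J. {(fst e, midpoint (fst e) (snd e)), (midpoint (fst e) (snd e), snd e)}))"
      using oriented_link_blank_closure[OF n set] unfolding sub edge_halves_def .
    fix e assume e: "e \<in> J"
    have "fst e \<noteq> snd e" using J_ends[OF e] by auto
    then show "midpoint (fst e) (snd e) \<in> open_segment (fst e) (snd e)" by simp
    show "{(fst e, midpoint (fst e) (snd e)), (midpoint (fst e) (snd e), snd e)} \<inter> (X \<union> J) = {}"
      using mid[OF e] X_plain J_plain by force
    fix e' assume e': "e' \<in> J" "e \<noteq> e'"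
    show "{(fst e, midpoint (fst e) (snd e)), (midpoint (fst e) (snd e), snd e)} \<inter>
      {(fst e', midpoint (fst e') (snd e')), (midpoint (fst e') (snd e'), snd e')} = {}"
    proof -
      have "fst e \<noteq> midpoint (fst e') (snd e')" "midpoint (fst e) (snd e) \<noteq> fst e'"
        using J_plain[OF e] J_plain[OF e'(1)] mid[OF e] mid[OF e'(1)] by auto
      moreover have "e = e'" if "midpoint (fst e) (snd e) = midpoint (fst e') (snd e')" "fst e = fst e' \<or> snd e = snd e'"
        using that by (auto simp: prod_eq_iff midpoint_def)
      ultimately show ?thesis using e'(2) by auto
    qed
  qed
  then show ?thesis unfolding orig sub edge_halves_def .
qed

section \<open>The Jones polynomial as a skein functional\<close>

lemma jones_link_iso: "jones_polynomial V \<Longrightarrow> link_iso E E' \<Longrightarrow> V E = V E'"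
  unfolding jones_polynomial_def link_iso_def by blast

lemma unknot_blank_closure: "unknot (blank_closure 1 [])"
proof -
  let ?a = "lift 0 (1, 0)" and ?b = "lift 0 (1, -1)" and ?p = "lift 1 (1, -1)"
  have "blank_closure 1 [] = {(?a, ?b), (?b, ?p), (?p, ?a)}"
    by (simp add: blank_closure_def slab_closure_def arc_edges_def)
  moreover have "\<not> collinear {?a, ?b, ?p}"
  proof
    assume "collinear {?a, ?b, ?p}"
    then have "collinear {0, ?a - ?b, ?p - ?b}" by (simp add: collinear_3)
    then obtain c where "?a = ?b \<or> ?p = ?b \<or> ?p - ?b = c *\<^sub>R (?a - ?b)"
      by (auto simp: collinear_lemma)
    then show False by (auto simp: point_eq_iff)
  qed
  ultimately show ?thesis unfolding unknot_def isotopic_def by (metis equivclp_refl)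
qed

text \<open>The factor $s + 1/s$ is chosen for the value at the trivial braid with one strand. The relation for
  a split strand follows from the skein relation at a stabilizing crossing, whose two signs give the
  same link. It has to be divided by $s^{-1} - s$, and this is done before the evaluation, where the
  factor may become zero.\<close>

theorem jones_skein_functional:
  assumes V: "jones_polynomial V" and s: "s \<noteq> 0"
  shows "skein_functional s (\<lambda>n w. (s + 1 / s) * laurent_eval (V (blank_closure n (map Some w))) s)"
proof
  let ?W = "\<lambda>n w. V (blank_closure n (map Some w))"
  let ?F = "\<lambda>n w. (s + 1 / s) * laurent_eval (?W n w) s"
  have letters: "set (map Some u) \<subseteq> letters n" if "u \<in> braid_words n" for u n
    using that by (auto simp: braid_words_def letters_def)
  have inv: "link_iso E E' \<Longrightarrow> V E = V E'" for E E' by (rule jones_link_iso[OF V])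
  have skein: "s_power (-2) * ?W n (u @ (i, True) # v) - s_power 2 * ?W n (u @ (i, False) # v)
      = (s_power (-1) - s_power 1) * ?W n (u @ v)"
    if u: "u \<in> braid_words n" "v \<in> braid_words n" and i: "i \<in> {1..<n}" for u v n i
  proof -
    have n: "n \<ge> 1" using i by simp
    obtain Lp Lm L0 where L: "skein_triple Lp Lm L0"
      "link_iso (blank_closure n (map Some u @ [Some (i, True)] @ map Some v)) Lp"
      "link_iso (blank_closure n (map Some u @ [Some (i, False)] @ map Some v)) Lm"
      "link_iso (blank_closure n (map Some u @ [None] @ map Some v)) L0"
      using blank_closure_skein_triple[OF n letters[OF u(1)] letters[OF u(2)] i] by blast
    have "s_power (-2) * V Lp - s_power 2 * V Lm = (s_power (-1) - s_power 1) * V L0"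
      using V L(1) unfolding jones_polynomial_def by blast
    then show ?thesis
      using inv[OF L(2)] inv[OF L(3)] inv[OF L(4)]
        inv[OF blank_closure_drop_blank[OF n letters[OF u(1)] letters[OF u(2)]]] by simp
  qed
  have stabilize: "?W (Suc n) (u @ (n, b) # v) = ?W n (u @ v)"
    if u: "u \<in> braid_words n" "v \<in> braid_words n" and n: "n \<ge> 1" for u v n b
    using inv[OF blank_closure_stabilize[OF n letters[OF u(1)] letters[OF u(2)], of b]]
      inv[OF blank_closure_drop_blank[OF n letters[OF u(1)] letters[OF u(2)]]] by simp
  show "s \<noteq> 0" by (rule s)
  fix u v n i j b
  show "?F n (u @ (i, True) # v) / s\<^sup>2 -
      s\<^sup>2 * ?F n (u @ (i, False) # v)
      = (1 / s - s) * ?F n (u @ v)"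
    if "u \<in> braid_words n" "v \<in> braid_words n" "i \<in> {1..<n}"
  proof -
    have "laurent_eval (s_power (-2) * ?W n (u @ (i, True) # v) - s_power 2 * ?W n (u @ (i, False) # v)) s
        = laurent_eval (s_power (-1) * ?W n (u @ v) - s_power 1 * ?W n (u @ v)) s"
      using skein[OF that] by (simp add: left_diff_distrib)
    then have "laurent_eval (?W n (u @ (i, True) # v)) s / s\<^sup>2 - s\<^sup>2 * laurent_eval (?W n (u @ (i, False) # v)) s
        = (1 / s - s) * laurent_eval (?W n (u @ v)) s"
      by (simp add: laurent_eval_diff laurent_eval_s_power_mult[OF s] power_int_minus divide_inverse
          left_diff_distrib mult.commute)
    then have "(s + 1 / s) * (laurent_eval (?W n (u @ (i, True) # v)) s / s\<^sup>2 - s\<^sup>2 * laurent_eval (?W n (u @ (i, False) # v)) s)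
        = (s + 1 / s) * ((1 / s - s) * laurent_eval (?W n (u @ v)) s)" by simp
    then show ?thesis by (simp add: right_diff_distrib mult.left_commute mult.commute)
  qed
  show "?F n (u @ [(i, True), (i, False)] @ v) = ?F n (u @ v)"
    if u: "u \<in> braid_words n" "v \<in> braid_words n" and i: "i \<in> {1..<n}"
  proof -
    have n: "n \<ge> 1" using i by simp
    note lu = letters[OF u(1)] and lv = letters[OF u(2)]
    have "set (None # map Some v) \<subseteq> letters n" using lv by (auto simp: letters_def)
    from link_iso_trans[OF blank_closure_drop_blank[OF n lu this] blank_closure_drop_blank[OF n lu lv]]
    have "link_iso (blank_closure n (map Some u @ [None, None] @ map Some v)) (blank_closure n (map Some u @ map Some v))"
      by simp
    from link_iso_trans[OF blank_closure_cancel[OF n lu lv i, of True] this] show ?thesis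
      using inv by simp
  qed
  show "?F n (u @ [(i, True), (j, True)] @ v)
      = ?F n (u @ [(j, True), (i, True)] @ v)"
    if u: "u \<in> braid_words n" "v \<in> braid_words n" and i: "i \<in> {1..<n}" "j \<in> {1..<n}" and far: "1 < \<bar>int i - int j\<bar>"
    using inv[OF blank_closure_commute[OF _ letters[OF u(1)] letters[OF u(2)] i far]] i by simp
  show "?F n (u @ [(i, True), (Suc i, True), (i, True)] @ v)
      = ?F n (u @ [(Suc i, True), (i, True), (Suc i, True)] @ v)"
    if u: "u \<in> braid_words n" "v \<in> braid_words n" and i: "i \<in> {1..<n}" "Suc i \<in> {1..<n}"
    using inv[OF blank_closure_braid[OF _ letters[OF u(1)] letters[OF u(2)] i]] i by simp
  show "?F (Suc n) (u @ (n, b) # v) = ?F n (u @ v)"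
    if "u \<in> braid_words n" "v \<in> braid_words n" "n \<ge> 1"
    using stabilize[OF that] by simp
  show "?F (Suc n) u = (s + 1 / s) * ?F n u"
    if u: "u \<in> braid_words n" and n: "n \<ge> 1"
  proof -
    have u': "u \<in> braid_words (Suc n)" "[] \<in> braid_words (Suc n)" "[] \<in> braid_words n"
      using u by (auto simp: braid_words_def)
    have "(s_power (-1) - s_power 1) * ?W (Suc n) u = s_power (-2) * ?W n u - s_power 2 * ?W n u"
      using skein[OF u'(1,2), of n] stabilize[OF u u'(3) n] n by simp
    also have "\<dots> = (s_power (-1) - s_power 1) * (s_power (-1) * ?W n u + s_power 1 * ?W n u)"
      by (simp add: algebra_simps s_power_add flip: mult.assoc)
    finally have "(s_power (-1) - s_power 1) * (?W (Suc n) u - (s_power (-1) * ?W n u + s_power 1 * ?W n u)) = 0"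
      by (simp add: right_diff_distrib)
    moreover have "s_power (-1) - s_power 1 \<noteq> 0"
    proof
      assume "s_power (-1) - s_power 1 = 0"
      then have "Poly_Mapping.lookup (s_power (-1)) (-1) = Poly_Mapping.lookup (s_power 1) (-1)" by simp
      then show False by (simp add: s_power_def lookup_single when_def)
    qed
    ultimately have "?W (Suc n) u = s_power (-1) * ?W n u + s_power 1 * ?W n u" by simp
    then have "laurent_eval (?W (Suc n) u) s = (s + 1 / s) * laurent_eval (?W n u) s"
      by (simp add: laurent_eval_add laurent_eval_s_power_mult[OF s] power_int_minus divide_inverse algebra_simps)
    then show ?thesis by simp
  qed
qed

theorem theorem3p7:
  fixes c d s :: complex and n :: nat
    and V :: "polygon \<Rightarrow> laurent"
    and \<phi> :: "braid_word set \<Rightarrow> rook_diagram \<Rightarrow> complex"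
    and x :: "braid_word set" and u :: braid_word
  assumes "c \<noteq> 0" and "d \<noteq> 0" and "c * d \<noteq> -1" and "s ^ 2 = c * d"
    and "jones_polynomial V"
    and "n \<ge> 1"
    and "\<phi> \<in> hom (braid_group n) (units_of (planar_rook_algebra n))"
    and "\<And>i. i \<in> {1..<n} \<Longrightarrow> \<phi> (braid_gen n i) = phi5_gen c d n i"
    and "x \<in> carrier (braid_group n)" and "u \<in> x"
  shows "Tr5 c d s \<phi> n x = (1 + c * d) / s * laurent_eval (V (braid_closure n u)) s"
  proof -
  have s: "s \<noteq> 0" using assms(1,2,4) by auto
  have factor: "(1 + c * d) / s = s + 1 / s"
    using s by (simp add: field_simps power2_eq_square flip: assms(4))
  have u: "u \<in> braid_words n" using carrier_braid_group_class assms(9,10) by blast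
  let ?F = "\<lambda>n w. s powi (word_writhe w + int n) * state_sum c d n w"
  let ?G = "\<lambda>n w. (s + 1 / s) * laurent_eval (V (blank_closure n (map Some w))) s"
  have "V (blank_closure 1 []) = 1"
    using unknot_blank_closure assms(5) unfolding jones_polynomial_def by blast
  moreover have "s * (1 + 1 / (c * d)) = s + 1 / s"
    using s by (simp add: field_simps power2_eq_square flip: assms(4))
  ultimately have base: "?F 1 [] = ?G 1 []"
    using state_sum_trivial[of c d] by (simp add: laurent_eval_1)
  have "Tr5 c d s \<phi> n x = ?F n u"
    by (rule Tr5_eq_state_sum[OF assms(1,2,7-10)])
  also have "\<dots> = ?G n u"
    by (rule skein_functional_unique[OF state_sum_skein_functional[OF assms(1,2,4)]
          jones_skein_functional[OF assms(5) s] base u assms(6)])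
  also have "V (blank_closure n (map Some u)) = V (braid_closure n u)"
    by (rule jones_link_iso[OF assms(5) link_iso_braid_closure[OF assms(6) u]])
  finally show ?thesis unfolding factor .
qed

end
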